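(* Let $\mathcal{H}=(C,F,D,G)$ be a hybrid system on $\mathbb{R}^n$ satisfying the Basic Assumptions, and let $\Gamma_1\subset\Gamma_2\subset\mathbb{R}^n$ with $\Gamma_1$ compact and $\Gamma_2$ closed. Then $\Gamma_1$ is asymptotically stable for $\mathcal{H}$ if and only if (i) $\Gamma_1$ is asymptotically stable relative to $\Gamma_2$, (ii) $\Gamma_2$ is locally stable near $\Gamma_1$, and (iii) $\Gamma_2$ is locally attractive near $\Gamma_1$. Moreover, $\Gamma_1$ is globally asymptotically stable for $\mathcal{H}$ if and only if (i') $\Gamma_1$ is globally asymptotically stable relative to $\Gamma_2$, (ii') $\Gamma_2$ is locally stable near $\Gamma_1$, (iii') $\Gamma_2$ is globally attractive for $\mathcal{H}$, and (iv') all solutions of $\mathcal{H}$ are bounded.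
   Context: Notation: $|x|_\Gamma=\inf_{y\in\Gamma}|x-y|$ and, for $c>0$, $B_c(\Gamma)=\{x\in\mathbb{R}^n:|x|_\Gamma<c\}$. Hybrid system: a 4-tuple $\mathcal{H}=(C,F,D,G)$ satisfying the Basic Assumptions: (A1) $C,D$ are closed subsets of $\mathbb{R}^n$; (A2) $F:\mathbb{R}^n\rightrightarrows\mathbb{R}^n$ is a set-valued map that is outer semicontinuous, locally bounded on $C$, with $F(x)$ nonempty and convex for each $x\in C$; (A3) $G:\mathbb{R}^n\rightrightarrows\mathbb{R}^n$ is outer semicontinuous, locally bounded on $D$, with $G(x)$ nonempty for each $x\in D$. Solutions: a hybrid time domain is a subset of $\mathbb{R}_{\ge0}\times\mathbb{N}$ that is a union of infinitely many sets $[t_j,t_{j+1}]\times\{j\}$, $j\in\mathbb{N}$, or of finitely many such sets with the last one of the form $[t_j,t_{j+1}]\times\{j\}$, $[t_j,t_{j+1})\times\{j\}$ or $[t_j,\infty)\times\{j\}$, where $0=t_0\le t_1\le\cdots$. A hybrid arc is a function $x:\mathrm{dom}(x)\to\mathbb{R}^n$ on a hybrid time domain such that for each $j$ the map $t\mapsto x(t,j)$ is locally absolutely continuous on $I_j=\{t:(t,j)\in\mathrm{dom}(x)\}$. A solution of $\mathcal{H}$ is a hybrid arc such that: for each $j$ for which $I_j$ has nonempty interior, $\dot x(t,j)\in F(x(t,j))$ for almost all $t\in I_j$ and $x(t,j)\in C$ for all $t\in[\min I_j,\sup I_j)$; and whenever $(t,j),(t,j+1)\in\mathrm{dom}(x)$,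 $x(t,j)\in D$ and $x(t,j+1)\in G(x(t,j))$. (From a point outside $C\cup D$ the only solution is the trivial one with domain $\{(0,0)\}$.) All solutions considered are maximal (cannot be extended). A solution is complete if its domain is unbounded, and bounded if its range is bounded. $\mathcal{S}_{\mathcal{H}}(x_0)$ is the set of maximal solutions with $x(0,0)=x_0$, $\mathcal{S}_{\mathcal{H}}(U)=\bigcup_{x_0\in U}\mathcal{S}_{\mathcal{H}}(x_0)$, and $\mathrm{rge}(\mathcal{S}_{\mathcal{H}}(U))$ is the union of the ranges of the solutions in $\mathcal{S}_{\mathcal{H}}(U)$. Write $(s,k)\preceq(t,j)$ if $s\le t$ and $k\le j$. Compact $\Gamma$: $\Gamma$ is stable for $\mathcal{H}$ if for every $\varepsilon>0$ there is $\delta>0$ with $\mathrm{rge}(\mathcal{S}_{\mathcal{H}}(B_\delta(\Gamma)))\subset B_\varepsilon(\Gamma)$. The basin of attraction of $\Gamma$ is the set of points $p\in\mathbb{R}^n$ such that each $x\in\mathcal{S}_{\mathcal{H}}(p)$ is bounded and, if $x$ is complete, $|x(t,j)|_\Gamma\to0$ as $t+j\to\infty$, $(t,j)\in\mathrm{dom}(x)$. Closed $\Gamma$: the basin of attraction of $\Gamma$ is the set of $p\in\mathbb{R}^n$ such that for each $x\in\mathcal{S}_{\mathcal{H}}(p)$, $|x|_\Gamma$ is bounded and, if $x$ is complete, $|x(t,j)|_\Gamma\to0$ as $t+j\to\infty$. In both cases, $\Gamma$ is attractive if its basin of attraction contains $\Gamma$ in its interior; globally attractive if its basin of attraction is $\mathbb{R}^n$;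 (globally) asymptotically stable if stable and (globally) attractive. Relative properties: for a closed set $\Gamma_2$, the restriction of $\mathcal{H}$ to $\Gamma_2$ is $\mathcal{H}|_{\Gamma_2}=(C\cap\Gamma_2,F,D\cap\Gamma_2,G)$. $\Gamma_1\subset\Gamma_2$ has a property relative to $\Gamma_2$ if it has that property for $\mathcal{H}|_{\Gamma_2}$. Local properties near a set: let $\Gamma_1\subset\Gamma_2$ with $\Gamma_1$ compact. $\Gamma_2$ is locally stable near $\Gamma_1$ for $\mathcal{H}$ if there exists $r>0$ such that for every $\varepsilon>0$ there exists $\delta>0$ such that, for each $x\in\mathcal{S}_{\mathcal{H}}(B_\delta(\Gamma_1))$ and each $(t,j)\in\mathrm{dom}(x)$: if $x(s,k)\in B_r(\Gamma_1)$ for all $(s,k)\in\mathrm{dom}(x)$ with $(s,k)\preceq(t,j)$, then $x(t,j)\in B_\varepsilon(\Gamma_2)$. $\Gamma_2$ is locally attractive near $\Gamma_1$ for $\mathcal{H}$ if there exists $r>0$ such that $B_r(\Gamma_1)$ is contained in the basin of attraction of $\Gamma_2$. *)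

theory Defs
  imports "HOL-Analysis.Analysis"
begin

(* The infimum is taken in the extended reals, so that the distance to the empty set is infinity
   and the neighbourhoods of the empty set are empty (infdist x {} is 0 by convention). *)
definition setdistance :: "'a::metric_space \<Rightarrow> 'a set \<Rightarrow> ereal" where
  "setdistance x \<Gamma> = (INF y\<in>\<Gamma>. ereal (dist x y))"

lemma setdistance_eq_infdist:
  assumes "\<Gamma> \<noteq> {}"
  shows "setdistance x \<Gamma> = ereal (infdist x \<Gamma>)"
proof (rule antisym)
  show "setdistance x \<Gamma> \<le> ereal (infdist x \<Gamma>)"
  proof (rule ereal_le_epsilon2)
    fix e :: real
    assume "0 < e"
    then obtain y where "y \<in> \<Gamma>" "dist x y < infdist x \<Gamma> + e"
      using assms cInf_lessD[of "dist x ` \<Gamma>" "infdist x \<Gamma> + e"] by (auto simp: infdist_def)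
    then show "setdistance x \<Gamma> \<le> ereal (infdist x \<Gamma>) + ereal e"
      unfolding setdistance_def by (intro INF_lower2[of y]) auto
  qed
  show "ereal (infdist x \<Gamma>) \<le> setdistance x \<Gamma>"
    unfolding setdistance_def by (intro INF_greatest) (simp add: infdist_le)
qed

definition set_ball :: "'a::metric_space set \<Rightarrow> real \<Rightarrow> 'a set" where
  "set_ball \<Gamma> c = {x. setdistance x \<Gamma> < ereal c}"

record 'a hybrid_system =
  flow_set :: "'a set"
  flow_map :: "'a \<Rightarrow> 'a set"
  jump_set :: "'a set"
  jump_map :: "'a \<Rightarrow> 'a set"

definition outer_semicontinuous :: "('a::metric_space \<Rightarrow> 'b::metric_space set) \<Rightarrow> bool" where
  "outer_semicontinuous M \<longleftrightarrow>
     (\<forall>x y u v. u \<longlonglongrightarrow> x \<longrightarrow> (\<forall>i::nat. v i \<in> M (u i)) \<longrightarrow> v \<longlonglongrightarrow> y \<longrightarrow> y \<in> M x)"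

definition locally_bounded_on ::
  "'a::metric_space set \<Rightarrow> ('a \<Rightarrow> 'b::metric_space set) \<Rightarrow> bool" where
  "locally_bounded_on S M \<longleftrightarrow>
     (\<forall>x\<in>S. \<exists>U. open U \<and> x \<in> U \<and> bounded (\<Union>y\<in>U \<inter> S. M y))"

definition basic_assumptions :: "'a::euclidean_space hybrid_system \<Rightarrow> bool" where
  "basic_assumptions H \<longleftrightarrow>
     closed (flow_set H) \<and> closed (jump_set H) \<and>
     outer_semicontinuous (flow_map H) \<and> locally_bounded_on (flow_set H) (flow_map H) \<and>
     (\<forall>x\<in>flow_set H. flow_map H x \<noteq> {} \<and> convex (flow_map H x)) \<and>
     outer_semicontinuous (jump_map H) \<and> locally_bounded_on (jump_set H) (jump_map H) \<and>
     (\<forall>x\<in>jump_set H. jump_map H x \<noteq> {})"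

definition restriction :: "'a hybrid_system \<Rightarrow> 'a set \<Rightarrow> 'a hybrid_system" where
  "restriction H \<Gamma> = H\<lparr>flow_set := flow_set H \<inter> \<Gamma>, jump_set := jump_set H \<inter> \<Gamma>\<rparr>"

(* The strict inequality in the half-open case only excludes an empty last piece,
   hence only the empty domain. *)
definition hybrid_time_domain :: "(real \<times> nat) set \<Rightarrow> bool" where
  "hybrid_time_domain E \<longleftrightarrow>
     (\<exists>t::nat \<Rightarrow> real. t 0 = 0 \<and> mono t \<and>
       (E = (\<Union>j. {t j..t (Suc j)} \<times> {j}) \<or>
        (\<exists>J L. E = (\<Union>j<J. {t j..t (Suc j)} \<times> {j}) \<union> L \<times> {J} \<and>
          (L = {t J..t (Suc J)} \<or>
           (t J < t (Suc J) \<and> L = {t J..<t (Suc J)}) \<or>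
           L = {t J..}))))"

definition abs_continuous_on :: "real set \<Rightarrow> (real \<Rightarrow> 'a::real_normed_vector) \<Rightarrow> bool" where
  "abs_continuous_on S f \<longleftrightarrow>
     (\<forall>\<epsilon>>0. \<exists>\<delta>>0. \<forall>\<D> T. \<D> division_of T \<longrightarrow> T \<subseteq> S \<longrightarrow> (\<Sum>K\<in>\<D>. Sup K - Inf K) < \<delta> \<longrightarrow>
        (\<Sum>K\<in>\<D>. norm (f (Sup K) - f (Inf K))) < \<epsilon>)"

definition locally_abs_continuous_on ::
  "real set \<Rightarrow> (real \<Rightarrow> 'a::real_normed_vector) \<Rightarrow> bool" where
  "locally_abs_continuous_on I f \<longleftrightarrow> (\<forall>a b. {a..b} \<subseteq> I \<longrightarrow> abs_continuous_on {a..b} f)"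

type_synonym 'a arc = "real \<times> nat \<rightharpoonup> 'a"

definition time_section :: "'a arc \<Rightarrow> nat \<Rightarrow> real set" where
  "time_section x j = {t. (t, j) \<in> dom x}"

definition hybrid_arc :: "'a::euclidean_space arc \<Rightarrow> bool" where
  "hybrid_arc x \<longleftrightarrow>
     hybrid_time_domain (dom x) \<and>
     (\<forall>j. locally_abs_continuous_on (time_section x j) (\<lambda>t. the (x (t, j))))"

(* "t < s for some s in I" says t < sup I, where sup I may be infinite. *)
definition is_solution :: "'a::euclidean_space hybrid_system \<Rightarrow> 'a arc \<Rightarrow> bool" where
  "is_solution H x \<longleftrightarrow>
     hybrid_arc x \<and>
     (\<forall>j. let I = time_section x j in
        interior I \<noteq> {} \<longrightarrow>
          (AE t in lebesgue. t \<in> I \<longrightarrow>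
             (\<exists>v \<in> flow_map H (the (x (t, j))).
                ((\<lambda>s. the (x (s, j))) has_vector_derivative v) (at t within I))) \<and>
          (\<forall>t\<in>I. (\<exists>s\<in>I. t < s) \<longrightarrow> the (x (t, j)) \<in> flow_set H)) \<and>
     (\<forall>t j. (t, j) \<in> dom x \<longrightarrow> (t, Suc j) \<in> dom x \<longrightarrow>
        the (x (t, j)) \<in> jump_set H \<and> the (x (t, Suc j)) \<in> jump_map H (the (x (t, j))))"

definition maximal_solution :: "'a::euclidean_space hybrid_system \<Rightarrow> 'a arc \<Rightarrow> bool" where
  "maximal_solution H x \<longleftrightarrow>
     is_solution H x \<and> (\<forall>y. is_solution H y \<longrightarrow> x \<subseteq>\<^sub>m y \<longrightarrow> y = x)"

definition solutions :: "'a::euclidean_space hybrid_system \<Rightarrow> 'a set \<Rightarrow> 'a arc set" where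
  "solutions H U = {x. maximal_solution H x \<and> (\<exists>x0\<in>U. x (0, 0) = Some x0)}"

definition complete_arc :: "'a arc \<Rightarrow> bool" where
  "complete_arc x \<longleftrightarrow> \<not> bounded ((\<lambda>(t, j). (t, real j)) ` dom x)"

definition bounded_arc :: "'a::metric_space arc \<Rightarrow> bool" where
  "bounded_arc x \<longleftrightarrow> bounded (ran x)"

definition stable :: "'a::euclidean_space hybrid_system \<Rightarrow> 'a set \<Rightarrow> bool" where
  "stable H \<Gamma> \<longleftrightarrow>
     (\<forall>\<epsilon>>0. \<exists>\<delta>>0. (\<Union>x\<in>solutions H (set_ball \<Gamma> \<delta>). ran x) \<subseteq> set_ball \<Gamma> \<epsilon>)"

definition converges_to :: "'a::metric_space arc \<Rightarrow> 'a set \<Rightarrow> bool" where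
  "converges_to x \<Gamma> \<longleftrightarrow>
     ((\<lambda>p. setdistance (the (x p)) \<Gamma>) \<longlongrightarrow> 0)
       (inf (filtercomap (\<lambda>(t, j). t + real j) at_top) (principal (dom x)))"

(* Compact and merely closed sets have separate definitions. For a nonempty compact set the two
   boundedness conditions agree; for the empty set they do not, and the compact one applies. *)
definition basin_of_attraction :: "'a::euclidean_space hybrid_system \<Rightarrow> 'a set \<Rightarrow> 'a set" where
  "basin_of_attraction H \<Gamma> =
     {p. \<forall>x\<in>solutions H {p}.
           (if compact \<Gamma> then bounded_arc x
            else \<exists>M::real. \<forall>z\<in>ran x. setdistance z \<Gamma> \<le> ereal M) \<and>
           (complete_arc x \<longrightarrow> converges_to x \<Gamma>)}"

definition attractive :: "'a::euclidean_space hybrid_system \<Rightarrow> 'a set \<Rightarrow> bool" where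
  "attractive H \<Gamma> \<longleftrightarrow> \<Gamma> \<subseteq> interior (basin_of_attraction H \<Gamma>)"

definition globally_attractive :: "'a::euclidean_space hybrid_system \<Rightarrow> 'a set \<Rightarrow> bool" where
  "globally_attractive H \<Gamma> \<longleftrightarrow> basin_of_attraction H \<Gamma> = UNIV"

definition asymptotically_stable :: "'a::euclidean_space hybrid_system \<Rightarrow> 'a set \<Rightarrow> bool" where
  "asymptotically_stable H \<Gamma> \<longleftrightarrow> stable H \<Gamma> \<and> attractive H \<Gamma>"

definition globally_asymptotically_stable ::
  "'a::euclidean_space hybrid_system \<Rightarrow> 'a set \<Rightarrow> bool" where
  "globally_asymptotically_stable H \<Gamma> \<longleftrightarrow> stable H \<Gamma> \<and> globally_attractive H \<Gamma>"

definition locally_stable_near ::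
  "'a::euclidean_space hybrid_system \<Rightarrow> 'a set \<Rightarrow> 'a set \<Rightarrow> bool" where
  "locally_stable_near H \<Gamma>\<^sub>2 \<Gamma>\<^sub>1 \<longleftrightarrow>
     (\<exists>r>0. \<forall>\<epsilon>>0. \<exists>\<delta>>0. \<forall>x\<in>solutions H (set_ball \<Gamma>\<^sub>1 \<delta>). \<forall>t j. (t, j) \<in> dom x \<longrightarrow>
        (\<forall>s k. (s, k) \<in> dom x \<longrightarrow> s \<le> t \<longrightarrow> k \<le> j \<longrightarrow> the (x (s, k)) \<in> set_ball \<Gamma>\<^sub>1 r) \<longrightarrow>
        the (x (t, j)) \<in> set_ball \<Gamma>\<^sub>2 \<epsilon>)"

definition locally_attractive_near ::
  "'a::euclidean_space hybrid_system \<Rightarrow> 'a set \<Rightarrow> 'a set \<Rightarrow> bool" where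
  "locally_attractive_near H \<Gamma>\<^sub>2 \<Gamma>\<^sub>1 \<longleftrightarrow>
     (\<exists>r>0. set_ball \<Gamma>\<^sub>1 r \<subseteq> basin_of_attraction H \<Gamma>\<^sub>2)"

end

(* Limits of hybrid solutions are again solutions: on each flow interval the solutions in a compact
   set are equi-Lipschitz, a limit of them is differentiable almost everywhere by Lebesgue's
   theorem (proved here through Vitali coverings), and its velocity is admissible because the flow
   map is outer semicontinuous with convex values.

   Suppose Gamma1 is not stable. Take solutions that start ever closer to Gamma1 and leave a fixed
   small neighbourhood, and cut each of them down to the piece between its last visit to a smaller
   neighbourhood A and its first exit. By local stability these pieces approach Gamma2 before the
   exit, so their limit is a solution of the restriction to Gamma2. It either leaves the large
   neighbourhood although it starts in A, contradicting relative stability, or is complete and never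
   returns to A, contradicting relative attractivity. For attractivity, a limit of tails of a
   complete solution converging to Gamma2 is a complete solution in Gamma2, hence approaches Gamma1;
   so the given solution comes arbitrarily close to Gamma1 and stability keeps it there. *)
theory Submission
  imports Defs "HOL-Library.Diagonal_Subsequence"
begin

text \<open>The definitions speak of maximal solutions, but limits and tails of solutions come
  without maximality. All limit arguments therefore run on arbitrary solutions, which are extended
  to maximal ones only where a stability or attractivity hypothesis is applied.

  Three obstacles shape the argument. Solutions are only absolutely continuous, so every estimate on
  a flow must come from derivatives that exist almost everywhere; one lemma on increments serves
  both for the Lipschitz bound and for the velocity of a limit. A solution may leave a compact
  neighbourhood by a jump that lands far away; local boundedness of the jump map keeps all these
  landing points in one compact set. Finally, the pieces between last visit and exit may have any
  length, so the limit is taken together with the jump times and the number of jumps: either the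
  exit times converge and the exit point survives in the limit, or the limit is complete.

  In the global statement, boundedness of each solution supplies the compact set that stability
  supplies near \<open>\<Gamma>\<^sub>1\<close> in the local one.\<close>

section \<open>Absolutely continuous and Lipschitz curves\<close>

lemma division_of_intervalD:
  fixes K :: "real set"
  assumes "\<D> division_of S" "K \<in> \<D>"
  shows "K = {Inf K..Sup K}" "Inf K \<le> Sup K"
proof -
  obtain c d where "K = {c..d}" "K \<noteq> {}"
    using division_ofD(3,4)[OF assms] by (metis box_real(2))
  then show "K = {Inf K..Sup K}" "Inf K \<le> Sup K" by auto
qed

lemma sum_content_division:
  assumes "\<D> division_of S"
  shows "sum (measure lborel) \<D> = measure lebesgue S"
proof -
  have "sum (measure lborel) \<D> = sum (measure lebesgue) \<D>"
  proof (rule sum.cong)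
    fix K assume "K \<in> \<D>"
    then obtain c d where "K = cbox c d" using division_ofD(4)[OF assms] by blast
    then show "measure lborel K = measure lebesgue K" by simp
  qed simp
  then show ?thesis using content_division[OF assms] by simp
qed

lemma sum_division_increments:
  fixes f :: "real \<Rightarrow> 'a::real_normed_vector"
  assumes "\<D> division_of {a..b}" "a \<le> b"
  shows "(\<Sum>K\<in>\<D>. f (Sup K) - f (Inf K)) = f b - f a"
proof -
  \<comment> \<open>The telescoping sum is available for tagged divisions; the right end point of
    each interval serves as tag.\<close>
  let ?p = "(\<lambda>K. (Sup K, K)) ` \<D>"
  have "?p tagged_division_of {a..b}"
  proof (rule tagged_division_ofI)
    show "finite ?p" using assms(1) by blast
    show "\<Union>{K. \<exists>x. (x, K) \<in> ?p} = {a..b}" using division_ofD(6)[OF assms(1)] by (auto simp: image_iff)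
    show "x \<in> K" if "(x, K) \<in> ?p" for x K
    proof -
      from that have "K \<in> \<D>" "x = Sup K" by auto
      from division_of_intervalD[OF assms(1) this(1)] this(2) show ?thesis by (metis atLeastAtMost_iff order_refl)
    qed
    show "K \<subseteq> {a..b}" if "(x, K) \<in> ?p" for x K
      using that division_ofD(2)[OF assms(1)] by blast
    show "\<exists>a b. K = cbox a b" if "(x, K) \<in> ?p" for x K
      using that division_ofD(4)[OF assms(1)] by blast
    show "interior K1 \<inter> interior K2 = {}"
      if "(x1, K1) \<in> ?p" "(x2, K2) \<in> ?p" "(x1, K1) \<noteq> (x2, K2)" for x1 K1 x2 K2
      using that division_ofD(5)[OF assms(1)] by blast
  qed
  from additive_tagged_division_1[OF assms(2) this, of f]
  show ?thesis by (subst (asm) sum.reindex) (auto simp: inj_on_def)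
qed

text \<open>The exceptional null set is covered by an open set so small that absolute continuity
  bounds the increments over finitely many intervals inside it by \<open>e\<close> in total. At any
  other point the derivative bounds the loss over short intervals around it by \<open>e\<close>
  times their length. A gauge merges the two situations, and a fine tagged division adds up to a
  total loss of at most \<open>e + e * (b - a)\<close>.\<close>

lemma abs_continuous_nondecreasing:
  fixes f :: "real \<Rightarrow> real"
  assumes ac: "abs_continuous_on {a..b} f" and ab: "a \<le> b"
    and der: "AE t in lebesgue. t \<in> {a<..<b} \<longrightarrow> (\<exists>v\<ge>0. (f has_vector_derivative v) (at t))"
  shows "f a \<le> f b"
proof (rule field_le_epsilon)
  fix e0 :: real assume "0 < e0"
  define e where "e = e0 / (1 + (b - a))"
  have "e * (1 + (b - a)) = e0" using ab by (simp add: e_def)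
  then have e: "e > 0" "e + e * (b - a) = e0"
    using \<open>0 < e0\<close> ab by (simp_all add: e_def distrib_left)
  obtain \<delta> where "\<delta> > 0" and \<delta>: "\<And>\<D> T. \<D> division_of T \<Longrightarrow> T \<subseteq> {a..b} \<Longrightarrow>
      (\<Sum>K\<in>\<D>. Sup K - Inf K) < \<delta> \<Longrightarrow> (\<Sum>K\<in>\<D>. norm (f (Sup K) - f (Inf K))) < e"
    using ac e(1) unfolding abs_continuous_on_def by meson
  from der obtain N0 where N0: "N0 \<in> null_sets lebesgue"
    "\<And>t. t \<notin> N0 \<Longrightarrow> t \<in> {a<..<b} \<Longrightarrow> \<exists>v\<ge>0. (f has_vector_derivative v) (at t)"
    by (rule AE_E3) auto
  \<comment> \<open>The derivative is known only inside the interval, so the end points join the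
    exceptional set.\<close>
  define N where "N = N0 \<union> {a, b}"
  have N: "negligible N" using N0(1) by (simp add: N_def negligible_iff_null_sets[symmetric])
  then have "N \<in> sets lebesgue" by (simp add: negligible_imp_sets)
  from sets_lebesgue_outer_open[OF this \<open>\<delta> > 0\<close>] obtain T where T: "open T" "N \<subseteq> T"
    "T - N \<in> lmeasurable" "emeasure lebesgue (T - N) < ennreal \<delta>" by blast
  have T2: "T \<in> lmeasurable" "measure lebesgue T < \<delta>"
  proof -
    have "T = (T - N) \<union> N" using T(2) by auto
    then show "T \<in> lmeasurable" using T(3) negligible_imp_measurable[OF N] by (metis fmeasurable.Un)
    have "emeasure lebesgue (T - N) = emeasure lebesgue T"
      using T N by (simp add: emeasure_Diff_null_set negligible_iff_null_sets lmeasurable_iff_has_integral borel_open)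
    then show "measure lebesgue T < \<delta>" using T(4) \<open>\<delta> > 0\<close>
        emeasure_eq_measure2[OF \<open>T \<in> lmeasurable\<close>] by (simp add: ennreal_less_iff)
  qed
  have "\<exists>r>0. t \<notin> N \<longrightarrow> t \<in> {a..b} \<longrightarrow> (\<forall>c d. c \<le> t \<longrightarrow> t \<le> d \<longrightarrow> {c..d} \<subseteq> ball t r \<longrightarrow> f d - f c \<ge> - e * (d - c))" for t
  proof (cases "t \<notin> N \<and> t \<in> {a..b}")
    case True
    then have "t \<in> {a<..<b}" by (auto simp: N_def)
    then obtain v where v: "v \<ge> 0" "(f has_vector_derivative v) (at t)" using True N0(2)[of t] by (auto simp: N_def)
    then have "(f has_derivative (\<lambda>h. h * v)) (at t)" by (simp add: has_vector_derivative_def)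
    then obtain r where r: "r > 0" "\<And>y. norm (y - t) < r \<Longrightarrow> norm (f y - f t - (y - t) * v) \<le> e * norm (y - t)"
      using e(1) unfolding has_derivative_within_alt by (metis UNIV_I)
    \<comment> \<open>The increment is split at \<open>t\<close>, and the linear approximation
      applies on either side; the derivative \<open>v \<ge> 0\<close> contributes no loss.\<close>
    have "f d - f c \<ge> - e * (d - c)" if "c \<le> t" "t \<le> d" "{c..d} \<subseteq> ball t r" for c d
    proof -
      have "c \<in> ball t r" "d \<in> ball t r" using that by (meson atLeastAtMost_iff order_refl order_trans subsetD)+
      then have "\<bar>f d - f t - (d - t) * v\<bar> \<le> e * (d - t)" "\<bar>f c - f t - (c - t) * v\<bar> \<le> e * (t - c)"
        using r(2)[of c] r(2)[of d] that(1,2) by (simp_all add: dist_real_def abs_minus_commute)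
      moreover have "(d - t) * v \<ge> 0" "(c - t) * v \<le> 0"
        using v that by (auto simp: mult_nonpos_nonneg)
      moreover have "- e * (d - c) = - (e * (d - t)) - e * (t - c)" by (simp add: algebra_simps)
      ultimately show ?thesis unfolding abs_le_iff by linarith
    qed
    then show ?thesis using r(1) by blast
  next
    case False then show ?thesis by (intro exI[of _ 1]) auto
  qed
  then obtain r where r: "\<And>t. r t > 0" "\<And>t c d. t \<notin> N \<Longrightarrow> t \<in> {a..b} \<Longrightarrow> c \<le> t \<Longrightarrow> t \<le> d \<Longrightarrow> {c..d} \<subseteq> ball t (r t) \<Longrightarrow> f d - f c \<ge> - e * (d - c)"
    by metis
  define g where "g t = (if t \<in> N then T else ball t (r t))" for t
  have "gauge g" using T r(1) by (auto simp: gauge_def g_def)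
  then obtain p where p: "p tagged_division_of {a..b}" "g fine p" by (rule fine_division_exists_real)
  note pD = tagged_division_ofD[OF p(1)]
  let ?B = "{q \<in> p. fst q \<in> N}"
  have intv: "K = {Inf K..Sup K} \<and> Inf K \<le> x \<and> x \<le> Sup K" if xK: "(x, K) \<in> p" for x K
  proof -
    obtain c d where "K = {c..d}" "x \<in> K" using pD(2,4)[OF xK] by (metis box_real(2))
    then show ?thesis by auto
  qed
  have Bpart: "?B tagged_partial_division_of {a..b}"
    by (rule tagged_partial_division_subset[of p]) (use p(1) in \<open>auto simp: tagged_division_of_def\<close>)
  let ?D = "snd ` ?B"
  have D: "?D division_of \<Union>?D" using partial_division_of_tagged_division[OF Bpart] .
  have red: "(\<Sum>(x,K)\<in>?B. \<phi> K) = sum \<phi> ?D" if "\<And>c. \<phi> {c..c} = 0" for \<phi> :: "real set \<Rightarrow> real"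
  proof -
    \<comment> \<open>Different tags can share an interval only if it has no interior. The empty
      interval is among those, and \<open>\<phi> {}\<close> is arbitrary, hence the guard.\<close>
    let ?\<psi> = "\<lambda>K. if K = {} then 0 else \<phi> K"
    have "(\<Sum>(x,K)\<in>?B. \<phi> K) = (\<Sum>(x,K)\<in>?B. ?\<psi> K)"
      using pD(2) by (intro sum.cong) fastforce+
    also have "\<dots> = sum ?\<psi> ?D"
    proof (rule sum.over_tagged_division_lemma[OF tagged_partial_division_of_Union_self[OF Bpart]])
      fix u v :: real assume "box u v = {}"
      then have "v \<le> u" by simp
      then show "?\<psi> (cbox u v) = 0" using that[of u] by (cases "u = v") auto
    qed
    also have "\<dots> = sum \<phi> ?D" using pD(2) by (intro sum.cong) fastforce+
    finally show ?thesis .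
  qed
  have sub: "\<Union>?D \<subseteq> {a..b}" using pD(3) by force
  have subT: "\<Union>?D \<subseteq> T" using p(2) by (fastforce simp: g_def fine_def)
  have "(\<Sum>K\<in>?D. Sup K - Inf K) = (\<Sum>K\<in>?D. measure lborel K)"
  proof (rule sum.cong)
    fix K assume "K \<in> ?D"
    then have "K = {Inf K..Sup K} \<and> Inf K \<le> Sup K" using division_of_intervalD[OF D] by blast
    then show "Sup K - Inf K = measure lborel K" by (metis content_real)
  qed simp
  also have "\<dots> = measure lebesgue (\<Union>?D)"
    by (rule sum_content_division[OF D])
  also have "\<dots> \<le> measure lebesgue T"
    by (rule measure_mono_fmeasurable[OF subT _ T2(1)]) (use D lmeasurable_division in blast)
  finally have "(\<Sum>K\<in>?D. Sup K - Inf K) < \<delta>" using T2(2) by linarith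
  from \<delta>[OF D sub this] have "(\<Sum>(x,K)\<in>?B. norm (f (Sup K) - f (Inf K))) < e"
    by (subst red) auto
  moreover have "- (\<Sum>(x,K)\<in>?B. norm (f (Sup K) - f (Inf K))) \<le> (\<Sum>(x,K)\<in>?B. f (Sup K) - f (Inf K))"
    unfolding sum_negf[symmetric] by (rule sum_mono) auto
  ultimately have bad: "(\<Sum>(x,K)\<in>?B. f (Sup K) - f (Inf K)) \<ge> - e" by linarith
  have "(\<Sum>(x,K)\<in>p - ?B. f (Sup K) - f (Inf K)) \<ge> (\<Sum>(x,K)\<in>p - ?B. - e * measure lborel K)"
  proof (rule sum_mono)
    fix y assume "y \<in> p - ?B"
    then obtain x K where *: "(x, K) \<in> p" "(x, K) \<notin> ?B" and y: "y = (x, K)" by (cases y) auto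
    then have "x \<notin> N" by auto
    have "K \<subseteq> g x" using p(2) *(1) by (rule fineD)
    then have "K \<subseteq> ball x (r x)" using \<open>x \<notin> N\<close> by (simp add: g_def)
    moreover have "x \<in> {a..b}" using pD(2,3) * by blast
    moreover have "measure lborel K = Sup K - Inf K" using intv[OF *(1)] by (metis content_real order_trans)
    ultimately show "(case y of (x, K) \<Rightarrow> - e * measure lborel K) \<le> (case y of (x, K) \<Rightarrow> f (Sup K) - f (Inf K))"
      unfolding y using r(2)[of x "Inf K" "Sup K"] intv[OF *(1)] \<open>x \<notin> N\<close> by auto
  qed
  moreover have "(\<Sum>(x,K)\<in>p - ?B. - e * measure lborel K) \<ge> (\<Sum>(x,K)\<in>p. - e * measure lborel K)"
  proof -
    have "(\<Sum>(x,K)\<in>p - ?B. e * measure lborel K) \<le> (\<Sum>(x,K)\<in>p. e * measure lborel K)"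
      by (rule sum_mono2) (use pD(1) e in auto)
    then show ?thesis by (simp add: case_prod_beta sum_negf)
  qed
  moreover have "(\<Sum>(x,K)\<in>p. - e * measure lborel K) = - e * (b - a)"
    using additive_content_tagged_division[of p a b] p(1) ab
    by (simp add: sum_distrib_left[symmetric] case_prod_beta sum_negf)
  moreover have "f b - f a = (\<Sum>(x,K)\<in>p - ?B. f (Sup K) - f (Inf K)) + (\<Sum>(x,K)\<in>?B. f (Sup K) - f (Inf K))"
    unfolding additive_tagged_division_1[OF ab p(1), of f, symmetric]
    by (rule sum.subset_diff) (use pD(1) in auto)
  ultimately show "f a \<le> f b + e0" using bad e(2) by linarith
qed

text \<open>The monotonicity lemma applied to \<open>w \<bullet> f t - c * t\<close>. With
  \<open>w\<close> an increment of \<open>f\<close> it yields a Lipschitz bound, and with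
  \<open>w\<close> normal to a separating hyperplane it confines the velocities of limits.\<close>

lemma abs_continuous_increment_ge:
  fixes f :: "real \<Rightarrow> 'a::real_inner"
  assumes ac: "abs_continuous_on {a..b} f" and ab: "a \<le> b"
    and der: "AE t in lebesgue. t \<in> {a<..<b} \<longrightarrow> (\<exists>v. c \<le> w \<bullet> v \<and> (f has_vector_derivative v) (at t))"
  shows "c * (b - a) \<le> w \<bullet> (f b - f a)"
proof -
  define g where "g t = w \<bullet> f t - c * t" for t
  \<comment> \<open>Enlarging the factors by 1 keeps them positive when \<open>w\<close> or
    \<open>c\<close> vanishes, so that \<open>e\<close> can be divided by them.\<close>
  have weaken: "A \<le> W * n + C * l \<Longrightarrow> 0 \<le> n \<Longrightarrow> 0 \<le> l \<Longrightarrow> A \<le> (W + 1) * n + (C + 1) * l" for A W n C l :: real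
    by (simp add: algebra_simps)
  have "abs_continuous_on {a..b} g"
    unfolding abs_continuous_on_def
  proof (intro allI impI)
    fix e :: real assume "e > 0"
    define e1 where "e1 = e / (2 * (norm w + 1))"
    have "norm w + 1 > 0" using norm_ge_zero[of w] by linarith
    then have "e1 > 0" using \<open>e > 0\<close> by (simp add: e1_def)
    then obtain \<delta> where \<delta>: "\<delta> > 0" "\<And>\<D> T. \<D> division_of T \<Longrightarrow> T \<subseteq> {a..b} \<Longrightarrow>
      (\<Sum>K\<in>\<D>. Sup K - Inf K) < \<delta> \<Longrightarrow> (\<Sum>K\<in>\<D>. norm (f (Sup K) - f (Inf K))) < e1"
      using ac unfolding abs_continuous_on_def by meson
    define d where "d = min \<delta> (e / (2 * (\<bar>c\<bar> + 1)))"
    have "d > 0" using \<delta> \<open>e > 0\<close> by (auto simp: d_def)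
    moreover have "(\<Sum>K\<in>\<D>. norm (g (Sup K) - g (Inf K))) < e"
      if "\<D> division_of T" "T \<subseteq> {a..b}" "(\<Sum>K\<in>\<D>. Sup K - Inf K) < d" for \<D> T
    proof -
      have "(\<Sum>K\<in>\<D>. norm (g (Sup K) - g (Inf K)))
          \<le> (\<Sum>K\<in>\<D>. (norm w + 1) * norm (f (Sup K) - f (Inf K)) + (\<bar>c\<bar> + 1) * (Sup K - Inf K))"
      proof (rule sum_mono)
        fix K assume "K \<in> \<D>"
        then have le: "Inf K \<le> Sup K" using division_of_intervalD[OF that(1)] by blast
        have "g (Sup K) - g (Inf K) = w \<bullet> (f (Sup K) - f (Inf K)) - c * (Sup K - Inf K)"
          by (simp add: g_def inner_diff_right algebra_simps)
        moreover have "\<bar>w \<bullet> (f (Sup K) - f (Inf K))\<bar> \<le> norm w * norm (f (Sup K) - f (Inf K))"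
          by (rule Cauchy_Schwarz_ineq2)
        moreover have "\<bar>c * (Sup K - Inf K)\<bar> = \<bar>c\<bar> * (Sup K - Inf K)" using le by (simp add: abs_mult)
        ultimately have "norm (g (Sup K) - g (Inf K)) \<le> norm w * norm (f (Sup K) - f (Inf K)) + \<bar>c\<bar> * (Sup K - Inf K)"
          using abs_triangle_ineq4[of "w \<bullet> (f (Sup K) - f (Inf K))" "c * (Sup K - Inf K)"]
          unfolding real_norm_def by simp
        then show "norm (g (Sup K) - g (Inf K)) \<le> (norm w + 1) * norm (f (Sup K) - f (Inf K)) + (\<bar>c\<bar> + 1) * (Sup K - Inf K)"
          using le by (intro weaken) auto
      qed
      also have "\<dots> = (norm w + 1) * (\<Sum>K\<in>\<D>. norm (f (Sup K) - f (Inf K))) + (\<bar>c\<bar> + 1) * (\<Sum>K\<in>\<D>. Sup K - Inf K)"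
        by (simp add: sum.distrib sum_distrib_left)
      also have "\<dots> < (norm w + 1) * e1 + (\<bar>c\<bar> + 1) * d"
        using that \<delta>(2)[OF that(1,2)] \<open>norm w + 1 > 0\<close>
        by (intro add_strict_mono mult_strict_left_mono) (auto simp: d_def)
      also have "(norm w + 1) * e1 = e / 2" using \<open>norm w + 1 > 0\<close> by (simp add: e1_def field_simps)
      also have "(\<bar>c\<bar> + 1) * d \<le> (\<bar>c\<bar> + 1) * (e / (2 * (\<bar>c\<bar> + 1)))" by (intro mult_left_mono) (auto simp: d_def)
      also have "\<dots> = e / 2" using abs_ge_zero[of c] by (simp add: field_simps)
      finally show ?thesis by simp
    qed
    ultimately show "\<exists>\<delta>>0. \<forall>\<D> T. \<D> division_of T \<longrightarrow> T \<subseteq> {a..b} \<longrightarrow> (\<Sum>K\<in>\<D>. Sup K - Inf K) < \<delta> \<longrightarrow>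
        (\<Sum>K\<in>\<D>. norm (g (Sup K) - g (Inf K))) < e" by blast
  qed
  moreover have "AE t in lebesgue. t \<in> {a<..<b} \<longrightarrow> (\<exists>v\<ge>0. (g has_vector_derivative v) (at t))"
    using der
  proof (rule AE_mp, intro AE_I2 impI)
    fix t assume "t \<in> {a<..<b} \<longrightarrow> (\<exists>v. c \<le> w \<bullet> v \<and> (f has_vector_derivative v) (at t))" "t \<in> {a<..<b}"
    then obtain v where v: "c \<le> w \<bullet> v" "(f has_vector_derivative v) (at t)" by blast
    have "(g has_vector_derivative (w \<bullet> v - c)) (at t)"
      unfolding g_def using v(2) by (auto simp: has_vector_derivative_def algebra_simps intro!: derivative_eq_intros)
    then show "\<exists>v\<ge>0. (g has_vector_derivative v) (at t)" using v(1) by (intro exI[of _ "w \<bullet> v - c"]) auto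
  qed
  ultimately have "g a \<le> g b" using abs_continuous_nondecreasing ab by blast
  then show ?thesis by (simp add: g_def inner_diff_right algebra_simps)
qed


section \<open>Almost everywhere differentiability of Lipschitz functions\<close>

text \<open>The derivate is approached from arbitrarily short intervals, so Vitali's theorem packs almost
  all of \<^term>\<open>{a..b}\<close> with intervals on which \<^term>\<open>f\<close> grows at least as fast as the Riemann
  sum of \<^term>\<open>u\<close>, and Henstock's lemma compares that sum with the integral.\<close>

lemma integral_upper_derivate_le:
  fixes f u :: "real \<Rightarrow> real"
  assumes ab: "a \<le> b" and lip: "\<And>s t. \<bar>f s - f t\<bar> \<le> L * \<bar>s - t\<bar>"
    and u: "u integrable_on {a..b}" "\<And>t. \<bar>u t\<bar> \<le> L"
    and der: "\<And>t e d. e > 0 \<Longrightarrow> d > 0 \<Longrightarrow>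
      \<exists>h. h \<noteq> 0 \<and> \<bar>h\<bar> < d \<and> u t - e < (f (t + h) - f t) / h"
  shows "integral {a..b} u \<le> f b - f a"
proof (rule field_le_epsilon)
  fix e0 :: real assume "0 < e0"
  have L: "L \<ge> 0" using u(2)[of a] by linarith
  \<comment> \<open>Error budget in units of \<open>e\<close>: one from Henstock's lemma,
    \<open>b - a\<close> from the slack in the chosen intervals, and \<open>L\<close> twice from the
    part left uncovered, once for the integral and once for the increments of
    \<open>f\<close>.\<close>
  define M where "M = 1 + (b - a) + 2 * L"
  have M: "M \<ge> 1" using L ab by (simp add: M_def)
  define e where "e = e0 / M"
  have e: "e > 0" "e * M = e0" using M \<open>0 < e0\<close> by (auto simp: e_def)
  have "u integrable_on cbox a b" using u(1) by simp
  from Henstock_lemma[OF this e(1)]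
  obtain g where g: "gauge g" "\<And>p. p tagged_partial_division_of (cbox a b) \<Longrightarrow> g fine p \<Longrightarrow>
      (\<Sum>(x,k)\<in>p. norm (measure lborel k *\<^sub>R u x - integral k u)) < e"
    by (auto simp del: box_real)
  define I where "I = {(t, c, d). t \<in> {c..d} \<and> c < d \<and> {c..d} \<subseteq> {a<..<b} \<and> {c..d} \<subseteq> g t \<and>
      (u t - e) * (d - c) \<le> f d - f c}"
  \<comment> \<open>Vitali's theorem is applied to balls, so an interval enters through its midpoint
    and radius; its tag is carried along in the index because it need not be the midpoint.\<close>
  define mid rad where "mid = (\<lambda>(t::real, c, d). (c + d) / 2 :: real)"
    and "rad = (\<lambda>(t::real, c, d). (d - c) / 2 :: real)"
  have cb: "cball (mid (t, c, d)) (rad (t, c, d)) = {c..d}" for t c d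
    by (auto simp: mid_def rad_def cball_eq_atLeastAtMost field_simps)
  have radpos: "0 < rad i" if "i \<in> I" for i
    using that by (auto simp: I_def rad_def)
  have "\<exists>i. i \<in> I \<and> x \<in> cball (mid i) (rad i) \<and> rad i < d" if x: "x \<in> {a<..<b}" and "0 < d" for x d
  proof -
    have "open (g x \<inter> {a<..<b})" "x \<in> g x \<inter> {a<..<b}" using g(1) x by (auto simp: gauge_def)
    then obtain r where r: "r > 0" "ball x r \<subseteq> g x \<inter> {a<..<b}" using open_contains_ball by meson
    obtain h where h: "h \<noteq> 0" "\<bar>h\<bar> < min r d" "u x - e < (f (x + h) - f x) / h"
      using der[of e "min r d" x] e(1) r(1) \<open>0 < d\<close> by auto
    \<comment> \<open>The step \<open>h\<close> may be negative; the difference quotient over the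
      interval is the same in either case.\<close>
    define c1 d1 where "c1 = min x (x + h)" and "d1 = max x (x + h)"
    have "(f d1 - f c1) / (d1 - c1) = (f (x + h) - f x) / h" "d1 - c1 = \<bar>h\<bar>"
      using h(1) by (auto simp: c1_def d1_def min_def max_def field_simps)
    then have "u x - e < (f d1 - f c1) / (d1 - c1)" "0 < d1 - c1" using h(1,3) by simp_all
    then have "(u x - e) * (d1 - c1) \<le> f d1 - f c1" by (simp add: pos_less_divide_eq less_imp_le)
    moreover have "{c1..d1} \<subseteq> ball x r"
      using h(2) by (auto simp: c1_def d1_def dist_real_def)
    ultimately have "(x, c1, d1) \<in> I" using r(2) h(1) by (auto simp: I_def c1_def d1_def)
    moreover have "x \<in> cball (mid (x, c1, d1)) (rad (x, c1, d1))" unfolding cb by (auto simp: c1_def d1_def)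
    moreover have "rad (x, c1, d1) < d" using h \<open>d1 - c1 = \<bar>h\<bar>\<close> \<open>0 < d\<close> by (simp add: rad_def)
    ultimately show ?thesis by blast
  qed
  then obtain C where
    C: "countable C" "C \<subseteq> I" "pairwise (\<lambda>i j. disjnt (cball (mid i) (rad i)) (cball (mid j) (rad j))) C"
      "negligible ({a<..<b} - (\<Union>i\<in>C. cball (mid i) (rad i)))"
    using Vitali_covering_theorem_cballs[of I rad "{a<..<b}" mid, OF radpos] by blast
  let ?J = "\<lambda>i. cball (mid i) (rad i)"
  have sub: "?J i \<subseteq> {a<..<b}" if "i \<in> C" for i
    using that C(2) cb by (cases i) (auto simp: I_def)
  have "measure lebesgue (\<Union>i\<in>C. ?J i) = measure lebesgue {a<..<b}"
  proof -
    have "{a<..<b} - (\<Union>i\<in>C. ?J i) \<in> null_sets lebesgue"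
      using C(4) by (simp add: negligible_iff_null_sets)
    then have "measure lebesgue ({a<..<b} - ({a<..<b} - (\<Union>i\<in>C. ?J i))) = measure lebesgue {a<..<b}"
      by (intro measure_Diff_null_set) auto
    also have "{a<..<b} - ({a<..<b} - (\<Union>i\<in>C. ?J i)) = (\<Union>i\<in>C. ?J i)" using sub by auto
    finally show ?thesis .
  qed
  then have mU: "measure lebesgue (\<Union>(?J ` C)) = b - a" using ab by simp
  have "measure lebesgue (\<Union>D') \<le> b - a" if "D' \<subseteq> ?J ` C" "finite D'" for D'
  proof -
    have "measure lebesgue (\<Union>D') \<le> measure lebesgue {a..b}"
      using that sub by (intro measure_mono_fmeasurable) force+
    then show ?thesis using ab by simp
  qed
  \<comment> \<open>Henstock's lemma concerns finite families: finitely many of the disjoint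
    intervals already cover all but measure \<open>e\<close>.\<close>
  then obtain D' where D': "D' \<subseteq> ?J ` C" "finite D'" "b - a - e < measure lebesgue (\<Union>D')"
    using measure_countable_Union_approachable[of "?J ` C" e "b - a"] C(1) e(1) mU
    by (metis (no_types, lifting) countable_image imageE lmeasurable_cball)
  obtain F where F: "F \<subseteq> C" "finite F" "D' = ?J ` F"
    using D' by (meson finite_subset_image)
  have J: "?J i = {fst (snd i)..snd (snd i)}" for i using cb by (cases i) auto
  have FI: "fst i \<in> ?J i" "?J i \<subseteq> {a<..<b}" "?J i \<subseteq> g (fst i)" "fst (snd i) < snd (snd i)"
      "(u (fst i) - e) * (snd (snd i) - fst (snd i)) \<le> f (snd (snd i)) - f (fst (snd i))" if "i \<in> F" for i
  proof -
    have "i \<in> I" using that F(1) C(2) by blast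
    then show "fst i \<in> ?J i" "?J i \<subseteq> {a<..<b}" "?J i \<subseteq> g (fst i)" "fst (snd i) < snd (snd i)"
      "(u (fst i) - e) * (snd (snd i) - fst (snd i)) \<le> f (snd (snd i)) - f (fst (snd i))"
      unfolding J by (simp_all add: I_def case_prod_beta)
  qed
  have injJ: "i = j" if "i \<in> F" "j \<in> F" "\<not> disjnt (?J i) (?J j)" for i j
    using C(3) F(1) that by (meson pairwise_def subsetD)
  define p where "p = (\<lambda>i. (fst i, ?J i)) ` F"
  have p: "p tagged_partial_division_of (cbox a b)"
    unfolding tagged_partial_division_of_def
  proof (intro conjI allI impI)
    show "finite p" using F(2) by (simp add: p_def)
  next
    fix x K assume "(x, K) \<in> p"
    then obtain i where i: "i \<in> F" "x = fst i" "K = ?J i" by (auto simp: p_def)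
    show "x \<in> K" "K \<subseteq> cbox a b" using FI(1,2)[OF i(1)] i by (auto simp: less_imp_le)
    show "\<exists>a b. K = cbox a b" unfolding i(3) J by (metis box_real(2))
  next
    fix x1 K1 x2 K2 assume *: "(x1, K1) \<in> p \<and> (x2, K2) \<in> p \<and> (x1, K1) \<noteq> (x2, K2)"
    then obtain i j where ij: "i \<in> F" "(x1, K1) = (fst i, ?J i)" "j \<in> F" "(x2, K2) = (fst j, ?J j)"
      unfolding p_def by blast
    then have "i \<noteq> j" using * by auto
    then have "disjnt (?J i) (?J j)" using injJ ij by blast
    then show "interior K1 \<inter> interior K2 = {}"
      using ij interior_subset[of K1] interior_subset[of K2] unfolding disjnt_def by blast
  qed
  have "g fine p" using FI(3) by (auto simp: p_def fine_def)
  note H = g(2)[OF p this]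
  have sndp: "snd ` p = D'" by (auto simp: p_def F(3) image_image)
  have D'div: "D' division_of \<Union>D'" using partial_division_of_tagged_division[OF p] by (simp add: sndp)
  have "\<Union>D' \<subseteq> cbox a b" using FI(2) F(3) by fastforce
  \<comment> \<open>The chosen intervals are completed to a division of the whole interval. The
    added ones have total length less than \<open>e\<close>, where the bound \<open>L\<close> on
    \<open>u\<close> and the Lipschitz bound on \<open>f\<close> suffice.\<close>
  then obtain q where q: "D' \<subseteq> q" "q division_of cbox a b"
    using partial_division_extend_interval[OF D'div] by blast
  have q': "q division_of {a..b}" and "finite q" using q(2) by auto
  have qK: "\<exists>c d. K = {c..d} \<and> c \<le> d \<and> Inf K = c \<and> Sup K = d \<and> measure lborel K = d - c \<and> {c..d} \<subseteq> {a..b}" if "K \<in> q" for K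
    using division_of_intervalD[OF q' that] division_ofD(2)[OF q' that] by (metis content_real)
  have cont: "sum (measure lborel) D' > b - a - e"
    using D'(3) sum_content_division[OF D'div] by simp
  have "sum (measure lborel) q = b - a" using additive_content_division[OF q(2)] ab by simp
  then have rest: "sum (measure lborel) (q - D') < e" using cont \<open>finite q\<close> q(1) by (simp add: sum_diff)
  have injF: "inj_on ?J F"
  proof (rule inj_onI)
    fix i j assume ij: "i \<in> F" "j \<in> F" "?J i = ?J j"
    then have "fst i \<in> ?J i" "fst i \<in> ?J j" using FI(1)[of i] by metis+
    then have "\<not> disjnt (?J i) (?J j)" unfolding disjnt_iff by blast
    then show "i = j" using injJ ij by blast
  qed
  then have injF': "inj_on (\<lambda>i. (fst i, ?J i)) F" by (auto simp: inj_on_def)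
  have red: "(\<Sum>(x,K)\<in>p. \<phi> x K) = (\<Sum>i\<in>F. \<phi> (fst i) (?J i))" for \<phi> :: "real \<Rightarrow> real set \<Rightarrow> real"
    unfolding p_def by (subst sum.reindex[OF injF']) simp
  have redD: "sum \<phi> D' = (\<Sum>i\<in>F. \<phi> (?J i))" for \<phi> :: "real set \<Rightarrow> real"
    unfolding F(3) by (subst sum.reindex[OF injF]) simp
  have int1: "integral {a..b} u = (\<Sum>K\<in>q. integral K u)"
    using integral_combine_division_topdown[OF _ q'] u(1) by blast
  have "(\<Sum>K\<in>q - D'. integral K u) \<le> (\<Sum>K\<in>q - D'. L * measure lborel K)"
  proof (rule sum_mono)
    fix K assume "K \<in> q - D'"
    then obtain c d where K: "K = {c..d}" "c \<le> d" "{c..d} \<subseteq> {a..b}" "measure lborel K = d - c" using qK by blast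
    have "integral {c..d} u \<le> integral {c..d} (\<lambda>_. L)"
      using integrable_on_subinterval[OF u(1) K(3)] u(2) by (intro integral_le) (auto simp: abs_le_iff)
    then show "integral K u \<le> L * measure lborel K" using K by (simp add: mult.commute)
  qed
  also have "\<dots> \<le> L * e" unfolding sum_distrib_left[symmetric] using rest L by (intro mult_left_mono) auto
  finally have i2: "(\<Sum>K\<in>q - D'. integral K u) \<le> L * e" .
  have i3: "(\<Sum>K\<in>D'. integral K u) \<le> (\<Sum>i\<in>F. measure lborel (?J i) * u (fst i)) + e"
  proof -
    have "(\<Sum>i\<in>F. integral (?J i) u - measure lborel (?J i) * u (fst i)) \<le> (\<Sum>i\<in>F. norm (measure lborel (?J i) *\<^sub>R u (fst i) - integral (?J i) u))"
      by (intro sum_mono) auto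
    also have "\<dots> \<le> e" using H unfolding red by simp
    finally show ?thesis unfolding redD by (simp add: sum_subtractf)
  qed
  have i4: "(\<Sum>i\<in>F. measure lborel (?J i) * u (fst i)) \<le> (\<Sum>K\<in>D'. f (Sup K) - f (Inf K)) + e * (b - a)"
  proof -
    have "(\<Sum>i\<in>F. measure lborel (?J i) * u (fst i)) \<le> (\<Sum>i\<in>F. (f (Sup (?J i)) - f (Inf (?J i))) + e * measure lborel (?J i))"
    proof (rule sum_mono)
      fix i assume "i \<in> F"
      note FI[OF this]
      then show "measure lborel (?J i) * u (fst i) \<le> (f (Sup (?J i)) - f (Inf (?J i))) + e * measure lborel (?J i)"
        unfolding J by (simp add: algebra_simps)
    qed
    also have "\<dots> = (\<Sum>K\<in>D'. f (Sup K) - f (Inf K)) + e * sum (measure lborel) D'"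
      unfolding redD by (simp add: sum.distrib sum_distrib_left)
    also have "sum (measure lborel) D' \<le> sum (measure lborel) q" using \<open>finite q\<close> q(1) by (intro sum_mono2) auto
    finally show ?thesis using e(1) \<open>sum (measure lborel) q = b - a\<close> by simp
  qed
  have "(\<Sum>K\<in>q - D'. f (Inf K) - f (Sup K)) \<le> (\<Sum>K\<in>q - D'. L * measure lborel K)"
  proof (rule sum_mono)
    fix K assume "K \<in> q - D'"
    then obtain c d where K: "Inf K = c" "Sup K = d" "c \<le> d" "measure lborel K = d - c" using qK by blast
    show "f (Inf K) - f (Sup K) \<le> L * measure lborel K" using lip[of c d] K by (simp add: abs_le_iff)
  qed
  also have "\<dots> \<le> L * e" unfolding sum_distrib_left[symmetric] using rest L by (intro mult_left_mono) auto
  finally have i5: "(\<Sum>K\<in>q - D'. f (Sup K) - f (Inf K)) \<ge> - (L * e)"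
    by (simp add: sum_subtractf)
  have "(\<Sum>K\<in>q. f (Sup K) - f (Inf K)) = (\<Sum>K\<in>q - D'. f (Sup K) - f (Inf K)) + (\<Sum>K\<in>D'. f (Sup K) - f (Inf K))"
    using \<open>finite q\<close> q(1) by (rule sum.subset_diff[rotated])
  moreover have "(\<Sum>K\<in>q. integral K u) = (\<Sum>K\<in>q - D'. integral K u) + (\<Sum>K\<in>D'. integral K u)"
    using \<open>finite q\<close> q(1) by (rule sum.subset_diff[rotated])
  ultimately have "integral {a..b} u \<le> f b - f a + (L * e + e + e * (b - a) + L * e)"
    using int1 i2 i3 i4 i5 sum_division_increments[OF q' ab, of f] by linarith
  also have "L * e + e + e * (b - a) + L * e = e * M" by (simp add: M_def algebra_simps)
  finally show "integral {a..b} u \<le> f b - f a + e0" using e(2) by simp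
qed

text \<open>The upper limit, from both sides, of the difference quotients. Only rational steps are
  used, so that suprema over countable sets keep it measurable; for continuous functions nothing is
  lost.\<close>

definition upper_derivate :: "(real \<Rightarrow> real) \<Rightarrow> real \<Rightarrow> real" where
  "upper_derivate f t = (INF n::nat. SUP h\<in>{h\<in>\<rat>. h \<noteq> 0 \<and> \<bar>h\<bar> < 1 / (real n + 1)}. (f (t + h) - f t) / h)"

context
  fixes f :: "real \<Rightarrow> real" and L :: real
  assumes lip: "\<And>s t. \<bar>f s - f t\<bar> \<le> L * \<bar>s - t\<bar>"
begin

private abbreviation "Q t h \<equiv> (f (t + h) - f t) / h"
private abbreviation "R n \<equiv> {h\<in>\<rat>. h \<noteq> 0 \<and> \<bar>h\<bar> < 1 / (real n + 1)} :: real set"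

private lemma Q_bound: "\<bar>Q t h\<bar> \<le> L"
proof (cases "h = 0")
  \<comment> \<open>Division by zero yields 0, and \<open>L\<close> is nonnegative since it bounds
    \<open>\<bar>f 0 - f 1\<bar>\<close>.\<close>
  case True then show ?thesis using lip[of 0 1] by (auto intro: order_trans[OF abs_ge_zero])
next
  case False
  have "\<bar>f (t + h) - f t\<bar> \<le> L * \<bar>h\<bar>" using lip[of "t + h" t] by simp
  then have "\<bar>f (t + h) - f t\<bar> / \<bar>h\<bar> \<le> L" using False by (simp add: pos_divide_le_eq)
  then show ?thesis unfolding abs_divide .
qed

private lemma continuous_f: "continuous_on UNIV f"
proof (rule lipschitz_on_continuous_on)
  show "L-lipschitz_on UNIV f"
    using lip lip[of 0 1] by (intro lipschitz_onI) (auto simp: dist_real_def)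
qed

private lemma R_nonempty: "R n \<noteq> {}"
proof -
  obtain q where "q \<in> \<rat>" "0 < q" "q < 1 / (real n + 1)"
    using Rats_dense_in_real[of 0 "1 / (real n + 1)"] by auto
  then have "q \<in> R n" by auto
  then show ?thesis by blast
qed

private lemma bdd: "bdd_above (Q t ` R n)" "bdd_below (range (\<lambda>n. SUP h\<in>R n. Q t h))"
proof -
  show *: "bdd_above (Q t ` R n)" for n
    using Q_bound[of t, THEN order_trans[OF abs_ge_self]] by (intro bdd_aboveI[of _ L]) auto
  show "bdd_below (range (\<lambda>n. SUP h\<in>R n. Q t h))"
  proof (intro bdd_belowI[of _ "- L"], clarify)
    fix n
    obtain h where "h \<in> R n" using R_nonempty by blast
    have "- L \<le> Q t h" using Q_bound[of t h] by linarith
    also have "\<dots> \<le> (SUP h\<in>R n. Q t h)" using * \<open>h \<in> R n\<close> by (rule cSUP_upper2) auto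
    finally show "- L \<le> (SUP h\<in>R n. Q t h)" .
  qed
qed

lemma upper_derivate_measurable: "upper_derivate f \<in> borel_measurable borel"
proof -
  have [measurable]: "f \<in> borel_measurable borel"
    by (rule borel_measurable_continuous_onI[OF continuous_f])
  have cR: "countable (R n)" for n using countable_rat by (rule countable_subset[rotated]) auto
  show ?thesis
    unfolding upper_derivate_def[abs_def]
    by (intro borel_measurable_cINF borel_measurable_cSUP bdd cR) (auto)
qed

lemma upper_derivate_approached:
  assumes "e > 0" "d > 0"
  shows "\<exists>h. h \<noteq> 0 \<and> \<bar>h\<bar> < d \<and> upper_derivate f t - e < (f (t + h) - f t) / h"
proof -
  obtain n :: nat where n: "1 / (real n + 1) < d"
    using assms(2) by (metis nat_approx_posE add.commute of_nat_Suc)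
  have "upper_derivate f t \<le> (SUP h\<in>R n. Q t h)"
    unfolding upper_derivate_def by (rule cINF_lower[OF bdd(2)]) auto
  then have "upper_derivate f t - e < (SUP h\<in>R n. Q t h)" using assms by linarith
  then obtain h where "h \<in> R n" "upper_derivate f t - e < Q t h"
    unfolding less_cSUP_iff[OF R_nonempty bdd(1)] by blast
  then show ?thesis using n by (intro exI[of _ h]) auto
qed

lemma upper_derivate_bound: "\<bar>upper_derivate f t\<bar> \<le> L"
proof -
  have Q: "Q t h \<le> L" "- L \<le> Q t h" for h using Q_bound[of t h] unfolding abs_le_iff by linarith+
  have "upper_derivate f t \<le> (SUP h\<in>R 0. Q t h)"
    unfolding upper_derivate_def by (rule cINF_lower[OF bdd(2)]) auto
  also have "\<dots> \<le> L" by (rule cSUP_least[OF R_nonempty]) (rule Q(1))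
  finally have "upper_derivate f t \<le> L" .
  moreover have "- L \<le> upper_derivate f t"
    unfolding upper_derivate_def
  proof (rule cINF_greatest)
    fix n
    obtain h where "h \<in> R n" using R_nonempty by blast
    have "- L \<le> Q t h" by (rule Q(2))
    also have "\<dots> \<le> (SUP h\<in>R n. Q t h)" using bdd(1) \<open>h \<in> R n\<close> by (rule cSUP_upper2) auto
    finally show "- L \<le> (SUP h\<in>R n. Q t h)" .
  qed auto
  ultimately show ?thesis by linarith
qed

text \<open>A real step is a limit of rational ones, and continuity of \<open>f\<close> carries the
  bound over to its quotient.\<close>

lemma upper_derivate_eventually:
  assumes "e > 0"
  shows "\<exists>d>0. \<forall>h. h \<noteq> 0 \<longrightarrow> \<bar>h\<bar> < d \<longrightarrow> (f (t + h) - f t) / h \<le> upper_derivate f t + e"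
proof -
  have "(INF n. SUP h\<in>R n. Q t h) < upper_derivate f t + e" using assms by (simp add: upper_derivate_def)
  then obtain n where n: "(SUP h\<in>R n. Q t h) < upper_derivate f t + e"
    unfolding cINF_less_iff[OF UNIV_not_empty bdd(2)] by blast
  have "Q t h \<le> upper_derivate f t + e" if h: "h \<noteq> 0" "\<bar>h\<bar> < 1 / (real n + 1)" for h
  proof -
    obtain X where X: "\<And>i. X i \<in> \<rat>" "X \<longlonglongrightarrow> h"
      using closure_sequential[of h "\<rat>"] by (auto simp: Rats_closure_real)
    have "(\<lambda>i. f (t + X i)) \<longlonglongrightarrow> f (t + h)"
      using X(2) by (intro continuous_on_tendsto_compose[OF continuous_f] tendsto_intros) auto
    then have "(\<lambda>i. Q t (X i)) \<longlonglongrightarrow> Q t h" using X(2) h(1) by (intro tendsto_intros)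
    moreover have "\<forall>\<^sub>F i in sequentially. Q t (X i) \<le> upper_derivate f t + e"
    proof -
      have "\<forall>\<^sub>F i in sequentially. X i \<noteq> 0" using X(2) h(1) by (rule tendsto_imp_eventually_ne)
      moreover have "\<forall>\<^sub>F i in sequentially. \<bar>X i\<bar> < 1 / (real n + 1)"
        using tendsto_rabs[OF X(2)] h(2) by (rule order_tendstoD(2))
      ultimately show ?thesis
      proof eventually_elim
        case (elim i)
        then have "Q t (X i) \<le> (SUP h\<in>R n. Q t h)" using X(1) by (intro cSUP_upper bdd) auto
        then show ?case using n by linarith
      qed
    qed
    ultimately show ?thesis by (rule tendsto_upperbound) simp
  qed
  then show ?thesis by (intro exI[of _ "1 / (real n + 1)"]) auto
qed

end

text \<open>The lower derivate is minus the upper derivate \<open>?l\<close> of \<open>- f\<close>,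
  so \<open>?u + ?l\<close> is nonnegative. Bounding the integrals of \<open>?u\<close> and
  \<open>?l\<close> by the increments of \<open>f\<close> and \<open>- f\<close>, which cancel,
  makes the integral of this sum nonpositive. Hence upper and lower derivate agree almost
  everywhere.\<close>

lemma lipschitz_real_differentiable_AE:
  fixes f :: "real \<Rightarrow> real"
  assumes lip: "\<And>s t. \<bar>f s - f t\<bar> \<le> L * \<bar>s - t\<bar>"
  shows "AE t in lebesgue. \<exists>v. (f has_vector_derivative v) (at t)"
proof -
  let ?g = "\<lambda>t. - f t"
  have lip': "\<And>s t. \<bar>?g s - ?g t\<bar> \<le> L * \<bar>s - t\<bar>" using lip by (simp add: abs_minus_commute)
  let ?u = "upper_derivate f" and ?l = "upper_derivate ?g"
  have nonneg: "0 \<le> ?u t + ?l t" for t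
  proof (rule field_le_epsilon)
    fix e :: real assume "e > 0"
    then obtain d where d: "d > 0" "\<And>h. h \<noteq> 0 \<Longrightarrow> \<bar>h\<bar> < d \<Longrightarrow> (f (t + h) - f t) / h \<le> ?u t + e / 2"
      using upper_derivate_eventually[OF lip, of "e / 2" t] by auto
    obtain h where h: "h \<noteq> 0" "\<bar>h\<bar> < d" "(?g (t + h) - ?g t) / h \<le> ?l t + e / 2"
    proof -
      obtain d' where d': "d' > 0" "\<And>h. h \<noteq> 0 \<Longrightarrow> \<bar>h\<bar> < d' \<Longrightarrow> (?g (t + h) - ?g t) / h \<le> ?l t + e / 2"
        using upper_derivate_eventually[OF lip', of "e / 2" t] \<open>e > 0\<close> by auto
      show thesis by (rule that[of "min d d' / 2"]) (use d(1) d'(1) in \<open>auto intro!: d'(2)[of "min d d' / 2", simplified]\<close>)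
    qed
    have "(?g (t + h) - ?g t) / h = - ((f (t + h) - f t) / h)" by (simp add: diff_divide_distrib)
    then show "0 \<le> ?u t + ?l t + e" using d(2)[OF h(1,2)] h(3) by linarith
  qed
  have ae: "AE t in lebesgue. t \<in> {a..b} \<longrightarrow> ?u t + ?l t = 0" if "a \<le> b" for a b :: real
  proof -
    have m: "upper_derivate h \<in> borel_measurable (lebesgue_on {a..b})" if "upper_derivate h \<in> borel_measurable borel" for h
      using that by (intro measurable_restrict_space1 measurable_completion) (simp add: measurable_lborel1)
    have meas: "?u \<in> borel_measurable (lebesgue_on {a..b})" "?l \<in> borel_measurable (lebesgue_on {a..b})"
      by (rule m[OF upper_derivate_measurable[OF lip]], rule m[OF upper_derivate_measurable[OF lip']])
    have cint: "(\<lambda>_::real. L) integrable_on {a..b}" by (rule integrable_const_ivl)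
    have int: "?u integrable_on {a..b}" "?l integrable_on {a..b}"
      using measurable_bounded_by_integrable_imp_integrable[OF meas(1) cint]
        measurable_bounded_by_integrable_imp_integrable[OF meas(2) cint]
        upper_derivate_bound[OF lip] upper_derivate_bound[OF lip'] by simp_all
    have "integral {a..b} ?u \<le> f b - f a"
      by (rule integral_upper_derivate_le[OF \<open>a \<le> b\<close> lip int(1) upper_derivate_bound[OF lip] upper_derivate_approached[OF lip]])
    moreover have "integral {a..b} ?l \<le> ?g b - ?g a"
      by (rule integral_upper_derivate_le[OF \<open>a \<le> b\<close> lip' int(2) upper_derivate_bound[OF lip'] upper_derivate_approached[OF lip']])
    ultimately have le: "integral {a..b} (\<lambda>t. ?u t + ?l t) \<le> 0" using int by (simp add: integral_add)
    have I: "integrable (lebesgue_on {a..b}) (\<lambda>t. ?u t + ?l t)"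
    proof (rule measurable_bounded_by_integrable_imp_lebesgue_integrable[where g = "\<lambda>_. 2 * L"])
      show "norm (?u t + ?l t) \<le> 2 * L" for t
        using upper_derivate_bound[OF lip, of t] upper_derivate_bound[OF lip', of t] by simp
    qed (use meas in auto)
    then have "integral\<^sup>L (lebesgue_on {a..b}) (\<lambda>t. ?u t + ?l t) \<le> 0"
      using le by (subst lebesgue_integral_eq_integral) auto
    then have "integral\<^sup>L (lebesgue_on {a..b}) (\<lambda>t. ?u t + ?l t) = 0"
      using nonneg by (intro antisym integral_nonneg_AE) auto
    then have "AE t in lebesgue_on {a..b}. ?u t + ?l t = 0"
      using integral_nonneg_eq_0_iff_AE[OF I] nonneg by auto
    then show ?thesis by (subst (asm) AE_restrict_space_iff) auto
  qed
  have "AE t in lebesgue. \<forall>n::nat. t \<in> {- real n..real n} \<longrightarrow> ?u t + ?l t = 0"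
    unfolding AE_all_countable using ae by auto
  then show ?thesis
  proof (rule AE_mp, intro AE_I2 impI)
    fix t assume *: "\<forall>n::nat. t \<in> {- real n..real n} \<longrightarrow> ?u t + ?l t = 0"
    obtain n :: nat where "\<bar>t\<bar> \<le> real n" using real_arch_simple by blast
    then have eq: "?l t = - ?u t" using *[rule_format, of n] by (auto simp: abs_le_iff)
    have "((\<lambda>h. (f (t + h) - f t) / h) \<longlongrightarrow> ?u t) (at 0)"
    proof (rule LIM_I)
      fix e :: real assume "e > 0"
      obtain d1 where d1: "d1 > 0" "\<And>h. h \<noteq> 0 \<Longrightarrow> \<bar>h\<bar> < d1 \<Longrightarrow> (f (t + h) - f t) / h \<le> ?u t + e / 2"
        using upper_derivate_eventually[OF lip, of "e / 2" t] \<open>e > 0\<close> by auto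
      obtain d2 where d2: "d2 > 0" "\<And>h. h \<noteq> 0 \<Longrightarrow> \<bar>h\<bar> < d2 \<Longrightarrow> (?g (t + h) - ?g t) / h \<le> ?l t + e / 2"
        using upper_derivate_eventually[OF lip', of "e / 2" t] \<open>e > 0\<close> by auto
      have "norm ((f (t + h) - f t) / h - ?u t) < e" if "h \<noteq> 0" "\<bar>h\<bar> < min d1 d2" for h
      proof -
        have "(?g (t + h) - ?g t) / h = - ((f (t + h) - f t) / h)" by (simp add: diff_divide_distrib)
        then show ?thesis using d1(2)[of h] d2(2)[of h] that eq \<open>e > 0\<close> unfolding real_norm_def by linarith
      qed
      then show "\<exists>s>0. \<forall>h. h \<noteq> 0 \<and> norm (h - 0) < s \<longrightarrow> norm ((f (t + h) - f t) / h - ?u t) < e"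
        using d1(1) d2(1) by (intro exI[of _ "min d1 d2"]) auto
    qed
    then have "(f has_field_derivative ?u t) (at t)" by (simp add: DERIV_def)
    then show "\<exists>v. (f has_vector_derivative v) (at t)" using has_real_derivative_iff_has_vector_derivative by blast
  qed
qed

lemma lipschitz_differentiable_AE:
  fixes f :: "real \<Rightarrow> 'a::euclidean_space"
  assumes lip: "\<And>s t. norm (f s - f t) \<le> L * \<bar>s - t\<bar>"
  shows "AE t in lebesgue. \<exists>v. (f has_vector_derivative v) (at t)"
proof -
  have "AE t in lebesgue. \<exists>v. ((\<lambda>t. f t \<bullet> b) has_vector_derivative v) (at t)" if "b \<in> Basis" for b
  proof (rule lipschitz_real_differentiable_AE)
    show "\<bar>f s \<bullet> b - f t \<bullet> b\<bar> \<le> L * \<bar>s - t\<bar>" for s t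
      using lip[of s t] Basis_le_norm[OF that, of "f s - f t"] by (simp add: inner_diff_left)
  qed
  then have "AE t in lebesgue. \<forall>b\<in>Basis. \<exists>v. ((\<lambda>t. f t \<bullet> b) has_vector_derivative v) (at t)"
    by (simp add: AE_finite_all)
  then show ?thesis
  proof (rule AE_mp, intro AE_I2 impI)
    fix t assume "\<forall>b\<in>Basis. \<exists>v. ((\<lambda>t. f t \<bullet> b) has_vector_derivative v) (at t)"
    then obtain v where v: "\<And>b. b \<in> Basis \<Longrightarrow> ((\<lambda>t. f t \<bullet> b) has_vector_derivative v b) (at t)" by metis
    have "((\<lambda>t. \<Sum>b\<in>Basis. (f t \<bullet> b) *\<^sub>R b) has_vector_derivative (\<Sum>b\<in>Basis. v b *\<^sub>R b)) (at t)"
    proof (rule has_vector_derivative_sum)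
      fix b :: 'a assume "b \<in> Basis"
      have "bounded_linear (\<lambda>x. x *\<^sub>R b)" by (rule bounded_linear_scaleR_left)
      from bounded_linear.has_vector_derivative[OF this v[OF \<open>b \<in> Basis\<close>]]
      show "((\<lambda>t. (f t \<bullet> b) *\<^sub>R b) has_vector_derivative v b *\<^sub>R b) (at t)" .
    qed
    then show "\<exists>v. (f has_vector_derivative v) (at t)" by (auto simp: euclidean_representation)
  qed
qed

section \<open>Hybrid time domains and solutions\<close>

text \<open>An intrinsic description of hybrid time domains: it is inherited by unions of chains, by tails and
  by limits, for which no enumeration of the jump times is at hand.\<close>

definition hybrid_dom :: "(real \<times> nat) set \<Rightarrow> bool" where
  "hybrid_dom E \<longleftrightarrow> (0, 0) \<in> E \<and> (\<forall>t. (t, 0) \<in> E \<longrightarrow> 0 \<le> t) \<and>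
     (\<forall>j a b t. (a, j) \<in> E \<longrightarrow> (b, j) \<in> E \<longrightarrow> a \<le> t \<longrightarrow> t \<le> b \<longrightarrow> (t, j) \<in> E) \<and>
     (\<forall>t j. (t, Suc j) \<in> E \<longrightarrow>
        (\<exists>T. (T, j) \<in> E \<and> (T, Suc j) \<in> E \<and>
           (\<forall>s. (s, j) \<in> E \<longrightarrow> s \<le> T) \<and> (\<forall>s. (s, Suc j) \<in> E \<longrightarrow> T \<le> s)))"

text \<open>The left end of section \<open>j\<close>, attained whenever that section of a hybrid
  time domain is inhabited; for an empty section the value is meaningless.\<close>

definition jump_time :: "(real \<times> nat) set \<Rightarrow> nat \<Rightarrow> real" where
  "jump_time E j = Inf {t. (t, j) \<in> E}"

lemma hybrid_dom_convex: "hybrid_dom E \<Longrightarrow> (a, j) \<in> E \<Longrightarrow> (b, j) \<in> E \<Longrightarrow> a \<le> t \<Longrightarrow> t \<le> b \<Longrightarrow> (t, j) \<in> E"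
  unfolding hybrid_dom_def by blast

lemma hybrid_dom_zero: "hybrid_dom E \<Longrightarrow> (0, 0) \<in> E"
  unfolding hybrid_dom_def by blast

lemma jump_time_eqI:
  assumes "(T, j) \<in> E" "\<And>s. (s, j) \<in> E \<Longrightarrow> T \<le> s"
  shows "jump_time E j = T"
  unfolding jump_time_def using assms by (intro cInf_eq_minimum) auto

lemma jump_time_0: "hybrid_dom E \<Longrightarrow> jump_time E 0 = 0"
  by (rule jump_time_eqI) (auto simp: hybrid_dom_def)

lemma jump_time_Suc:
  assumes "hybrid_dom E" "(t, Suc j) \<in> E"
  shows "(jump_time E (Suc j), j) \<in> E" "(jump_time E (Suc j), Suc j) \<in> E"
    "\<And>s. (s, j) \<in> E \<Longrightarrow> s \<le> jump_time E (Suc j)"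
    "\<And>s. (s, Suc j) \<in> E \<Longrightarrow> jump_time E (Suc j) \<le> s"
proof -
  obtain T where "(T, j) \<in> E" "(T, Suc j) \<in> E" "\<forall>s. (s, j) \<in> E \<longrightarrow> s \<le> T" "\<forall>s. (s, Suc j) \<in> E \<longrightarrow> T \<le> s"
    using assms(1)[unfolded hybrid_dom_def] assms(2) by blast
  moreover from this have "jump_time E (Suc j) = T" by (intro jump_time_eqI) auto
  ultimately show "(jump_time E (Suc j), j) \<in> E" "(jump_time E (Suc j), Suc j) \<in> E"
    "\<And>s. (s, j) \<in> E \<Longrightarrow> s \<le> jump_time E (Suc j)"
    "\<And>s. (s, Suc j) \<in> E \<Longrightarrow> jump_time E (Suc j) \<le> s" by auto
qed

lemma jump_time_least:
  assumes "hybrid_dom E" "(t, j) \<in> E"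
  shows "(jump_time E j, j) \<in> E" "jump_time E j \<le> t"
proof -
  have "(jump_time E j, j) \<in> E \<and> jump_time E j \<le> t"
  proof (cases j)
    case 0 then show ?thesis using assms by (simp add: jump_time_0) (simp add: hybrid_dom_def)
  next
    case (Suc k) then show ?thesis using jump_time_Suc[OF assms(1), of t k] assms(2) by auto
  qed
  then show "(jump_time E j, j) \<in> E" "jump_time E j \<le> t" by auto
qed

lemma hybrid_dom_downward:
  assumes "hybrid_dom E"
  shows "(t, j) \<in> E \<Longrightarrow> k < j \<Longrightarrow>
    (jump_time E (Suc k), k) \<in> E \<and> (jump_time E (Suc k), Suc k) \<in> E \<and> jump_time E (Suc k) \<le> t"
proof (induction j arbitrary: t)
  case (Suc j)
  note J = jump_time_Suc[OF assms Suc.prems(1)]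
  show ?case
  proof (cases "k = j")
    case True then show ?thesis using J Suc.prems(1) by auto
  next
    case False
    then have "k < j" using Suc.prems(2) by simp
    then show ?thesis using Suc.IH[OF J(1)] J(4)[OF Suc.prems(1)] by force
  qed
qed simp

text \<open>The jump out of level \<open>k\<close> takes place no earlier than \<open>s\<close> and
  no later than \<open>t\<close>.\<close>

lemma hybrid_dom_mono:
  assumes "hybrid_dom E" "(s, k) \<in> E" "(t, j) \<in> E" "k < j"
  shows "s \<le> t"
proof -
  have *: "(jump_time E (Suc k), Suc k) \<in> E" "jump_time E (Suc k) \<le> t"
    using hybrid_dom_downward[OF assms(1,3,4)] by auto
  show ?thesis using jump_time_Suc(3)[OF assms(1) *(1) assms(2)] *(2) by linarith
qed

lemma hybrid_dom_nonneg: "hybrid_dom E \<Longrightarrow> (t, j) \<in> E \<Longrightarrow> 0 \<le> t"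
  using hybrid_dom_mono[of E 0 0 t j] hybrid_dom_zero[of E] jump_time_least(2)[of E t 0] jump_time_0[of E]
  by (cases j) auto

lemma hybrid_time_domain_imp_hybrid_dom:
  assumes "hybrid_time_domain E"
  shows "hybrid_dom E"
proof -
  obtain t :: "nat \<Rightarrow> real" where t: "t 0 = 0" "mono t" and
    E: "E = (\<Union>j. {t j..t (Suc j)} \<times> {j}) \<or>
        (\<exists>J L. E = (\<Union>j<J. {t j..t (Suc j)} \<times> {j}) \<union> L \<times> {J} \<and>
          (L = {t J..t (Suc J)} \<or> (t J < t (Suc J) \<and> L = {t J..<t (Suc J)}) \<or> L = {t J..}))"
    using assms unfolding hybrid_time_domain_def by blast
  have tS: "t j \<le> t (Suc j)" for j using t(2) by (simp add: mono_iff_le_Suc)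
  from E show ?thesis
  proof (elim disjE exE conjE)
    assume E: "E = (\<Union>j. {t j..t (Suc j)} \<times> {j})"
    have "(s, j) \<in> E \<longleftrightarrow> t j \<le> s \<and> s \<le> t (Suc j)" for s j unfolding E by auto
    then have mem: "(s, j) \<in> E \<longleftrightarrow> t j \<le> s \<and> s \<le> t (Suc j)" for s j by blast
    have J: "\<exists>T. (T, j) \<in> E \<and> (T, Suc j) \<in> E \<and> (\<forall>s. (s, j) \<in> E \<longrightarrow> s \<le> T) \<and> (\<forall>s. (s, Suc j) \<in> E \<longrightarrow> T \<le> s)" for j
      by (rule exI[of _ "t (Suc j)"]) (use tS in \<open>auto simp: mem\<close>)
    have c: "(s, j) \<in> E" if "(a, j) \<in> E" "(b, j) \<in> E" "a \<le> s" "s \<le> b" for a b s j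
      using that unfolding mem by auto
    have "(0, 0) \<in> E" "\<And>s. (s, 0) \<in> E \<Longrightarrow> 0 \<le> s"
      unfolding mem using t(1) tS[of 0] by auto
    then show ?thesis unfolding hybrid_dom_def using J c by blast
  next
    \<comment> \<open>Whatever the shape of the last piece, only its least point and its order
      convexity matter.\<close>
    have main: ?thesis if E: "E = (\<Union>j<J. {t j..t (Suc j)} \<times> {j}) \<union> L \<times> {J}"
      and L: "t J \<in> L" "\<And>s. s \<in> L \<Longrightarrow> t J \<le> s" "\<And>a b s. a \<in> L \<Longrightarrow> b \<in> L \<Longrightarrow> a \<le> s \<Longrightarrow> s \<le> b \<Longrightarrow> s \<in> L" for J L
    proof -
      have mem: "(s, j) \<in> E \<longleftrightarrow> (if j < J then t j \<le> s \<and> s \<le> t (Suc j) else j = J \<and> s \<in> L)" for s j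
        unfolding E by auto
      have z: "(0, 0) \<in> E" "\<And>s. (s, 0) \<in> E \<Longrightarrow> 0 \<le> s"
        unfolding mem using L(1,2) t(1) tS[of 0] by (fastforce split: if_splits)+
      have c: "(s, j) \<in> E" if "(a, j) \<in> E" "(b, j) \<in> E" "a \<le> s" "s \<le> b" for a b s j
        using that L(3)[of a b s] unfolding mem by (simp split: if_splits)
      have J: "\<exists>T. (T, j) \<in> E \<and> (T, Suc j) \<in> E \<and> (\<forall>s. (s, j) \<in> E \<longrightarrow> s \<le> T) \<and> (\<forall>s. (s, Suc j) \<in> E \<longrightarrow> T \<le> s)"
        if "(s, Suc j) \<in> E" for s j
        using that L(1,2) tS unfolding mem by (intro exI[of _ "t (Suc j)"]) (auto split: if_splits)
      show ?thesis unfolding hybrid_dom_def using z c J by blast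
    qed
    fix J L assume E: "E = (\<Union>j<J. {t j..t (Suc j)} \<times> {j}) \<union> L \<times> {J}"
    {
      assume "L = {t J..t (Suc J)}"
      then show ?thesis using tS[of J] by (intro main[OF E]) auto
    next
      assume "t J < t (Suc J)" "L = {t J..<t (Suc J)}"
      then show ?thesis by (intro main[OF E]) auto
    next
      assume "L = {t J..}"
      then show ?thesis by (intro main[OF E]) auto
    }
  qed
qed

text \<open>The alternatives are those allowed for the last piece of a domain, told apart by whether
  the supremum exists and is attained.\<close>

lemma interval_with_least:
  fixes S :: "real set"
  assumes m: "m \<in> S" "\<And>s. s \<in> S \<Longrightarrow> m \<le> s"
    and conv: "\<And>a b s. a \<in> S \<Longrightarrow> b \<in> S \<Longrightarrow> a \<le> s \<Longrightarrow> s \<le> b \<Longrightarrow> s \<in> S"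
  obtains c where "m \<le> c" "S = {m..c} \<or> (m < c \<and> S = {m..<c}) \<or> S = {m..}"
proof (cases "bdd_above S")
  case False
  have "S = {m..}"
  proof (intro equalityI subsetI)
    fix s assume "s \<in> {m..}"
    then obtain b where "b \<in> S" "s \<le> b" using False by (metis bdd_above.I linear)
    then show "s \<in> S" using conv[of m b s] m(1) \<open>s \<in> {m..}\<close> by auto
  qed (use m in auto)
  then show ?thesis using that[of m] by auto
next
  case True
  have up: "s \<le> Sup S" if "s \<in> S" for s using cSup_upper[OF that True] .
  have below: "s \<in> S" if s: "m \<le> s" "s < Sup S" for s
  proof -
    obtain b where "b \<in> S" "s < b" using less_cSup_iff[of S s] s(2) True m(1) by auto
    then show ?thesis using conv[of m b s] m(1) s(1) by auto
  qed
  show ?thesis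
  proof (cases "Sup S \<in> S")
    case True
    have "S = {m..Sup S}"
    proof (intro equalityI subsetI)
      fix s assume "s \<in> {m..Sup S}"
      then show "s \<in> S" using conv[OF m(1) True] by simp
    qed (use up m(2) in auto)
    then show ?thesis using that[of "Sup S"] up m(1) by auto
  next
    case False
    have "S = {m..<Sup S}"
    proof (intro equalityI subsetI)
      fix s assume s: "s \<in> S"
      then have "s \<noteq> Sup S" using False by blast
      then show "s \<in> {m..<Sup S}" using up[OF s] m(2)[OF s] by simp
    qed (use below in auto)
    moreover have "m < Sup S" using False up[OF m(1)] m(1) by (cases "m = Sup S") auto
    ultimately show ?thesis using that[of "Sup S"] by auto
  qed
qed

lemma hybrid_dom_imp_hybrid_time_domain:
  assumes "hybrid_dom E"
  shows "hybrid_time_domain E"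
proof (cases "\<forall>j. \<exists>t. (t, j) \<in> E")
  case True
  define t where "t = jump_time E"
  have mem: "(s, j) \<in> E \<longleftrightarrow> t j \<le> s \<and> s \<le> t (Suc j)" for s j
  proof -
    obtain u where "(u, Suc j) \<in> E" using True by blast
    note J = jump_time_Suc[OF assms this]
    note L = jump_time_least[OF assms J(1)]
    show ?thesis unfolding t_def
      using jump_time_least(2)[OF assms, of s j] J(3)[of s] hybrid_dom_convex[OF assms L(1) J(1), of s] by blast
  qed
  have "E = (\<Union>j. {t j..t (Suc j)} \<times> {j})" using mem by auto
  moreover have "mono t"
    unfolding mono_iff_le_Suc using True mem by (meson order_trans)
  moreover have "t 0 = 0" using assms by (simp add: t_def jump_time_0)
  ultimately show ?thesis unfolding hybrid_time_domain_def by blast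
next
  case False
  \<comment> \<open>The last inhabited level: a higher one could only be reached through level
    \<open>Suc J\<close>.\<close>
  define J where "J = (LEAST j. \<not> (\<exists>t. (t, Suc j) \<in> E))"
  have "\<exists>j. \<not> (\<exists>t. (t, Suc j) \<in> E)"
  proof -
    from False obtain j where "\<not> (\<exists>t. (t, j) \<in> E)" by blast
    then show ?thesis using hybrid_dom_zero[OF assms] by (cases j) blast+
  qed
  then have J1: "\<nexists>t. (t, Suc J) \<in> E" unfolding J_def by (rule LeastI_ex)
  have J2: "\<exists>t. (t, Suc j) \<in> E" if "j < J" for j using not_less_Least[OF that[unfolded J_def]] by blast
  have ne: "\<exists>t. (t, j) \<in> E" if "j \<le> J" for j
    using that J2[of "j - 1"] hybrid_dom_zero[OF assms] by (cases j) auto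
  have no: "(s, j) \<notin> E" if "J < j" for s j
  proof
    assume "(s, j) \<in> E"
    from hybrid_dom_downward[OF assms this that] J1 show False by blast
  qed
  let ?m = "jump_time E"
  let ?L = "{s. (s, J) \<in> E}"
  obtain u where u: "(u, J) \<in> E" using ne by blast
  obtain c where c: "?m J \<le> c" "?L = {?m J..c} \<or> (?m J < c \<and> ?L = {?m J..<c}) \<or> ?L = {?m J..}"
    by (rule interval_with_least[of "?m J" ?L])
       (use jump_time_least[OF assms] u hybrid_dom_convex[OF assms] in blast)+
  \<comment> \<open>Beyond \<open>J\<close> the sequence stays at \<open>c\<close>, which is the
    right end of the last piece if that piece is bounded. It remains monotone because
    \<open>c\<close> is at least \<open>?m J\<close>.\<close>
  define t where "t j = (if j \<le> J then ?m j else c)" for j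
  have mS: "?m j \<le> ?m (Suc j)" if j: "j < J" for j
  proof -
    obtain s where "(s, Suc j) \<in> E" using J2[OF j] by blast
    from jump_time_Suc(1)[OF assms this] show ?thesis by (rule jump_time_least(2)[OF assms])
  qed
  have "mono t" unfolding mono_iff_le_Suc
  proof
    fix j
    consider "j < J" | "j = J" | "J < j" by linarith
    then show "t j \<le> t (Suc j)" using mS c(1) by cases (auto simp: t_def)
  qed
  moreover have "t 0 = 0" using assms by (simp add: t_def jump_time_0)
  moreover have "E = (\<Union>j<J. {t j..t (Suc j)} \<times> {j}) \<union> ?L \<times> {J}"
  proof -
    have mem: "(s, j) \<in> E \<longleftrightarrow> t j \<le> s \<and> s \<le> t (Suc j)" if j: "j < J" for s j
    proof -
      obtain v where "(v, Suc j) \<in> E" using J2[OF j] by blast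
      note J = jump_time_Suc[OF assms this]
      note L = jump_time_least[OF assms J(1)]
      have "t j = ?m j" "t (Suc j) = ?m (Suc j)" using j by (auto simp: t_def)
      then show ?thesis
        using jump_time_least(2)[OF assms, of s j] J(3)[of s] hybrid_dom_convex[OF assms L(1) J(1), of s] by metis
    qed
    show ?thesis
    proof (intro set_eqI)
      fix p :: "real \<times> nat"
      obtain s j where p: "p = (s, j)" by (cases p)
      consider "j < J" | "j = J" | "J < j" by linarith
      then show "p \<in> E \<longleftrightarrow> p \<in> (\<Union>j<J. {t j..t (Suc j)} \<times> {j}) \<union> ?L \<times> {J}"
        using mem[of j s] no[of j s] unfolding p by cases auto
    qed
  qed
  moreover have "t J = ?m J" "t (Suc J) = c" by (auto simp: t_def)
  then have "?L = {t J..t (Suc J)} \<or> (t J < t (Suc J) \<and> ?L = {t J..<t (Suc J)}) \<or> ?L = {t J..}"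
    using c(2) by simp
  ultimately show ?thesis unfolding hybrid_time_domain_def by blast
qed

lemma hybrid_time_domain_iff_hybrid_dom: "hybrid_time_domain E \<longleftrightarrow> hybrid_dom E"
  using hybrid_time_domain_imp_hybrid_dom hybrid_dom_imp_hybrid_time_domain by blast

section \<open>Flows on compact intervals and the working notion of solution\<close>

text \<open>The flow map is bounded along compact curves in the flow set, so flows are locally Lipschitz.
  Only interior times are constrained, where the derivative does not depend on the surrounding time section.\<close>

definition flow_segment :: "'a::euclidean_space hybrid_system \<Rightarrow> (real \<Rightarrow> 'a) \<Rightarrow> real \<Rightarrow> real \<Rightarrow> bool" where
  "flow_segment H f a b \<longleftrightarrow>
     (\<exists>L. L-lipschitz_on {a..b} f) \<and>
     (\<exists>N. negligible N \<and>
        (\<forall>t\<in>{a<..<b} - N. \<exists>v\<in>flow_map H (f t). (f has_vector_derivative v) (at t))) \<and>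
     (\<forall>t\<in>{a..<b}. f t \<in> flow_set H)"

abbreviation val :: "'a arc \<Rightarrow> real \<Rightarrow> nat \<Rightarrow> 'a" where
  "val x t j \<equiv> the (x (t, j))"

text \<open>Every condition on flows and jumps refers to two points of the domain, never to a whole
  section with its possibly open or infinite end. This is what makes the notion pass to unions of
  chains, tails and limits; under the basic assumptions it agrees with
  \<open>is_solution\<close>.\<close>

definition sol :: "'a::euclidean_space hybrid_system \<Rightarrow> 'a arc \<Rightarrow> bool" where
  "sol H x \<longleftrightarrow> hybrid_dom (dom x) \<and>
     (\<forall>j a b. a < b \<longrightarrow> (a, j) \<in> dom x \<longrightarrow> (b, j) \<in> dom x \<longrightarrow> flow_segment H (\<lambda>t. val x t j) a b) \<and>
     (\<forall>t j. (t, j) \<in> dom x \<longrightarrow> (t, Suc j) \<in> dom x \<longrightarrow>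
        val x t j \<in> jump_set H \<and> val x t (Suc j) \<in> jump_map H (val x t j))"

lemma solD:
  assumes "sol H x"
  shows "hybrid_dom (dom x)"
    "\<And>j a b. a < b \<Longrightarrow> (a, j) \<in> dom x \<Longrightarrow> (b, j) \<in> dom x \<Longrightarrow> flow_segment H (\<lambda>t. val x t j) a b"
    "\<And>t j. (t, j) \<in> dom x \<Longrightarrow> (t, Suc j) \<in> dom x \<Longrightarrow> val x t j \<in> jump_set H"
    "\<And>t j. (t, j) \<in> dom x \<Longrightarrow> (t, Suc j) \<in> dom x \<Longrightarrow> val x t (Suc j) \<in> jump_map H (val x t j)"
  using assms unfolding sol_def by blast+

lemma abs_continuous_on_subset:
  "abs_continuous_on S f \<Longrightarrow> T \<subseteq> S \<Longrightarrow> abs_continuous_on T f"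
  unfolding abs_continuous_on_def by (meson subset_trans)

lemma lipschitz_imp_abs_continuous_on:
  fixes f :: "real \<Rightarrow> 'a::real_normed_vector"
  assumes "L-lipschitz_on S f"
  shows "abs_continuous_on S f"
  unfolding abs_continuous_on_def
proof (intro allI impI)
  fix e :: real assume "e > 0"
  have L: "L \<ge> 0" using assms by (rule lipschitz_on_nonneg)
  have "(\<Sum>K\<in>\<D>. norm (f (Sup K) - f (Inf K))) < e"
    if D: "\<D> division_of T" "T \<subseteq> S" "(\<Sum>K\<in>\<D>. Sup K - Inf K) < e / (L + 1)" for \<D> T
  proof -
    have "(\<Sum>K\<in>\<D>. norm (f (Sup K) - f (Inf K))) \<le> (\<Sum>K\<in>\<D>. L * (Sup K - Inf K))"
    proof (rule sum_mono)
      fix K assume K: "K \<in> \<D>"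
      note KI = division_of_intervalD[OF D(1) K]
      have "Sup K \<in> K" "Inf K \<in> K" using KI by (metis atLeastAtMost_iff order_refl)+
      then have "Sup K \<in> S" "Inf K \<in> S" using division_ofD(2)[OF D(1) K] D(2) by auto
      from lipschitz_onD[OF assms this] show "norm (f (Sup K) - f (Inf K)) \<le> L * (Sup K - Inf K)"
        using KI(2) by (simp add: dist_norm)
    qed
    also have "\<dots> = L * (\<Sum>K\<in>\<D>. Sup K - Inf K)" by (simp add: sum_distrib_left)
    also have "\<dots> \<le> L * (e / (L + 1))" using D(3) L by (intro mult_left_mono) auto
    also have "\<dots> < e" using L \<open>e > 0\<close> by (simp add: field_simps)
    finally show ?thesis .
  qed
  then show "\<exists>\<delta>>0. \<forall>\<D> T. \<D> division_of T \<longrightarrow> T \<subseteq> S \<longrightarrow> (\<Sum>K\<in>\<D>. Sup K - Inf K) < \<delta> \<longrightarrow>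
      (\<Sum>K\<in>\<D>. norm (f (Sup K) - f (Inf K))) < e"
    using L \<open>e > 0\<close> by (intro exI[of _ "e / (L + 1)"]) auto
qed

lemma abs_continuous_on_imp_continuous_on:
  fixes f :: "real \<Rightarrow> 'a::real_normed_vector"
  assumes "abs_continuous_on {a..b} f"
  shows "continuous_on {a..b} f"
  unfolding continuous_on_iff
proof (intro ballI allI impI)
  fix s e :: real assume s: "s \<in> {a..b}" and "e > 0"
  then obtain d where d: "d > 0" "\<And>\<D> T. \<D> division_of T \<Longrightarrow> T \<subseteq> {a..b} \<Longrightarrow>
      (\<Sum>K\<in>\<D>. Sup K - Inf K) < d \<Longrightarrow> (\<Sum>K\<in>\<D>. norm (f (Sup K) - f (Inf K))) < e"
    using assms unfolding abs_continuous_on_def by meson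
  have "dist (f t) (f s) < e" if t: "t \<in> {a..b}" "dist t s < d" for t
  proof -
    let ?c = "min s t" and ?d = "max s t"
    \<comment> \<open>A division with a single interval turns absolute continuity into
      continuity.\<close>
    have "{{?c..?d}} division_of {?c..?d}" using division_of_self[of ?c ?d] by (simp add: cbox_interval)
    then have "(\<Sum>K\<in>{{?c..?d}}. norm (f (Sup K) - f (Inf K))) < e"
      by (rule d(2)) (use s t in \<open>auto simp: dist_real_def min_def max_def\<close>)
    then show ?thesis by (auto simp: dist_norm min_def max_def norm_minus_commute split: if_splits)
  qed
  then show "\<exists>d>0. \<forall>t\<in>{a..b}. dist t s < d \<longrightarrow> dist (f t) (f s) < e" using d(1) by blast
qed

lemma abs_continuous_on_degenerate:
  fixes f :: "real \<Rightarrow> 'a::real_normed_vector"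
  assumes "b \<le> a"
  shows "abs_continuous_on {a..b} f"
proof (rule lipschitz_imp_abs_continuous_on)
  have "s = t" if "s \<in> {a..b}" "t \<in> {a..b}" for s t using that assms by auto
  then show "0-lipschitz_on {a..b} f" by (intro lipschitz_onI) fastforce+
qed

text \<open>With \<open>?w\<close> minus the increment itself, Cauchy-Schwarz bounds
  \<open>?w \<bullet> v\<close> from below by \<open>- (norm ?w * M)\<close>, and the increment
  lemma turns this into \<open>norm ?w * norm ?w \<le> norm ?w * (M * (t - s))\<close>.\<close>

lemma lipschitz_on_bounded_derivative:
  fixes f :: "real \<Rightarrow> 'a::euclidean_space"
  assumes ac: "abs_continuous_on {a..b} f" and N: "negligible N"
    and der: "\<And>t. t \<in> {a<..<b} - N \<Longrightarrow> \<exists>v. norm v \<le> M \<and> (f has_vector_derivative v) (at t)"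
    and M: "0 \<le> M"
  shows "M-lipschitz_on {a..b} f"
proof (rule lipschitz_onI)
  have *: "norm (f t - f s) \<le> M * (t - s)" if st: "s \<in> {a..b}" "t \<in> {a..b}" "s \<le> t" for s t
  proof -
    let ?w = "f s - f t"
    have "AE r in lebesgue. r \<in> {s<..<t} \<longrightarrow> (\<exists>v. - (norm ?w * M) \<le> ?w \<bullet> v \<and> (f has_vector_derivative v) (at r))"
    proof (rule AE_I'[of N])
      show "N \<in> null_sets lebesgue" using N by (simp add: negligible_iff_null_sets)
      show "{r \<in> space lebesgue. \<not> (r \<in> {s<..<t} \<longrightarrow> (\<exists>v. - (norm ?w * M) \<le> ?w \<bullet> v \<and> (f has_vector_derivative v) (at r)))} \<subseteq> N"
      proof (clarsimp, rule ccontr)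
        fix r assume r: "s < r" "r < t" "r \<notin> N"
          and no: "\<forall>v. - (norm ?w * M) \<le> ?w \<bullet> v \<longrightarrow> \<not> (f has_vector_derivative v) (at r)"
        obtain v where v: "norm v \<le> M" "(f has_vector_derivative v) (at r)" using der[of r] r st by auto
        have "\<bar>?w \<bullet> v\<bar> \<le> norm ?w * norm v" by (rule Cauchy_Schwarz_ineq2)
        also have "\<dots> \<le> norm ?w * M" using v(1) by (intro mult_left_mono) auto
        finally show False using no v(2) by (auto simp: abs_le_iff)
      qed
    qed
    from abs_continuous_increment_ge[OF abs_continuous_on_subset[OF ac] st(3) this] st
    have "- (norm ?w * M) * (t - s) \<le> ?w \<bullet> (f t - f s)" by simp
    also have "?w \<bullet> (f t - f s) = - (?w \<bullet> ?w)" by (simp add: inner_diff_left inner_diff_right)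
    also have "?w \<bullet> ?w = norm ?w * norm ?w" by (simp add: dot_square_norm power2_eq_square)
    finally have "norm ?w * norm ?w \<le> norm ?w * (M * (t - s))" by (simp add: mult.assoc)
    then show ?thesis using M st(3) by (cases "?w = 0") (auto simp: norm_minus_commute)
  qed
  show "dist (f s) (f t) \<le> M * dist s t" if "s \<in> {a..b}" "t \<in> {a..b}" for s t
    using *[of s t] *[of t s] that by (cases "s \<le> t") (auto simp: dist_norm norm_minus_commute)
qed fact

lemma locally_bounded_on_compact:
  assumes "locally_bounded_on S M" "compact K" "K \<subseteq> S"
  shows "bounded (\<Union>y\<in>K. M y)"
proof -
  have "\<forall>x\<in>K. \<exists>U. open U \<and> x \<in> U \<and> bounded (\<Union>y\<in>U \<inter> S. M y)"
    using assms(1,3) unfolding locally_bounded_on_def by blast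
  from bchoice[OF this] obtain U where U: "\<forall>x\<in>K. open (U x) \<and> x \<in> U x \<and> bounded (\<Union>y\<in>U x \<inter> S. M y)" ..
  then have "\<And>x. x \<in> K \<Longrightarrow> open (U x)" "K \<subseteq> (\<Union>x\<in>K. U x)" by blast+
  from compactE_image[OF assms(2) this] obtain F where F: "F \<subseteq> K" "finite F" "K \<subseteq> (\<Union>x\<in>F. U x)"
    by (metis (no_types))
  have "bounded (\<Union>x\<in>F. \<Union>y\<in>U x \<inter> S. M y)"
    by (rule bounded_UN[OF F(2)]) (use F(1) U in blast)
  then show ?thesis by (rule bounded_subset) (use F(3) assms(3) in blast)
qed

lemma flow_map_bounded_on_compact:
  assumes "basic_assumptions H" "compact K"
  obtains M where "0 \<le> M" "\<And>z v. z \<in> K \<inter> flow_set H \<Longrightarrow> v \<in> flow_map H z \<Longrightarrow> norm v \<le> M"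
proof -
  have "bounded (\<Union>y\<in>K \<inter> flow_set H. flow_map H y)"
    using assms by (intro locally_bounded_on_compact compact_Int_closed) (auto simp: basic_assumptions_def)
  then obtain M where "\<And>v. v \<in> (\<Union>y\<in>K \<inter> flow_set H. flow_map H y) \<Longrightarrow> norm v \<le> M"
    unfolding bounded_iff by blast
  then show ?thesis using that[of "max M 0"] by fastforce
qed

lemma jump_map_bounded_on_compact:
  assumes "basic_assumptions H" "compact K"
  shows "bounded (\<Union>y\<in>K \<inter> jump_set H. jump_map H y)"
  using assms by (intro locally_bounded_on_compact compact_Int_closed) (auto simp: basic_assumptions_def)

lemma flow_segment_lipschitz:
  assumes "flow_segment H f a b"
    and M: "0 \<le> M" "\<And>t v. t \<in> {a<..<b} \<Longrightarrow> v \<in> flow_map H (f t) \<Longrightarrow> norm v \<le> M"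
  shows "M-lipschitz_on {a..b} f"
proof -
  obtain L N where L: "L-lipschitz_on {a..b} f" and N: "negligible N"
    "\<forall>t\<in>{a<..<b} - N. \<exists>v\<in>flow_map H (f t). (f has_vector_derivative v) (at t)"
    using assms(1) unfolding flow_segment_def by blast
  show ?thesis
    by (rule lipschitz_on_bounded_derivative[OF lipschitz_imp_abs_continuous_on[OF L] N(1) _ M(1)])
       (use N(2) M(2) in blast)
qed

lemma flow_segment_continuous: "flow_segment H f a b \<Longrightarrow> continuous_on {a..b} f"
  unfolding flow_segment_def by (auto intro: lipschitz_on_continuous_on)

lemma flow_segmentI:
  assumes H: "basic_assumptions H" and ab: "a < b"
    and ac: "abs_continuous_on {a..b} f" and N: "negligible N"
    and der: "\<And>t. t \<in> {a<..<b} - N \<Longrightarrow> \<exists>v\<in>flow_map H (f t). (f has_vector_derivative v) (at t)"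
    and C: "\<And>t. t \<in> {a..<b} \<Longrightarrow> f t \<in> flow_set H"
  shows "flow_segment H f a b"
proof -
  have cont: "continuous_on {a..b} f" using ac by (rule abs_continuous_on_imp_continuous_on)
  then have "compact (f ` {a..b})" by (intro compact_continuous_image) auto
  then obtain M where M: "0 \<le> M" "\<And>z v. z \<in> f ` {a..b} \<inter> flow_set H \<Longrightarrow> v \<in> flow_map H z \<Longrightarrow> norm v \<le> M"
    using flow_map_bounded_on_compact[OF H] by blast
  have "M-lipschitz_on {a..b} f"
  proof (rule lipschitz_on_bounded_derivative[OF ac N _ M(1)])
    fix t assume t: "t \<in> {a<..<b} - N"
    then obtain v where "v \<in> flow_map H (f t)" "(f has_vector_derivative v) (at t)" using der by blast
    moreover have "f t \<in> f ` {a..b} \<inter> flow_set H" using t C[of t] by auto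
    ultimately show "\<exists>v. norm v \<le> M \<and> (f has_vector_derivative v) (at t)" using M(2) by blast
  qed
  then show ?thesis unfolding flow_segment_def using N der C by blast
qed

lemma flow_segment_cong:
  assumes f: "flow_segment H f a b" and eq: "\<And>t. t \<in> {a..b} \<Longrightarrow> f t = g t"
  shows "flow_segment H g a b"
proof -
  obtain L N where L: "L-lipschitz_on {a..b} f" and N: "negligible N"
    "\<And>t. t \<in> {a<..<b} - N \<Longrightarrow> \<exists>v\<in>flow_map H (f t). (f has_vector_derivative v) (at t)"
    and C: "\<forall>t\<in>{a..<b}. f t \<in> flow_set H"
    using f unfolding flow_segment_def by blast
  have "\<exists>v\<in>flow_map H (g t). (g has_vector_derivative v) (at t)" if t: "t \<in> {a<..<b} - N" for t
  proof -
    obtain v where v: "v \<in> flow_map H (f t)" "(f has_vector_derivative v) (at t)" using N(2)[OF t] by blast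
    have "(g has_vector_derivative v) (at t)"
      by (rule has_vector_derivative_transform_within_open[OF v(2), of "{a<..<b}"]) (use t eq in auto)
    moreover have "g t = f t" using eq[of t] t by auto
    ultimately show ?thesis using v(1) by auto
  qed
  moreover have "L-lipschitz_on {a..b} g" using L eq unfolding lipschitz_on_def by auto
  moreover have "\<forall>t\<in>{a..<b}. g t \<in> flow_set H" using C eq by force
  ultimately show ?thesis unfolding flow_segment_def using N(1) by blast
qed

lemma flow_segment_subset:
  assumes "flow_segment H f a b" "a \<le> c" "d \<le> b"
  shows "flow_segment H f c d"
proof -
  have "{c..d} \<subseteq> {a..b}" "{c<..<d} \<subseteq> {a<..<b}" "{c..<d} \<subseteq> {a..<b}" using assms(2,3) by auto
  then show ?thesis using assms(1) unfolding flow_segment_def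
    by (meson Diff_mono lipschitz_on_subset order_refl subsetD)
qed

lemma flow_segment_translation:
  assumes "flow_segment H f (a + s) (b + s)"
  shows "flow_segment H (\<lambda>t. f (t + s)) a b"
proof -
  obtain L N where L: "L-lipschitz_on {a + s..b + s} f" and N: "negligible N"
    "\<And>t. t \<in> {a + s<..<b + s} - N \<Longrightarrow> \<exists>v\<in>flow_map H (f t). (f has_vector_derivative v) (at t)"
    and C: "\<forall>t\<in>{a + s..<b + s}. f t \<in> flow_set H"
    using assms unfolding flow_segment_def by blast
  have "L-lipschitz_on {a..b} (\<lambda>t. f (t + s))"
  proof (rule lipschitz_onI)
    show "dist (f (t + s)) (f (u + s)) \<le> L * dist t u" if "t \<in> {a..b}" "u \<in> {a..b}" for t u
      using lipschitz_onD[OF L, of "t + s" "u + s"] that by (simp add: dist_norm)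
  qed (rule lipschitz_on_nonneg[OF L])
  moreover have "\<exists>v\<in>flow_map H (f (t + s)). ((\<lambda>t. f (t + s)) has_vector_derivative v) (at t)"
    if t: "t \<in> {a<..<b} - (+) (- s) ` N" for t
  proof -
    have "t + s \<notin> N"
    proof
      assume "t + s \<in> N"
      then have "- s + (t + s) \<in> (+) (- s) ` N" by (rule imageI)
      then show False using t by simp
    qed
    then obtain v where v: "v \<in> flow_map H (f (t + s))" "(f has_vector_derivative v) (at (t + s))"
      using N(2)[of "t + s"] t by auto
    have "((\<lambda>t. t + s) has_vector_derivative 1) (at t)" by (auto intro!: derivative_eq_intros)
    from vector_diff_chain_at[OF this v(2)] v(1) show ?thesis by (auto simp: o_def)
  qed
  moreover have "negligible ((+) (- s) ` N)" using N(1) by (rule negligible_translation)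
  moreover have "\<forall>t\<in>{a..<b}. f (t + s) \<in> flow_set H" using C by auto
  ultimately show ?thesis unfolding flow_segment_def by blast
qed

lemma is_solution_imp_sol:
  assumes H: "basic_assumptions H" and x: "is_solution H x"
  shows "sol H x"
proof -
  have dom: "hybrid_dom (dom x)"
    and ac: "\<And>j. locally_abs_continuous_on (time_section x j) (\<lambda>t. val x t j)"
    using x unfolding is_solution_def hybrid_arc_def hybrid_time_domain_iff_hybrid_dom by auto
  have "flow_segment H (\<lambda>t. val x t j) a b" if ab: "a < b" "(a, j) \<in> dom x" "(b, j) \<in> dom x" for j a b
  proof -
    let ?I = "time_section x j"
    have sub: "{a..b} \<subseteq> ?I" unfolding time_section_def using hybrid_dom_convex[OF dom ab(2,3)] by fastforce
    then have int: "{a<..<b} \<subseteq> interior ?I" by (intro interior_maximal) auto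
    then have "interior ?I \<noteq> {}" using ab(1) by force
    then have AE: "AE t in lebesgue. t \<in> ?I \<longrightarrow> (\<exists>v \<in> flow_map H (val x t j). ((\<lambda>s. val x s j) has_vector_derivative v) (at t within ?I))"
      and C: "\<And>t. t \<in> ?I \<Longrightarrow> (\<exists>s\<in>?I. t < s) \<Longrightarrow> val x t j \<in> flow_set H"
      using x unfolding is_solution_def Let_def by blast+
    from AE obtain N where N: "N \<in> null_sets lebesgue"
      "\<And>t. t \<notin> N \<Longrightarrow> t \<in> ?I \<Longrightarrow> \<exists>v \<in> flow_map H (val x t j). ((\<lambda>s. val x s j) has_vector_derivative v) (at t within ?I)"
      by (rule AE_E3) auto
    show ?thesis
    proof (rule flow_segmentI[OF H ab(1)])
      show "abs_continuous_on {a..b} (\<lambda>t. val x t j)"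
        using ac sub unfolding locally_abs_continuous_on_def by blast
      show "negligible N" using N(1) by (simp add: negligible_iff_null_sets)
      show "\<exists>v\<in>flow_map H (val x t j). ((\<lambda>t. val x t j) has_vector_derivative v) (at t)" if "t \<in> {a<..<b} - N" for t
      proof -
        have "t \<in> interior ?I" using int that by blast
        then have "at t within ?I = at t" by (rule at_within_interior)
        moreover have "t \<notin> N" "t \<in> ?I" using that sub by auto
        ultimately show ?thesis using N(2)[of t] by simp
      qed
      show "val x t j \<in> flow_set H" if "t \<in> {a..<b}" for t
      proof -
        have "t \<in> {a..b}" "b \<in> {a..b}" "t < b" using that by auto
        then show ?thesis using C sub by blast
      qed
    qed
  qed
  then show ?thesis using x dom unfolding sol_def is_solution_def by blast
qed

text \<open>Every pair of points of a section has its own null set. Pairs of rational points are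
  countably many and surround every interior point, and the frontier of the section is negligible
  because the section is an interval.\<close>

lemma sol_imp_is_solution:
  assumes x: "sol H x"
  shows "is_solution H x"
proof -
  note dom = solD(1)[OF x]
  have mem: "t \<in> time_section x j \<longleftrightarrow> (t, j) \<in> dom x" for t j by (simp add: time_section_def)
  have "locally_abs_continuous_on (time_section x j) (\<lambda>t. val x t j)" for j
    unfolding locally_abs_continuous_on_def
  proof (intro allI impI)
    fix a b assume sub: "{a..b} \<subseteq> time_section x j"
    show "abs_continuous_on {a..b} (\<lambda>t. val x t j)"
    proof (cases "a < b")
      case True
      then have "a \<in> time_section x j" "b \<in> time_section x j" using sub by auto
      then have "flow_segment H (\<lambda>t. val x t j) a b" using solD(2)[OF x True] by (simp add: mem)
      then show ?thesis unfolding flow_segment_def using lipschitz_imp_abs_continuous_on by blast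
    qed (simp add: abs_continuous_on_degenerate)
  qed
  then have "hybrid_arc x" unfolding hybrid_arc_def using hybrid_time_domain_iff_hybrid_dom dom by blast
  moreover have "AE t in lebesgue. t \<in> time_section x j \<longrightarrow> (\<exists>v \<in> flow_map H (val x t j).
      ((\<lambda>s. val x s j) has_vector_derivative v) (at t within time_section x j))" for j
  proof -
    let ?I = "time_section x j"
    define \<Q> where "\<Q> = {(p, q). p \<in> \<rat> \<and> q \<in> \<rat> \<and> p < q \<and> p \<in> ?I \<and> q \<in> ?I}"
    have "countable \<Q>" by (rule countable_subset[of _ "\<rat> \<times> \<rat>"]) (auto simp: \<Q>_def countable_rat)
    have "\<exists>N. negligible N \<and> (\<forall>t\<in>{fst i<..<snd i} - N. \<exists>v\<in>flow_map H (val x t j). ((\<lambda>s. val x s j) has_vector_derivative v) (at t))"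
      if i: "i \<in> \<Q>" for i
    proof -
      have "flow_segment H (\<lambda>s. val x s j) (fst i) (snd i)"
        using i by (intro solD(2)[OF x]) (auto simp: \<Q>_def mem)
      then show ?thesis unfolding flow_segment_def by blast
    qed
    then obtain N where N: "\<And>i. i \<in> \<Q> \<Longrightarrow> negligible (N i)"
      "\<And>i t. i \<in> \<Q> \<Longrightarrow> t \<in> {fst i<..<snd i} - N i \<Longrightarrow> \<exists>v\<in>flow_map H (val x t j). ((\<lambda>s. val x s j) has_vector_derivative v) (at t)"
      by metis
    have "convex ?I"
      unfolding is_interval_convex_1[symmetric] is_interval_1 Ball_def mem using hybrid_dom_convex[OF dom] by blast
    then have "negligible (frontier ?I)" by (rule negligible_convex_frontier)
    moreover have "negligible (\<Union>(N ` \<Q>))"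
      using \<open>countable \<Q>\<close> N(1) by (intro negligible_countable_Union) auto
    ultimately have neg: "negligible (frontier ?I \<union> \<Union>(N ` \<Q>))" by (rule negligible_Un)
    show ?thesis
    proof (rule AE_I'[of "frontier ?I \<union> \<Union>(N ` \<Q>)"])
      show "frontier ?I \<union> \<Union>(N ` \<Q>) \<in> null_sets lebesgue" using neg by (simp add: negligible_iff_null_sets)
      have "\<exists>v \<in> flow_map H (val x t j). ((\<lambda>s. val x s j) has_vector_derivative v) (at t within ?I)"
        if t: "t \<in> ?I" "t \<notin> frontier ?I" "t \<notin> \<Union>(N ` \<Q>)" for t
      proof -
        have ti: "t \<in> interior ?I" using t(1,2) closure_subset[of ?I] by (auto simp: frontier_def)
        then obtain e where e: "e > 0" "ball t e \<subseteq> ?I" by (auto simp: mem_interior)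
        obtain p q where pq: "p \<in> \<rat>" "t - e < p" "p < t" "q \<in> \<rat>" "t < q" "q < t + e"
          using Rats_dense_in_real[of "t - e" t] Rats_dense_in_real[of t "t + e"] e(1) that
          by (metis diff_gt_0_iff_gt diff_less_eq less_add_same_cancel1 diff_add_cancel)
        then have "p \<in> ball t e" "q \<in> ball t e" by (auto simp: dist_real_def)
        then have i: "(p, q) \<in> \<Q>" using e(2) pq by (auto simp: \<Q>_def)
        have "t \<in> {fst (p, q)<..<snd (p, q)} - N (p, q)" using t(3) pq(3,5) i by auto
        then have "\<exists>v\<in>flow_map H (val x t j). ((\<lambda>s. val x s j) has_vector_derivative v) (at t)"
          by (rule N(2)[OF i])
        then show ?thesis unfolding at_within_interior[OF ti] .
      qed
      then show "{t \<in> space lebesgue. \<not> (t \<in> ?I \<longrightarrow> (\<exists>v \<in> flow_map H (val x t j).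
          ((\<lambda>s. val x s j) has_vector_derivative v) (at t within ?I)))} \<subseteq> frontier ?I \<union> \<Union>(N ` \<Q>)" by blast
    qed
  qed
  moreover have "val x t j \<in> flow_set H" if "t \<in> time_section x j" "s \<in> time_section x j" "t < s" for t s j
    using solD(2)[OF x that(3), of j] that unfolding mem flow_segment_def by auto
  ultimately show ?thesis unfolding is_solution_def Let_def using solD(3,4)[OF x] by blast
qed

lemma is_solution_iff_sol: "basic_assumptions H \<Longrightarrow> is_solution H x \<longleftrightarrow> sol H x"
  using is_solution_imp_sol sol_imp_is_solution by blast

section \<open>Restricted systems and extension to maximal solutions\<close>

lemma basic_assumptions_restriction:
  assumes "basic_assumptions H" "closed \<Gamma>"
  shows "basic_assumptions (restriction H \<Gamma>)"
proof -
  have *: "locally_bounded_on (S \<inter> \<Gamma>) M" if "locally_bounded_on S M" for S and M :: "'a \<Rightarrow> 'a set"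
    unfolding locally_bounded_on_def
  proof
    fix x assume "x \<in> S \<inter> \<Gamma>"
    then obtain U where U: "open U" "x \<in> U" "bounded (\<Union>y\<in>U \<inter> S. M y)"
      using \<open>locally_bounded_on S M\<close> unfolding locally_bounded_on_def by blast
    have "bounded (\<Union>y\<in>U \<inter> (S \<inter> \<Gamma>). M y)" by (rule bounded_subset[OF U(3)]) blast
    then show "\<exists>U. open U \<and> x \<in> U \<and> bounded (\<Union>y\<in>U \<inter> (S \<inter> \<Gamma>). M y)" using U by blast
  qed
  show ?thesis
    using assms unfolding basic_assumptions_def restriction_def by (auto intro: *)
qed

text \<open>Once a jump time is named, every clause of \<open>sol\<close> concerns at most two given
  points of the domain, and two points of the union of a chain already lie in one member of
  it.\<close>

lemma sol_chain_Union:
  fixes u :: "'a::euclidean_space arc"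
  assumes ne: "y0 \<in> A" and A: "\<And>y. y \<in> A \<Longrightarrow> sol H y"
    and chain: "\<And>y z. y \<in> A \<Longrightarrow> z \<in> A \<Longrightarrow> y \<subseteq>\<^sub>m z \<or> z \<subseteq>\<^sub>m y"
    and u: "\<And>y. y \<in> A \<Longrightarrow> y \<subseteq>\<^sub>m u" and domu: "dom u = (\<Union>y\<in>A. dom y)"
  shows "sol H u"
proof -
  have val: "p \<in> dom u" "the (u p) = the (y p)" if "y \<in> A" "p \<in> dom y" for y p
    using u[OF that(1)] that domu unfolding map_le_def by auto
  have common: "\<exists>y\<in>A. p \<in> dom y \<and> q \<in> dom y" if "p \<in> dom u" "q \<in> dom u" for p q
  proof -
    obtain y z where "y \<in> A" "p \<in> dom y" "z \<in> A" "q \<in> dom z" using \<open>p \<in> dom u\<close> \<open>q \<in> dom u\<close> unfolding domu by blast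
    then show ?thesis using chain[of y z] map_le_implies_dom_le by blast
  qed
  have "hybrid_dom (dom u)"
    unfolding hybrid_dom_def
  proof (intro conjI allI impI)
    show "(0, 0) \<in> dom u" using val(1)[OF ne hybrid_dom_zero[OF solD(1)[OF A[OF ne]]]] .
    show "0 \<le> t" if t: "(t, 0) \<in> dom u" for t
    proof -
      obtain y where "y \<in> A" "(t, 0) \<in> dom y" using common[OF t t] by blast
      then show ?thesis using hybrid_dom_nonneg solD(1) A by blast
    qed
    show "(t, j) \<in> dom u" if ab: "(a, j) \<in> dom u" "(b, j) \<in> dom u" "a \<le> t" "t \<le> b" for j a b t
    proof -
      obtain y where "y \<in> A" "(a, j) \<in> dom y" "(b, j) \<in> dom y" using common[OF ab(1,2)] by blast
      then show ?thesis using hybrid_dom_convex[OF solD(1)[OF A]] ab(3,4) val(1) by blast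
    qed
    show "\<exists>T. (T, j) \<in> dom u \<and> (T, Suc j) \<in> dom u \<and> (\<forall>s. (s, j) \<in> dom u \<longrightarrow> s \<le> T) \<and> (\<forall>s. (s, Suc j) \<in> dom u \<longrightarrow> T \<le> s)"
      if t: "(t, Suc j) \<in> dom u" for t j
    proof -
      obtain y where y: "y \<in> A" "(t, Suc j) \<in> dom y" using common[OF t t] by blast
      let ?T = "jump_time (dom y) (Suc j)"
      note J = jump_time_Suc[OF solD(1)[OF A[OF y(1)]] y(2)]
      have T: "(?T, j) \<in> dom u" "(?T, Suc j) \<in> dom u" using J(1,2) val(1)[OF y(1)] by auto
      have "s \<le> ?T" if s: "(s, j) \<in> dom u" for s
      proof -
        obtain z where "z \<in> A" "(s, j) \<in> dom z" "(?T, Suc j) \<in> dom z" using common[OF s T(2)] by blast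
        then show ?thesis using hybrid_dom_mono[OF solD(1)[OF A]] by blast
      qed
      moreover have "?T \<le> s" if s: "(s, Suc j) \<in> dom u" for s
      proof -
        obtain z where "z \<in> A" "(s, Suc j) \<in> dom z" "(?T, j) \<in> dom z" using common[OF s T(1)] by blast
        then show ?thesis using hybrid_dom_mono[OF solD(1)[OF A]] by blast
      qed
      ultimately show ?thesis using T by blast
    qed
  qed
  moreover have "flow_segment H (\<lambda>t. val u t j) a b"
    if ab: "a < b" "(a, j) \<in> dom u" "(b, j) \<in> dom u" for j a b
  proof -
    obtain y where y: "y \<in> A" "(a, j) \<in> dom y" "(b, j) \<in> dom y" using common[OF ab(2,3)] by blast
    show ?thesis
    proof (rule flow_segment_cong)
      show "flow_segment H (\<lambda>t. val y t j) a b" using solD(2)[OF A[OF y(1)] ab(1)] y by blast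
      show "val y t j = val u t j" if "t \<in> {a..b}" for t
        using that hybrid_dom_convex[OF solD(1)[OF A[OF y(1)]] y(2,3), of t] val(2)[OF y(1), of "(t, j)"] by auto
    qed
  qed
  moreover have "val u t j \<in> jump_set H \<and> val u t (Suc j) \<in> jump_map H (val u t j)"
    if t: "(t, j) \<in> dom u" "(t, Suc j) \<in> dom u" for t j
  proof -
    obtain y where y: "y \<in> A" "(t, j) \<in> dom y" "(t, Suc j) \<in> dom y" using common[OF t] by blast
    then show ?thesis using solD(3,4)[OF A[OF y(1)]] val(2)[OF y(1)] by metis
  qed
  ultimately show ?thesis unfolding sol_def by blast
qed

text \<open>Zorn's lemma for the extension order of arcs. It links arbitrary solutions to the
  hypotheses, which speak of maximal ones.\<close>

lemma sol_extends_to_maximal: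
  fixes x :: "'a::euclidean_space arc"
  assumes x: "sol H x"
  obtains m where "x \<subseteq>\<^sub>m m" "sol H m" "\<And>y. sol H y \<Longrightarrow> m \<subseteq>\<^sub>m y \<Longrightarrow> y = m"
proof -
  let ?A = "{y. sol H y \<and> x \<subseteq>\<^sub>m y}"
  have "\<exists>m\<in>?A. \<forall>y\<in>?A. m \<subseteq>\<^sub>m y \<longrightarrow> y = m"
  proof (rule predicate_Zorn)
    show "partial_order_on ?A (relation_of (\<subseteq>\<^sub>m) ?A)"
      by (rule partial_order_on_relation_ofI) (auto intro: map_le_trans map_le_antisym)
    fix \<C> assume "\<C> \<in> Chains (relation_of (\<subseteq>\<^sub>m) ?A)"
    then have C: "\<And>y. y \<in> \<C> \<Longrightarrow> y \<in> ?A" "\<And>y z. y \<in> \<C> \<Longrightarrow> z \<in> \<C> \<Longrightarrow> y \<subseteq>\<^sub>m z \<or> z \<subseteq>\<^sub>m y"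
      unfolding Chains_def relation_of_def by auto
    show "\<exists>u\<in>?A. \<forall>y\<in>\<C>. y \<subseteq>\<^sub>m u"
    proof (cases "\<C> = {}")
      case True then show ?thesis using x by auto
    next
      case False
      then obtain y0 where y0: "y0 \<in> \<C>" by blast
      \<comment> \<open>The choice of the member is immaterial, since members of a chain agree where
        both are defined.\<close>
      define u where "u p = (if \<exists>y\<in>\<C>. p \<in> dom y then (SOME y. y \<in> \<C> \<and> p \<in> dom y) p else None)" for p
      have le: "y \<subseteq>\<^sub>m u" if y: "y \<in> \<C>" for y
        unfolding map_le_def
      proof
        fix p assume p: "p \<in> dom y"
        define z where "z = (SOME y. y \<in> \<C> \<and> p \<in> dom y)"
        have z: "z \<in> \<C> \<and> p \<in> dom z" unfolding z_def by (rule someI[of _ y]) (use y p in blast)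
        then have "y \<subseteq>\<^sub>m z \<or> z \<subseteq>\<^sub>m y" using C(2)[OF y] by blast
        then have "y p = z p" using z p unfolding map_le_def by force
        moreover have "u p = z p" unfolding u_def z_def[symmetric] using y p by auto
        ultimately show "y p = u p" by simp
      qed
      have "dom u = (\<Union>y\<in>\<C>. dom y)"
      proof
        show "dom u \<subseteq> (\<Union>y\<in>\<C>. dom y)" unfolding u_def by (auto split: if_splits)
        show "(\<Union>y\<in>\<C>. dom y) \<subseteq> dom u" using le map_le_implies_dom_le by blast
      qed
      then have "sol H u" by (rule sol_chain_Union[OF y0 _ C(2) le, rotated -1]) (use C(1) in blast)
      moreover have "x \<subseteq>\<^sub>m u" using C(1)[OF y0] le[OF y0] map_le_trans by blast
      ultimately show ?thesis using le by blast
    qed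
  qed
  then obtain m where m: "m \<in> ?A" "\<And>y. y \<in> ?A \<Longrightarrow> m \<subseteq>\<^sub>m y \<Longrightarrow> y = m" by blast
  show ?thesis
  proof (rule that[of m])
    show "y = m" if "sol H y" "m \<subseteq>\<^sub>m y" for y using m that map_le_trans[of x m y] by blast
  qed (use m in auto)
qed

lemma sol_extends_to_solutions:
  assumes H: "basic_assumptions H" and x: "sol H x" "val x 0 0 \<in> U"
  obtains y where "y \<in> solutions H U" "x \<subseteq>\<^sub>m y"
proof -
  obtain m where m: "x \<subseteq>\<^sub>m m" "sol H m" "\<And>y. sol H y \<Longrightarrow> m \<subseteq>\<^sub>m y \<Longrightarrow> y = m"
    using sol_extends_to_maximal[OF x(1)] by blast
  have "(0, 0) \<in> dom x" using hybrid_dom_zero[OF solD(1)[OF x(1)]] .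
  then have "m (0, 0) = Some (val x 0 0)" using m(1) unfolding map_le_def by force
  then have "m \<in> solutions H U"
    using m x(2) unfolding solutions_def maximal_solution_def is_solution_iff_sol[OF H] by blast
  then show ?thesis using that m(1) by blast
qed

lemma solutionsD:
  assumes "basic_assumptions H" "x \<in> solutions H U"
  shows "sol H x" "val x 0 0 \<in> U"
  using assms is_solution_imp_sol unfolding solutions_def maximal_solution_def by auto

lemma solutions_singleton: "x \<in> solutions H U \<Longrightarrow> x \<in> solutions H {val x 0 0}"
  unfolding solutions_def by auto

section \<open>Tails, exit times and limits of flows\<close>

text \<open>The tail from hybrid time \<open>(s, k)\<close> on, with clock and jump counter reset.
  The guard \<open>0 \<le> t\<close> cuts off the part of section \<open>k\<close> before
  \<open>s\<close>, which would otherwise give the tail negative times.\<close>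

definition shift_arc :: "real \<Rightarrow> nat \<Rightarrow> 'a arc \<Rightarrow> 'a arc" where
  "shift_arc s k x = (\<lambda>(t, j). if 0 \<le> t then x (t + s, j + k) else None)"

lemma dom_shift_arc: "(t, j) \<in> dom (shift_arc s k x) \<longleftrightarrow> 0 \<le> t \<and> (t + s, j + k) \<in> dom x"
  by (auto simp: shift_arc_def dom_def)

lemma val_shift_arc: "0 \<le> t \<Longrightarrow> val (shift_arc s k x) t j = val x (t + s) (j + k)"
  by (simp add: shift_arc_def)

lemma sol_shift_arc:
  assumes x: "sol H x" and sk: "(s, k) \<in> dom x"
  shows "sol H (shift_arc s k x)"
proof -
  note E = solD(1)[OF x]
  have "hybrid_dom (dom (shift_arc s k x))"
    unfolding hybrid_dom_def dom_shift_arc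
  proof (intro conjI allI impI)
    fix j a b t
    assume "0 \<le> a \<and> (a + s, j + k) \<in> dom x" "0 \<le> b \<and> (b + s, j + k) \<in> dom x" "a \<le> t" "t \<le> b"
    then show "0 \<le> t" "(t + s, j + k) \<in> dom x" using hybrid_dom_convex[OF E, of "a + s" "j + k" "b + s" "t + s"] by auto
  next
    fix t j assume t: "0 \<le> t \<and> (t + s, Suc j + k) \<in> dom x"
    let ?T = "jump_time (dom x) (Suc (j + k))"
    have t': "(t + s, Suc (j + k)) \<in> dom x" using t by simp
    note J = jump_time_Suc[OF E t']
    have "s \<le> ?T" using hybrid_dom_mono[OF E sk J(2)] by simp
    then show "\<exists>T. (0 \<le> T \<and> (T + s, j + k) \<in> dom x) \<and> (0 \<le> T \<and> (T + s, Suc j + k) \<in> dom x) \<and>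
        (\<forall>sa. 0 \<le> sa \<and> (sa + s, j + k) \<in> dom x \<longrightarrow> sa \<le> T) \<and> (\<forall>sa. 0 \<le> sa \<and> (sa + s, Suc j + k) \<in> dom x \<longrightarrow> T \<le> sa)"
      using J(1,2) J(3)[of "_ + s"] J(4)[of "_ + s"] by (intro exI[of _ "?T - s"]) (force simp: diff_le_eq le_diff_eq)
  qed (use sk in auto)
  moreover have "flow_segment H (\<lambda>t. val (shift_arc s k x) t j) a b"
    if ab: "a < b" "(a, j) \<in> dom (shift_arc s k x)" "(b, j) \<in> dom (shift_arc s k x)" for j a b
  proof (rule flow_segment_cong)
    show "flow_segment H (\<lambda>t. val x (t + s) (j + k)) a b"
      using ab solD(2)[OF x, of "a + s" "b + s" "j + k"] unfolding dom_shift_arc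
      by (intro flow_segment_translation) auto
    show "val x (t + s) (j + k) = val (shift_arc s k x) t j" if "t \<in> {a..b}" for t
      using that ab(2) by (subst val_shift_arc) (auto simp: dom_shift_arc)
  qed
  moreover have "val (shift_arc s k x) t j \<in> jump_set H \<and>
      val (shift_arc s k x) t (Suc j) \<in> jump_map H (val (shift_arc s k x) t j)"
    if "(t, j) \<in> dom (shift_arc s k x)" "(t, Suc j) \<in> dom (shift_arc s k x)" for t j
    using that solD(3,4)[OF x, of "t + s" "j + k"] unfolding dom_shift_arc by (auto simp: val_shift_arc)
  ultimately show ?thesis unfolding sol_def by blast
qed

text \<open>Two points of one hybrid time domain are always comparable in the product order, so the
  single number \<open>t + j\<close> decides which comes first. Hence first and last times can be
  found as extrema of a real function.\<close>

lemma hybrid_dom_order: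
  assumes "hybrid_dom E" "(s, k) \<in> E" "(t, j) \<in> E" "s + real k \<le> t + real j"
  shows "s \<le> t" "k \<le> j"
proof -
  have "s \<le> t \<and> k \<le> j"
  proof (cases "k \<le> j")
    case True
    then show ?thesis using hybrid_dom_mono[OF assms(1,2,3)] assms(4) by (cases "k = j") auto
  next
    case False
    then show ?thesis using hybrid_dom_mono[OF assms(1,3,2)] assms(4) by auto
  qed
  then show "s \<le> t" "k \<le> j" by auto
qed

text \<open>Jump times of the part of the domain up to \<open>(T, J)\<close>. Setting the later ones
  to \<open>T\<close> closes the last section there and makes all further levels collapse to a
  point, so that these times form one sequence over all \<open>j\<close>, whatever \<open>J\<close>
  is.\<close>

definition truncation_time :: "(real \<times> nat) set \<Rightarrow> real \<Rightarrow> nat \<Rightarrow> nat \<Rightarrow> real" where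
  "truncation_time E T J j = (if j \<le> J then jump_time E j else T)"

lemma truncation_time:
  assumes E: "hybrid_dom E" and TJ: "(T, J) \<in> E"
  shows "truncation_time E T J 0 = 0"
    "truncation_time E T J j \<le> truncation_time E T J (Suc j)"
    "j \<le> J \<Longrightarrow> (s, j) \<in> E \<and> s \<le> T \<longleftrightarrow> truncation_time E T J j \<le> s \<and> s \<le> truncation_time E T J (Suc j)"
proof -
  let ?\<tau> = "truncation_time E T J"
  show "?\<tau> 0 = 0" using jump_time_0[OF E] by (simp add: truncation_time_def)
  have main: "?\<tau> j \<le> ?\<tau> (Suc j) \<and> (\<forall>s. (s, j) \<in> E \<and> s \<le> T \<longleftrightarrow> ?\<tau> j \<le> s \<and> s \<le> ?\<tau> (Suc j))" if j: "j \<le> J"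
  proof (cases "j = J")
    case True
    note L = jump_time_least[OF E TJ]
    show ?thesis using L jump_time_least(2)[OF E, of _ J] hybrid_dom_convex[OF E L(1) TJ] True
      by (auto simp: truncation_time_def)
  next
    case False
    then have "j < J" using j by simp
    from hybrid_dom_downward[OF E TJ this]
    have D: "(jump_time E (Suc j), j) \<in> E" "(jump_time E (Suc j), Suc j) \<in> E" "jump_time E (Suc j) \<le> T" by auto
    note L = jump_time_least[OF E D(1)]
    have "(s, j) \<in> E \<and> s \<le> T \<longleftrightarrow> jump_time E j \<le> s \<and> s \<le> jump_time E (Suc j)" for s
      using jump_time_least(2)[OF E, of s j] jump_time_Suc(3)[OF E D(2), of s] hybrid_dom_convex[OF E L(1) D(1), of s] D(3)
      by (meson order_trans)
    then show ?thesis using \<open>j < J\<close> L(2) by (simp add: truncation_time_def)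
  qed
  show "?\<tau> j \<le> ?\<tau> (Suc j)"
    using main by (cases "j \<le> J") (auto simp: truncation_time_def)
  show "j \<le> J \<Longrightarrow> (s, j) \<in> E \<and> s \<le> T \<longleftrightarrow> ?\<tau> j \<le> s \<and> s \<le> ?\<tau> (Suc j)" using main by blast
qed

text \<open>The truncated domain is a finite union of compact sections. Levels are discrete, so each
  section is relatively open and continuity has to be checked along one section only.\<close>

lemma sol_truncation:
  assumes x: "sol H x" and TJ: "(T, J) \<in> dom x"
  defines "E \<equiv> {p \<in> dom x. fst p \<le> T \<and> snd p \<le> J}"
  shows "compact E" "continuous_on E (\<lambda>p. the (x p))"
proof -
  let ?\<tau> = "truncation_time (dom x) T J"
  note \<tau> = truncation_time[OF solD(1)[OF x] TJ]
  have sec: "p \<in> E \<longleftrightarrow> snd p \<le> J \<and> fst p \<in> {?\<tau> (snd p)..?\<tau> (Suc (snd p))}" for p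
    using \<tau>(3)[of "snd p" "fst p"] by (cases p) (auto simp: E_def)
  have "E = (\<Union>j\<le>J. {?\<tau> j..?\<tau> (Suc j)} \<times> {j})"
    by (intro set_eqI) (unfold sec, auto simp: mem_Times_iff)
  then show "compact E" by (simp add: compact_UN compact_Times)
  show "continuous_on E (\<lambda>p. the (x p))"
    unfolding continuous_on_eq_continuous_within
  proof
    fix p assume p: "p \<in> E"
    define j where "j = snd p"
    let ?I = "{?\<tau> j..?\<tau> (Suc j)}"
    have "continuous_on ?I (\<lambda>t. val x t j)"
    proof (cases "?\<tau> j < ?\<tau> (Suc j)")
      case True
      have "(?\<tau> j, j) \<in> dom x" "(?\<tau> (Suc j), j) \<in> dom x"
        using p \<tau>(2)[of j] \<tau>(3)[of j "?\<tau> j"] \<tau>(3)[of j "?\<tau> (Suc j)"] sec[of p] by (auto simp: j_def)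
      from solD(2)[OF x True this] show ?thesis by (rule flow_segment_continuous)
    next
      case False
      then have "?I \<subseteq> {?\<tau> j}" by auto
      then show ?thesis by (meson continuous_on_sing continuous_on_subset)
    qed
    then have "continuous_on (?I \<times> {j}) (\<lambda>p. val x (fst p) j)"
      by (rule continuous_on_compose2) (auto intro!: continuous_intros)
    then have "continuous_on (?I \<times> {j}) (\<lambda>p. the (x p))"
      by (rule continuous_on_eq) auto
    moreover have pI: "p \<in> ?I \<times> {j}" using p sec[of p] by (cases p) (auto simp: j_def)
    ultimately have "continuous (at p within ?I \<times> {j}) (\<lambda>p. the (x p))"
      unfolding continuous_on_eq_continuous_within by blast
    moreover have "at p within E = at p within ?I \<times> {j}"
    proof (rule at_within_nhd)
      show "p \<in> UNIV \<times> {j}" using pI by auto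
      show "open (UNIV \<times> {j} :: (real \<times> nat) set)" by (intro open_Times) (auto simp: open_discrete)
      show "E \<inter> UNIV \<times> {j} - {p} = ?I \<times> {j} \<inter> UNIV \<times> {j} - {p}"
        using sec p by (auto simp: j_def)
    qed
    ultimately show "continuous (at p within E) (\<lambda>p. the (x p))" by simp
  qed
qed

lemma hybrid_time_continuous: "continuous_on E (\<lambda>p::real \<times> nat. fst p + real (snd p))"
  by (intro continuous_intros)

text \<open>Up to \<open>(t0, j0)\<close> the points of the domain with value outside
  \<open>U\<close> form a compact set, on which \<open>t + j\<close> attains its minimum. The exit
  point itself lies outside \<open>U\<close> because \<open>U\<close> is open.\<close>

lemma first_exit:
  assumes x: "sol H x" and U: "open U" and p: "(t0, j0) \<in> dom x" "val x t0 j0 \<notin> U"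
  obtains T J where "(T, J) \<in> dom x" "val x T J \<notin> U"
    "\<And>s k. (s, k) \<in> dom x \<Longrightarrow> s + real k < T + real J \<Longrightarrow> val x s k \<in> U"
proof -
  note E = solD(1)[OF x]
  let ?E = "{p \<in> dom x. fst p \<le> t0 \<and> snd p \<le> j0}"
  note tr = sol_truncation[OF x p(1)]
  let ?B = "?E \<inter> (\<lambda>p. the (x p)) -` (- U)"
  have "closed ?B" 
    by (rule continuous_closed_preimage[OF tr(2) compact_imp_closed[OF tr(1)]]) (use U in auto)
  then have "compact (?E \<inter> ?B)" by (intro compact_Int_closed tr(1))
  then have "compact ?B" by (simp add: Int_absorb1)
  moreover have "(t0, j0) \<in> ?B" using p by auto
  ultimately obtain q where q: "q \<in> ?B" "\<And>r. r \<in> ?B \<Longrightarrow> fst q + real (snd q) \<le> fst r + real (snd r)"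
    using continuous_attains_inf[OF _ _ hybrid_time_continuous, of ?B] by blast
  obtain T J where TJ: "q = (T, J)" by (cases q)
  show ?thesis
  proof (rule that[of T J])
    show "(T, J) \<in> dom x" "val x T J \<notin> U" using q(1) TJ by auto
    show "val x s k \<in> U" if sk: "(s, k) \<in> dom x" "s + real k < T + real J" for s k
    proof (rule ccontr)
      assume "val x s k \<notin> U"
      have "T \<le> t0" "J \<le> j0" using q(1) TJ by auto
      then have "s + real k \<le> t0 + real j0" using sk(2) by linarith
      from hybrid_dom_order[OF E sk(1) p(1) this] have "(s, k) \<in> ?B" using sk \<open>val x s k \<notin> U\<close> by auto
      from q(2)[OF this] show False using sk(2) TJ by simp
    qed
  qed
qed

text \<open>Dually, the points up to \<open>(T, J)\<close> with value in \<open>A\<close> form a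
  compact set containing the initial one, and \<open>t + j\<close> attains its maximum
  there.\<close>

lemma last_entry:
  assumes x: "sol H x" and A: "closed A" and TJ: "(T, J) \<in> dom x" and z: "val x 0 0 \<in> A"
  obtains s k where "(s, k) \<in> dom x" "s \<le> T" "k \<le> J" "val x s k \<in> A"
    "\<And>t j. (t, j) \<in> dom x \<Longrightarrow> s + real k < t + real j \<Longrightarrow> t + real j \<le> T + real J \<Longrightarrow> val x t j \<notin> A"
proof -
  note E = solD(1)[OF x]
  let ?E = "{p \<in> dom x. fst p \<le> T \<and> snd p \<le> J}"
  note tr = sol_truncation[OF x TJ]
  let ?B = "?E \<inter> (\<lambda>p. the (x p)) -` A"
  have "closed ?B" by (rule continuous_closed_preimage[OF tr(2) compact_imp_closed[OF tr(1)] A])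
  then have "compact (?E \<inter> ?B)" by (intro compact_Int_closed tr(1))
  then have "compact ?B" by (simp add: Int_absorb1)
  moreover have "(0, 0) \<in> ?B" using z hybrid_dom_zero[OF E] hybrid_dom_nonneg[OF E TJ] by auto
  ultimately obtain q where q: "q \<in> ?B" "\<And>r. r \<in> ?B \<Longrightarrow> fst r + real (snd r) \<le> fst q + real (snd q)"
    using continuous_attains_sup[OF _ _ hybrid_time_continuous, of ?B] by blast
  obtain s k where sk: "q = (s, k)" by (cases q)
  show ?thesis
  proof (rule that[of s k])
    show "(s, k) \<in> dom x" "s \<le> T" "k \<le> J" "val x s k \<in> A" using q(1) sk by auto
    show "val x t j \<notin> A" if tj: "(t, j) \<in> dom x" "s + real k < t + real j" "t + real j \<le> T + real J" for t j
    proof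
      assume "val x t j \<in> A"
      with hybrid_dom_order[OF E tj(1) TJ tj(3)] have "(t, j) \<in> ?B" using tj(1) by auto
      from q(2)[OF this] show False using tj(2) sk by simp
    qed
  qed
qed

section \<open>Velocities of limits of flows\<close>

lemma outer_semicontinuous_eventually:
  assumes "outer_semicontinuous M" "u \<longlonglongrightarrow> x" "v \<longlonglongrightarrow> y" "\<forall>\<^sub>F i in sequentially. v i \<in> M (u i)"
  shows "y \<in> M x"
proof -
  obtain n where n: "\<And>i. i \<ge> n \<Longrightarrow> v i \<in> M (u i)" using assms(4) unfolding eventually_sequentially by blast
  have "(\<lambda>i. u (i + n)) \<longlonglongrightarrow> x" "(\<lambda>i. v (i + n)) \<longlonglongrightarrow> y" using assms(2,3) by (auto intro: LIMSEQ_ignore_initial_segment)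
  moreover have "\<forall>i. v (i + n) \<in> M (u (i + n))" using n by simp
  ultimately show ?thesis
    using assms(1)[unfolded outer_semicontinuous_def, rule_format, of "\<lambda>i. u (i + n)" x "\<lambda>i. v (i + n)" y] by blast
qed

text \<open>Velocities violating the inequality at points tending to \<open>p\<close> would be
  bounded, hence accumulate at an element of \<open>M p\<close> that violates it as well.\<close>

lemma outer_semicontinuous_halfspace:
  fixes M :: "'a::euclidean_space \<Rightarrow> 'b::euclidean_space set"
  assumes osc: "outer_semicontinuous M" and bdd: "\<And>z v. z \<in> S \<Longrightarrow> dist z p \<le> 1 \<Longrightarrow> v \<in> M z \<Longrightarrow> norm v \<le> B"
    and half: "\<And>v. v \<in> M p \<Longrightarrow> c < w \<bullet> v"
  shows "\<exists>d>0. \<forall>z\<in>S. dist z p < d \<longrightarrow> (\<forall>v\<in>M z. c < w \<bullet> v)"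
proof (rule ccontr)
  assume "\<not> ?thesis"
  then have "\<exists>z v. z \<in> S \<and> dist z p < 1 / real (Suc n) \<and> v \<in> M z \<and> w \<bullet> v \<le> c" for n
    by (meson not_less of_nat_0_less_iff zero_less_Suc zero_less_divide_1_iff)
  then obtain z v where zv: "\<And>n. z n \<in> S" "\<And>n. dist (z n) p < 1 / real (Suc n)" "\<And>n. v n \<in> M (z n)" "\<And>n. w \<bullet> v n \<le> c"
    by metis
  have "norm (v n) \<le> B" for n
  proof (rule bdd[OF zv(1) _ zv(3)])
    have "1 / real (Suc n) \<le> 1" by simp
    then show "dist (z n) p \<le> 1" using zv(2)[of n] by linarith
  qed
  then have "\<forall>n. v n \<in> cball 0 B" by simp
  then obtain l r where l: "strict_mono r" "(v \<circ> r) \<longlonglongrightarrow> l"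
    using compact_cball[of 0 B] unfolding compact_def by blast
  have "z \<longlonglongrightarrow> p"
  proof (rule metric_LIMSEQ_I)
    fix e :: real assume "e > 0"
    then obtain n where n: "1 / real (Suc n) < e" using nat_approx_posE by blast
    have "dist (z m) p < e" if "m \<ge> n" for m
    proof -
      have "1 / real (Suc m) \<le> 1 / real (Suc n)" using that by (intro divide_left_mono) auto
      then show ?thesis using zv(2)[of m] n by linarith
    qed
    then show "\<exists>no. \<forall>n\<ge>no. dist (z n) p < e" by blast
  qed
  then have "(z \<circ> r) \<longlonglongrightarrow> p" using l(1) by (rule LIMSEQ_subseq_LIMSEQ)
  then have "l \<in> M p" using l(2) zv(3) by (intro outer_semicontinuous_eventually[OF osc]) auto
  moreover have "w \<bullet> l \<le> c"
    by (rule tendsto_upperbound[OF tendsto_inner[OF tendsto_const l(2)]]) (use zv(4) in auto)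
  ultimately show False using half by force
qed

text \<open>If the limit velocity \<^term>\<open>v\<close> were outside the closed convex set of admissible velocities, a
  hyperplane would separate them; by semicontinuity the nearby velocities of the approximating
  flows lie on the far side as well, hence so do all short increments, and with them \<^term>\<open>v\<close>.\<close>

lemma flow_limit_derivative:
  fixes f :: "nat \<Rightarrow> real \<Rightarrow> 'a::euclidean_space"
  assumes H: "basic_assumptions H"
    and flow: "\<forall>\<^sub>F i in sequentially. flow_segment H (f i) a b"
    and lip: "\<And>i s t. dist (f i s) (f i t) \<le> L * \<bar>s - t\<bar>" and L: "0 \<le> L"
    and lim: "\<And>s. (\<lambda>i. f i s) \<longlonglongrightarrow> g s"
    and t: "t \<in> {a<..<b}" and der: "(g has_vector_derivative v) (at t)"
  shows "v \<in> flow_map H (g t)"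
proof -
  have osc: "outer_semicontinuous (flow_map H)" and clC: "closed (flow_set H)"
    using H by (auto simp: basic_assumptions_def)
  have "\<forall>\<^sub>F i in sequentially. f i t \<in> flow_set H"
    using flow by eventually_elim (use t in \<open>auto simp: flow_segment_def\<close>)
  then have gC: "g t \<in> flow_set H"
    using closed_sequentially Lim_in_closed_set[OF clC _ _ lim] by simp
  show "v \<in> flow_map H (g t)"
  proof (rule ccontr)
    assume "v \<notin> flow_map H (g t)"
    \<comment> \<open>Outer semicontinuity along a constant sequence says that the value is
      closed.\<close>
    moreover have "closed (flow_map H (g t))"
      unfolding closed_sequential_limits
      using outer_semicontinuous_eventually[OF osc tendsto_const] by (metis always_eventually)
    moreover have "convex (flow_map H (g t))" using H gC by (auto simp: basic_assumptions_def)
    ultimately obtain w c where w: "w \<bullet> v < c" "\<And>u. u \<in> flow_map H (g t) \<Longrightarrow> c < w \<bullet> u"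
      using separating_hyperplane_closed_point by metis
    obtain B where "\<And>z u. z \<in> cball (g t) 1 \<inter> flow_set H \<Longrightarrow> u \<in> flow_map H z \<Longrightarrow> norm u \<le> B"
      using flow_map_bounded_on_compact[OF H compact_cball] by metis
    then obtain d where d: "d > 0" "\<And>z u. z \<in> flow_set H \<Longrightarrow> dist z (g t) < d \<Longrightarrow> u \<in> flow_map H z \<Longrightarrow> c < w \<bullet> u"
      using outer_semicontinuous_halfspace[OF osc, of "flow_set H" "g t" B c w] w(2)
      by (metis Int_iff dist_commute mem_cball)
    \<comment> \<open>The distance \<open>d\<close> is shared equally: half of it for the drift of
      \<open>f i\<close> during time \<open>h0\<close>, half for the distance between
      \<open>f i t\<close> and \<open>g t\<close>. The factor \<open>L + 1\<close> also covers
      \<open>L = 0\<close>.\<close>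
    define h0 where "h0 = min (b - t) (d / (2 * (L + 1)))"
    have h0: "h0 > 0" using t d(1) L by (simp add: h0_def)
    have "L * h0 \<le> L * (d / (2 * (L + 1)))" using L by (intro mult_left_mono) (auto simp: h0_def)
    also have "\<dots> < d / 2" using L d(1) by (simp add: field_simps)
    finally have Lh0: "L * h0 < d / 2" .
    have incr: "c * h \<le> w \<bullet> (g (t + h) - g t)" if h: "0 < h" "h < h0" for h
    proof -
      have "\<forall>\<^sub>F i in sequentially. dist (f i t) (g t) < d / 2"
        using lim[of t] d(1) by (intro tendstoD) auto
      with flow have "\<forall>\<^sub>F i in sequentially. c * h \<le> w \<bullet> (f i (t + h) - f i t)"
      proof eventually_elim
        case (elim i)
        have tb: "a \<le> t" "t + h \<le> b" using t h by (auto simp: h0_def)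
        have seg: "flow_segment H (f i) t (t + h)" using flow_segment_subset[OF elim(1) tb] .
        then obtain M N where M: "M-lipschitz_on {t..t + h} (f i)" and N: "negligible N"
          "\<And>r. r \<in> {t<..<t + h} - N \<Longrightarrow> \<exists>v\<in>flow_map H (f i r). (f i has_vector_derivative v) (at r)"
          "\<And>r. r \<in> {t..<t + h} \<Longrightarrow> f i r \<in> flow_set H" unfolding flow_segment_def by blast
        have "AE r in lebesgue. r \<in> {t<..<t + h} \<longrightarrow> (\<exists>v. c \<le> w \<bullet> v \<and> (f i has_vector_derivative v) (at r))"
        proof (rule AE_I'[of N])
          show "N \<in> null_sets lebesgue" using N(1) by (simp add: negligible_iff_null_sets)
          have "\<exists>v. c \<le> w \<bullet> v \<and> (f i has_vector_derivative v) (at r)" if r: "r \<in> {t<..<t + h}" "r \<notin> N" for r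
          proof -
            obtain v where v: "v \<in> flow_map H (f i r)" "(f i has_vector_derivative v) (at r)" using N(2)[of r] r by blast
            have "dist (f i r) (f i t) \<le> L * \<bar>r - t\<bar>" by (rule lip)
            also have "\<dots> \<le> L * h0" using r h L by (intro mult_left_mono) auto
            finally have "dist (f i r) (g t) < d"
              using elim(2) Lh0 dist_triangle[of "f i r" "g t" "f i t"] by linarith
            moreover have "f i r \<in> flow_set H" using N(3)[of r] r by auto
            ultimately show ?thesis using d(2) v by (meson less_imp_le)
          qed
          then show "{r \<in> space lebesgue. \<not> (r \<in> {t<..<t + h} \<longrightarrow> (\<exists>v. c \<le> w \<bullet> v \<and> (f i has_vector_derivative v) (at r)))} \<subseteq> N"
            by blast
        qed
        from abs_continuous_increment_ge[OF lipschitz_imp_abs_continuous_on[OF M] _ this] h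
        show ?case by simp
      qed
      then show ?thesis by (rule tendsto_lowerbound[rotated]) (auto intro!: tendsto_intros lim)
    qed
    have "((\<lambda>s. w \<bullet> g s) has_vector_derivative (w \<bullet> v)) (at t)"
      using bounded_linear.has_vector_derivative[OF bounded_linear_inner_right der] .
    then have "((\<lambda>s. w \<bullet> g s) has_field_derivative (w \<bullet> v)) (at t)"
      by (simp add: has_real_derivative_iff_has_vector_derivative)
    then have "((\<lambda>h. (w \<bullet> g (t + h) - w \<bullet> g t) / h) \<longlongrightarrow> w \<bullet> v) (at_right 0)"
      unfolding DERIV_def by (rule filterlim_mono) (auto simp: at_le)
    moreover have "\<forall>\<^sub>F h in at_right 0. c \<le> (w \<bullet> g (t + h) - w \<bullet> g t) / h"
      unfolding eventually_at_right_field
      using h0 incr by (intro exI[of _ h0]) (auto simp: inner_diff_right pos_le_divide_eq)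
    ultimately have "c \<le> w \<bullet> v" by (rule tendsto_lowerbound) simp
    then show False using w(1) by simp
  qed
qed


section \<open>Completeness and extraction of convergent subsequences\<close>

lemma complete_arc_iff:
  assumes "hybrid_dom (dom x)"
  shows "complete_arc x \<longleftrightarrow> (\<forall>n. \<exists>t j. (t, j) \<in> dom x \<and> n \<le> t + real j)"
proof
  assume c: "complete_arc x"
  show "\<forall>n. \<exists>t j. (t, j) \<in> dom x \<and> n \<le> t + real j"
  proof (rule ccontr)
    assume "\<not> ?thesis"
    then obtain n where n: "\<And>t j. (t, j) \<in> dom x \<Longrightarrow> t + real j < n" by (meson not_le)
    have "norm (t, real j) \<le> n" if "(t, j) \<in> dom x" for t j
    proof -
      have "norm (t, real j) \<le> norm t + norm (real j)" by (rule norm_Pair_le)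
      then show ?thesis using n[OF that] hybrid_dom_nonneg[OF assms that] by simp
    qed
    then have "bounded ((\<lambda>(t, j). (t, real j)) ` dom x)"
      unfolding bounded_iff by (intro exI[of _ n]) force
    then show False using c unfolding complete_arc_def by blast
  qed
next
  assume u: "\<forall>n. \<exists>t j. (t, j) \<in> dom x \<and> n \<le> t + real j"
  show "complete_arc x"
    unfolding complete_arc_def
  proof
    assume "bounded ((\<lambda>(t, j). (t, real j)) ` dom x)"
    then obtain B where B: "\<And>p. p \<in> (\<lambda>(t, j). (t, real j)) ` dom x \<Longrightarrow> norm p \<le> B" unfolding bounded_iff by blast
    \<comment> \<open>Each coordinate is at most the norm, so \<open>t + j\<close> is at most
      \<open>2 * B\<close> on a domain bounded by \<open>B\<close>.\<close>
    obtain t j where tj: "(t, j) \<in> dom x" "2 * B + 1 \<le> t + real j" using u by blast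
    have "norm (t, real j) \<le> B" using tj(1) by (intro B) (auto intro: rev_image_eqI)
    then show False using tj(2) norm_fst_le[of t "real j"] norm_snd_le[of "real j" t] by simp
  qed
qed

lemma equilipschitz_tendsto:
  fixes f :: "nat \<Rightarrow> real \<Rightarrow> 'a::metric_space"
  assumes lip: "\<And>i s t. dist (f i s) (f i t) \<le> L * \<bar>s - t\<bar>"
    and lim: "(\<lambda>i. f i t) \<longlonglongrightarrow> l" and u: "u \<longlonglongrightarrow> t"
  shows "(\<lambda>i. f i (u i)) \<longlonglongrightarrow> l"
proof -
  have "(\<lambda>i. L * \<bar>u i - t\<bar> + dist (f i t) l) \<longlonglongrightarrow> L * \<bar>t - t\<bar> + dist l l"
    by (intro tendsto_intros lim u)
  then have *: "(\<lambda>i. L * \<bar>u i - t\<bar> + dist (f i t) l) \<longlonglongrightarrow> 0" by simp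
  have "(\<lambda>i. dist (f i (u i)) l) \<longlonglongrightarrow> 0"
  proof (rule tendsto_sandwich[OF _ _ tendsto_const *])
    have "dist (f i (u i)) l \<le> L * \<bar>u i - t\<bar> + dist (f i t) l" for i
      using lip[of i "u i" t] dist_triangle[of "f i (u i)" l "f i t"] by linarith
    then show "\<forall>\<^sub>F i in sequentially. dist (f i (u i)) l \<le> L * \<bar>u i - t\<bar> + dist (f i t) l" by simp
  qed simp
  then show ?thesis by (subst tendsto_dist_iff)
qed

lemma equilipschitz_convergent:
  fixes f :: "nat \<Rightarrow> real \<Rightarrow> 'a::complete_space"
  assumes lip: "\<And>i s t. dist (f i s) (f i t) \<le> L * \<bar>s - t\<bar>" and L: "0 \<le> L"
    and lim: "\<And>q. q \<in> \<rat> \<Longrightarrow> convergent (\<lambda>i. f i q)"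
  shows "convergent (\<lambda>i. f i t)"
proof -
  have "Cauchy (\<lambda>i. f i t)"
  proof (rule metric_CauchyI)
    fix e :: real assume "e > 0"
    \<comment> \<open>The tolerance is split into thirds: two for moving between \<open>t\<close>
      and the rational \<open>q\<close>, one for convergence at \<open>q\<close>.\<close>
    define d where "d = e / (3 * (L + 1))"
    have d: "d > 0" using \<open>e > 0\<close> L by (simp add: d_def)
    obtain q where q: "q \<in> \<rat>" "t < q" "q < t + d" using Rats_dense_in_real[of t "t + d"] d by auto
    have "L * \<bar>t - q\<bar> \<le> L * d" using q L by (intro mult_left_mono) auto
    also have "\<dots> < e / 3" using L \<open>e > 0\<close> by (simp add: d_def field_simps)
    finally have Ld: "L * \<bar>t - q\<bar> < e / 3" .
    have "Cauchy (\<lambda>i. f i q)" using lim[OF q(1)] by (rule convergent_Cauchy)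
    moreover have "e / 3 > 0" using \<open>e > 0\<close> by simp
    ultimately obtain N where N: "\<And>m n. m \<ge> N \<Longrightarrow> n \<ge> N \<Longrightarrow> dist (f m q) (f n q) < e / 3"
      using metric_CauchyD by blast
    have "dist (f m t) (f n t) < e" if "m \<ge> N" "n \<ge> N" for m n
    proof -
      have "dist (f m t) (f n t) \<le> dist (f m t) (f m q) + dist (f m q) (f n q) + dist (f n q) (f n t)"
        using dist_triangle[of "f m t" "f n t" "f m q"] dist_triangle[of "f m q" "f n t" "f n q"] by linarith
      also have "\<dots> < e / 3 + e / 3 + e / 3"
        using N[OF that] lip[of m t q] lip[of n t q] Ld by (simp add: dist_commute)
      finally show ?thesis by simp
    qed
    then show "\<exists>M. \<forall>m\<ge>M. \<forall>n\<ge>M. dist (f m t) (f n t) < e" by blast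
  qed
  then show ?thesis by (rule Cauchy_convergent)
qed

text \<open>Arzela-Ascoli for countably many sequences at once. The diagonal subsequence handles all
  pairs of a level and a rational time, and equicontinuity extends convergence to all times. Jump
  times and final levels are read as extended reals, where every sequence has a convergent
  subsequence.\<close>

lemma diagonal_extraction:
  fixes g :: "nat \<Rightarrow> nat \<Rightarrow> real \<Rightarrow> 'a::euclidean_space"
    and \<tau> :: "nat \<Rightarrow> nat \<Rightarrow> ereal" and J :: "nat \<Rightarrow> nat"
  assumes K: "compact K" "\<And>i j t. g i j t \<in> K"
    and lip: "\<And>i j s t. dist (g i j s) (g i j t) \<le> L * \<bar>s - t\<bar>" and L: "0 \<le> L"
  obtains \<phi> h \<sigma> l where "strict_mono (\<phi> :: nat \<Rightarrow> nat)" "\<And>j t. (\<lambda>i. g (\<phi> i) j t) \<longlonglongrightarrow> h j t"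
    "\<And>j. (\<lambda>i. \<tau> (\<phi> i) j) \<longlonglongrightarrow> \<sigma> j" "(\<lambda>i. ereal (real (J (\<phi> i)))) \<longlonglongrightarrow> l"
proof -
  define q :: "nat \<Rightarrow> real" where "q m = real_of_rat (nat_to_rat_surj m)" for m
  \<comment> \<open>A code \<open>n\<close> stands for a level and a rational time; bundling three
    sequences into a triple leaves a single convergence condition per code.\<close>
  define X where "X n s = (case prod_decode n of (j, m) \<Rightarrow>
      (\<lambda>i. (g (s i) j (q m), \<tau> (s i) j, ereal (real (J (s i))))))" for n and s :: "nat \<Rightarrow> nat"
  have Xo: "X n (s \<circ> r) = X n s \<circ> r" for n s r by (auto simp: X_def o_def split: prod.splits)
  interpret subseqs "\<lambda>n s. convergent (X n s)"
  proof
    fix n and s :: "nat \<Rightarrow> nat" assume "strict_mono s"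
    obtain j m where jm: "prod_decode n = (j, m)" by (cases "prod_decode n")
    obtain a r1 where r1: "strict_mono r1" "(\<lambda>i. g (s (r1 i)) j (q m)) \<longlonglongrightarrow> a"
    proof -
      obtain a r1 where "strict_mono r1" "((\<lambda>i. g (s i) j (q m)) \<circ> r1) \<longlonglongrightarrow> a"
        using K(1)[unfolded compact_def, rule_format, of "\<lambda>i. g (s i) j (q m)"] K(2) by blast
      then show ?thesis by (intro that[of r1 a]) (auto simp: o_def)
    qed
    obtain b r2 where r2: "strict_mono r2" "(\<lambda>i. \<tau> (s (r1 (r2 i))) j) \<longlonglongrightarrow> b"
      using compact_complete_linorder[of "\<lambda>i. \<tau> (s (r1 i)) j"] unfolding o_def by blast
    obtain c r3 where r3: "strict_mono r3" "(\<lambda>i. ereal (real (J (s (r1 (r2 (r3 i))))))) \<longlonglongrightarrow> c"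
      using compact_complete_linorder[of "\<lambda>i. ereal (real (J (s (r1 (r2 i)))))"] unfolding o_def by blast
    let ?r = "\<lambda>i. r1 (r2 (r3 i))"
    have "(\<lambda>i. g (s (?r i)) j (q m)) \<longlonglongrightarrow> a"
      using LIMSEQ_subseq_LIMSEQ[OF LIMSEQ_subseq_LIMSEQ[OF r1(2) r2(1)] r3(1)] by (simp add: o_def)
    moreover have "(\<lambda>i. \<tau> (s (?r i)) j) \<longlonglongrightarrow> b"
      using LIMSEQ_subseq_LIMSEQ[OF r2(2) r3(1)] by (simp add: o_def)
    ultimately have "X n (s \<circ> ?r) \<longlonglongrightarrow> (a, b, c)"
      using r3(2) unfolding X_def jm by (auto intro!: tendsto_Pair)
    moreover have "strict_mono ?r" using r1(1) r2(1) r3(1) by (auto simp: strict_mono_def)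
    ultimately show "\<exists>r. strict_mono r \<and> convergent (X n (s \<circ> r))" unfolding convergent_def by blast
  qed
  let ?\<phi> = "diagseq"
  have conv: "convergent (X n ?\<phi>)" for n
  proof -
    \<comment> \<open>The diagonal sequence is a subsequence of the \<open>n\<close>-th one only
      after its first terms, so convergence is first obtained for a tail.\<close>
    have "convergent (X n (?\<phi> \<circ> ((+) (Suc n))))"
    proof (rule diagseq_holds)
      show "convergent (X n (s \<circ> r))" if "strict_mono r" "convergent (X n s)" for r s n
        unfolding Xo using convergent_subseq_convergent[OF that(2,1)] .
    qed
    then obtain l where "(X n ?\<phi> \<circ> ((+) (Suc n))) \<longlonglongrightarrow> l" unfolding convergent_def Xo by blast
    then have "(\<lambda>i. X n ?\<phi> (i + Suc n)) \<longlonglongrightarrow> l" by (simp add: o_def add.commute)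
    then have "X n ?\<phi> \<longlonglongrightarrow> l" by (rule LIMSEQ_offset)
    then show ?thesis unfolding convergent_def by blast
  qed
  have conv3: "\<exists>a b c. (\<lambda>i. g (?\<phi> i) j (q m)) \<longlonglongrightarrow> a \<and> (\<lambda>i. \<tau> (?\<phi> i) j) \<longlonglongrightarrow> b \<and> (\<lambda>i. ereal (real (J (?\<phi> i)))) \<longlonglongrightarrow> c" for j m
  proof -
    obtain p where p: "X (prod_encode (j, m)) ?\<phi> \<longlonglongrightarrow> p" using conv unfolding convergent_def by blast
    have "X (prod_encode (j, m)) ?\<phi> = (\<lambda>i. (g (?\<phi> i) j (q m), \<tau> (?\<phi> i) j, ereal (real (J (?\<phi> i)))))"
      by (simp add: X_def)
    then show ?thesis using tendsto_fst[OF p] tendsto_fst[OF tendsto_snd[OF p]] tendsto_snd[OF tendsto_snd[OF p]] by auto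
  qed
  have "convergent (\<lambda>i. g (?\<phi> i) j t)" for j t
  proof (rule equilipschitz_convergent[OF lip L])
    fix r :: real assume "r \<in> \<rat>"
    then obtain u where "r = real_of_rat u" by (rule Rats_cases)
    moreover obtain m where "u = nat_to_rat_surj m" using surj_nat_to_rat_surj by (rule surjE)
    ultimately have "r = q m" by (simp add: q_def)
    then show "convergent (\<lambda>i. g (?\<phi> i) j r)" using conv3[of j m] unfolding convergent_def by blast
  qed
  then have h: "(\<lambda>i. g (?\<phi> i) j t) \<longlonglongrightarrow> lim (\<lambda>i. g (?\<phi> i) j t)" for j t by (simp add: convergent_LIMSEQ_iff)
  have \<sigma>: "(\<lambda>i. \<tau> (?\<phi> i) j) \<longlonglongrightarrow> lim (\<lambda>i. \<tau> (?\<phi> i) j)" for j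
    using conv3[of j 0] unfolding convergent_LIMSEQ_iff[symmetric] convergent_def by blast
  obtain l where l: "(\<lambda>i. ereal (real (J (?\<phi> i)))) \<longlonglongrightarrow> l" using conv3 by blast
  show ?thesis by (rule that[OF subseq_diagseq h \<sigma> l])
qed

section \<open>Sequential compactness of solutions\<close>

lemma clamp_nonexpansive:
  fixes a b s t :: real
  shows "\<bar>max a (min s b) - max a (min t b)\<bar> \<le> \<bar>s - t\<bar>"
  by (auto simp: max_def min_def)

text \<open>For the numbers of jumps this separates unbounded growth from a number that settles:
  natural numbers within 1/2 of the same real are equal.\<close>

lemma nat_tendsto_ereal:
  fixes J :: "nat \<Rightarrow> nat"
  assumes "(\<lambda>i. ereal (real (J i))) \<longlonglongrightarrow> l"
  shows "(\<forall>j. \<forall>\<^sub>F i in sequentially. j \<le> J i) \<or> (\<exists>j0. \<forall>\<^sub>F i in sequentially. J i = j0)"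
proof (cases l)
  case PInf
  have "\<forall>\<^sub>F i in sequentially. j \<le> J i" for j
  proof -
    have "\<forall>\<^sub>F i in sequentially. ereal (real j) < ereal (real (J i))"
      using assms by (rule order_tendstoD) (simp add: PInf)
    then show ?thesis by eventually_elim simp
  qed
  then show ?thesis by blast
next
  case MInf
  have "0 \<le> l" by (rule tendsto_lowerbound[OF assms]) auto
  then show ?thesis by (simp add: MInf)
next
  case (real r)
  then have "(\<lambda>i. real (J i)) \<longlonglongrightarrow> r" using assms by simp
  then have ev: "\<forall>\<^sub>F i in sequentially. dist (real (J i)) r < 1 / 2" by (rule tendstoD) simp
  then obtain n where n: "\<And>i. i \<ge> n \<Longrightarrow> dist (real (J i)) r < 1 / 2" unfolding eventually_sequentially by blast
  have "J i = J n" if "i \<ge> n" for i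
  proof -
    have "\<bar>real (J i) - real (J n)\<bar> < 1" using n[OF that] n[of n] unfolding dist_real_def by linarith
    then show ?thesis by linarith
  qed
  then have "\<forall>\<^sub>F i in sequentially. J i = J n" unfolding eventually_sequentially by blast
  then show ?thesis by blast
qed

text \<open>The last clause records how the end points \<^term>\<open>(T i, J i)\<close> of the considered parts of the domains
  survive in the limit.\<close>

definition graphical_limit ::
  "(nat \<Rightarrow> 'a::euclidean_space arc) \<Rightarrow> (nat \<Rightarrow> real) \<Rightarrow> (nat \<Rightarrow> nat) \<Rightarrow> 'a arc \<Rightarrow> bool" where
  "graphical_limit x T J y \<longleftrightarrow> (\<lambda>i. val (x i) 0 0) \<longlonglongrightarrow> val y 0 0 \<and>
     (\<forall>t j. (t, j) \<in> dom y \<longrightarrow> (\<exists>s. s \<longlonglongrightarrow> t \<and>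
       (\<forall>\<^sub>F i in sequentially. (s i, j) \<in> dom (x i) \<and> s i \<le> T i \<and> j \<le> J i) \<and>
       (\<lambda>i. val (x i) (s i) j) \<longlonglongrightarrow> val y t j)) \<and>
     (complete_arc y \<or> (\<exists>t j. (t, j) \<in> dom y \<and> T \<longlonglongrightarrow> t \<and>
       (\<forall>\<^sub>F i in sequentially. J i = j) \<and> (\<lambda>i. val (x i) (T i) (J i)) \<longlonglongrightarrow> val y t j))"

text \<open>On each level the curves live on different intervals. Clamping the time to the interval
  extends them to the whole line with the common Lipschitz constant \<open>M\<close>, which bounds
  the velocities on \<open>K\<close>. A subsequence then converges on every level, and the limit
  curves are cut back to the limits \<open>\<sigma> j\<close> of the jump times.\<close>

lemma solution_sequence_limit:
  fixes x :: "nat \<Rightarrow> 'a::euclidean_space arc"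
  assumes H: "basic_assumptions H" and K: "compact K"
    and x: "\<And>i. sol H (x i)" and TJ: "\<And>i. (T i, J i) \<in> dom (x i)"
    and inK: "\<And>i s k. (s, k) \<in> dom (x i) \<Longrightarrow> s \<le> T i \<Longrightarrow> k \<le> J i \<Longrightarrow> val (x i) s k \<in> K"
  obtains y \<phi> where "sol H y" "strict_mono (\<phi> :: nat \<Rightarrow> nat)"
    "graphical_limit (\<lambda>i. x (\<phi> i)) (\<lambda>i. T (\<phi> i)) (\<lambda>i. J (\<phi> i)) y"
proof -
  define \<tau> where "\<tau> i = truncation_time (dom (x i)) (T i) (J i)" for i
  have \<tau>: "\<tau> i 0 = 0" "\<tau> i j \<le> \<tau> i (Suc j)"
    "j \<le> J i \<Longrightarrow> (s, j) \<in> dom (x i) \<and> s \<le> T i \<longleftrightarrow> \<tau> i j \<le> s \<and> s \<le> \<tau> i (Suc j)" for i j s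
    unfolding \<tau>_def by (rule truncation_time[OF solD(1)[OF x] TJ])+
  have \<tau>T: "\<tau> i j = T i" if "J i < j" for i j using that by (simp add: \<tau>_def truncation_time_def)
  define cl where "cl i j t = max (\<tau> i j) (min t (\<tau> i (Suc j)))" for i j t
  have cl: "\<tau> i j \<le> cl i j t" "cl i j t \<le> \<tau> i (Suc j)" for i j t
    using \<tau>(2)[of i j] by (auto simp: cl_def)
  have cl_id: "cl i j t = t" if "\<tau> i j \<le> t" "t \<le> \<tau> i (Suc j)" for i j t
    using that by (simp add: cl_def)
  have cl_dom: "(cl i j t, j) \<in> dom (x i)" "cl i j t \<le> T i" if "j \<le> J i" for i j t
    using \<tau>(3)[OF that, of "cl i j t"] cl[of i j t] by auto
  \<comment> \<open>Levels that are never reached get the constant end value, so that a curve in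
    \<open>K\<close> is defined for all \<open>i\<close> and \<open>j\<close>.\<close>
  define g where "g i j t = (if j \<le> J i then val (x i) (cl i j t) j else val (x i) (T i) (J i))" for i j t
  have g_eq: "g i j t = val (x i) t j" if "j \<le> J i" "\<tau> i j \<le> t" "t \<le> \<tau> i (Suc j)" for i j t
    using that by (simp add: g_def cl_id)
  have gK: "g i j t \<in> K" for i j t
    using inK[OF cl_dom, of j i t] inK[OF TJ, of i] by (simp add: g_def)
  obtain M where M: "0 \<le> M" "\<And>z v. z \<in> K \<inter> flow_set H \<Longrightarrow> v \<in> flow_map H z \<Longrightarrow> norm v \<le> M"
    using flow_map_bounded_on_compact[OF H K] by blast
  have lip: "dist (g i j s) (g i j t) \<le> M * \<bar>s - t\<bar>" for i j s t
  proof (cases "j \<le> J i \<and> \<tau> i j < \<tau> i (Suc j)")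
    case True
    let ?a = "\<tau> i j" and ?b = "\<tau> i (Suc j)"
    have ab: "(?a, j) \<in> dom (x i)" "(?b, j) \<in> dom (x i)"
      using \<tau>(3)[of j i ?a] \<tau>(3)[of j i ?b] True by auto
    have seg: "flow_segment H (\<lambda>t. val (x i) t j) ?a ?b" using solD(2)[OF x _ ab] True by blast
    have "M-lipschitz_on {?a..?b} (\<lambda>t. val (x i) t j)"
    proof (rule flow_segment_lipschitz[OF seg M(1)])
      fix t v assume t: "t \<in> {?a<..<?b}" and v: "v \<in> flow_map H (val (x i) t j)"
      have "val (x i) t j \<in> flow_set H" using seg t by (auto simp: flow_segment_def)
      moreover have "val (x i) t j \<in> K" using \<tau>(3)[of j i t] t True by (intro inK) auto
      ultimately show "norm v \<le> M" using M(2) v by blast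
    qed
    from lipschitz_onD[OF this, of "cl i j s" "cl i j t"]
    have "dist (g i j s) (g i j t) \<le> M * dist (cl i j s) (cl i j t)" using cl True by (simp add: g_def)
    also have "\<dots> \<le> M * \<bar>s - t\<bar>"
      unfolding dist_real_def cl_def by (intro mult_left_mono clamp_nonexpansive M(1))
    finally show ?thesis .
  next
    case False
    have "g i j s = g i j t"
    proof (cases "j \<le> J i")
      case True
      then have "\<tau> i (Suc j) \<le> \<tau> i j" using False by simp
      then have "cl i j s = cl i j t" using cl[of i j s] cl[of i j t] by linarith
      then show ?thesis by (simp add: g_def)
    qed (simp add: g_def)
    then show ?thesis using M(1) by simp
  qed
  obtain \<phi> h \<sigma> l where \<phi>: "strict_mono (\<phi> :: nat \<Rightarrow> nat)" and h: "\<And>j t. (\<lambda>i. g (\<phi> i) j t) \<longlonglongrightarrow> h j t"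
    and \<sigma>: "\<And>j. (\<lambda>i. ereal (\<tau> (\<phi> i) j)) \<longlonglongrightarrow> \<sigma> j" and l: "(\<lambda>i. ereal (real (J (\<phi> i)))) \<longlonglongrightarrow> l"
    using diagonal_extraction[of K g M "\<lambda>i j. ereal (\<tau> i j)" J, OF K gK lip M(1)] by blast
  have \<sigma>0: "\<sigma> 0 = 0"
    using \<sigma>[of 0] unfolding \<tau>(1) by (simp add: LIMSEQ_const_iff zero_ereal_def)
  have \<sigma>mono: "\<sigma> j \<le> \<sigma> (Suc j)" for j
    by (rule LIMSEQ_le[OF \<sigma> \<sigma>]) (use \<tau>(2) in auto)
  have \<sigma>nonneg: "0 \<le> \<sigma> j" for j
    by (induction j) (use \<sigma>0 \<sigma>mono order_trans in auto)
  have hlip: "dist (h j s) (h j t) \<le> M * \<bar>s - t\<bar>" for j s t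
    by (rule tendsto_upperbound[OF tendsto_dist[OF h h]]) (use lip in auto)
  have hL: "M-lipschitz_on S (h j)" for S j
    using hlip M(1) by (intro lipschitz_onI) (auto simp: dist_real_def)
  \<comment> \<open>A level belongs to the limit if almost all members of the subsequence reach
    it.\<close>
  define P where "P j \<longleftrightarrow> (\<forall>\<^sub>F i in sequentially. j \<le> J (\<phi> i))" for j
  have P0: "P 0" by (simp add: P_def)
  have Pdown: "P j" if "P (Suc j)" for j
    using that unfolding P_def by eventually_elim simp
  \<comment> \<open>Times are compared in the extended reals:
    \<open>\<sigma> (Suc j) = \<infinity>\<close> lets level \<open>j\<close> flow for ever, and
    then all higher levels are empty.\<close>
  define y where "y = (\<lambda>(t, j). if P j \<and> \<sigma> j \<le> ereal t \<and> ereal t \<le> \<sigma> (Suc j) then Some (h j t) else None)"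
  have domy: "(t, j) \<in> dom y \<longleftrightarrow> P j \<and> \<sigma> j \<le> ereal t \<and> ereal t \<le> \<sigma> (Suc j)" for t j
    by (simp add: y_def dom_def)
  have valy: "val y t j = h j t" if "(t, j) \<in> dom y" for t j
    using that unfolding domy by (simp add: y_def)
  have jump_real: "\<exists>T. \<sigma> (Suc j) = ereal T" if "(t, Suc j) \<in> dom y" for t j
    using that \<sigma>nonneg[of "Suc j"] unfolding domy by (cases "\<sigma> (Suc j)") auto
  have hd: "hybrid_dom (dom y)"
    unfolding hybrid_dom_def
  proof (intro conjI allI impI)
    show "(0, 0) \<in> dom y" unfolding domy using P0 \<sigma>0 \<sigma>nonneg[of "Suc 0"] by (simp add: zero_ereal_def)
    show "0 \<le> t" if "(t, 0) \<in> dom y" for t using that \<sigma>0 unfolding domy by (simp add: zero_ereal_def)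
    show "(t, j) \<in> dom y" if "(a, j) \<in> dom y" "(b, j) \<in> dom y" "a \<le> t" "t \<le> b" for j a b t
      using that unfolding domy by (meson ereal_less_eq(3) order_trans)
    show "\<exists>T. (T, j) \<in> dom y \<and> (T, Suc j) \<in> dom y \<and> (\<forall>s. (s, j) \<in> dom y \<longrightarrow> s \<le> T) \<and> (\<forall>s. (s, Suc j) \<in> dom y \<longrightarrow> T \<le> s)"
      if t: "(t, Suc j) \<in> dom y" for t j
    proof -
      obtain T where T: "\<sigma> (Suc j) = ereal T" using jump_real[OF t] by blast
      have "ereal T \<le> \<sigma> (Suc (Suc j))" using \<sigma>mono[of "Suc j"] T by simp
      moreover have "P (Suc j)" "P j" using t Pdown[of j] unfolding domy by auto
      moreover have "\<sigma> j \<le> ereal T" using \<sigma>mono[of j] T by simp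
      ultimately show ?thesis unfolding domy T by (intro exI[of _ T]) auto
    qed
  qed
  have seg: "flow_segment H (h j) a b" if ab: "a < b" and aj: "(a, j) \<in> dom y" and bj: "(b, j) \<in> dom y" for j a b
  proof -
    \<comment> \<open>The jump times only converge, so the approximating flows cover the
      subintervals strictly inside; these suffice for the velocity almost everywhere.\<close>
    have ev: "\<forall>\<^sub>F i in sequentially. flow_segment H (g (\<phi> i) j) c d" if cd: "a < c" "c < d" "d < b" for c d
    proof -
      have "\<sigma> j \<le> ereal a" using aj unfolding domy by simp
      also have "ereal a < ereal c" using cd by simp
      finally have "\<forall>\<^sub>F i in sequentially. ereal (\<tau> (\<phi> i) j) < ereal c" by (rule order_tendstoD(2)[OF \<sigma>])
      moreover have "ereal d < ereal b" using cd by simp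
      then have "ereal d < \<sigma> (Suc j)" using bj unfolding domy by (meson less_le_trans)
      then have "\<forall>\<^sub>F i in sequentially. ereal d < ereal (\<tau> (\<phi> i) (Suc j))" by (rule order_tendstoD(1)[OF \<sigma>])
      moreover have "\<forall>\<^sub>F i in sequentially. j \<le> J (\<phi> i)" using aj unfolding domy P_def by blast
      ultimately show ?thesis
      proof eventually_elim
        case (elim i)
        then have *: "\<tau> (\<phi> i) j < c" "d < \<tau> (\<phi> i) (Suc j)" "j \<le> J (\<phi> i)" by auto
        have "(c, j) \<in> dom (x (\<phi> i))" "(d, j) \<in> dom (x (\<phi> i))"
          using \<tau>(3)[OF *(3), of c] \<tau>(3)[OF *(3), of d] * cd by auto
        from solD(2)[OF x cd(2) this] show ?case
          by (rule flow_segment_cong) (use * g_eq[OF *(3)] in auto)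
      qed
    qed
    have "AE t in lebesgue. \<exists>v. (h j has_vector_derivative v) (at t)"
      by (rule lipschitz_differentiable_AE[of _ M]) (use hlip in \<open>auto simp: dist_norm\<close>)
    then obtain N where N: "N \<in> null_sets lebesgue" "\<And>t. t \<notin> N \<Longrightarrow> \<exists>v. (h j has_vector_derivative v) (at t)"
      by (rule AE_E3) auto
    have mid: "a < (a + t) / 2" "(a + t) / 2 < t" "t < (t + b) / 2" "(t + b) / 2 < b" if "t \<in> {a<..<b}" for t
      using that by auto
    have "\<exists>v\<in>flow_map H (h j t). (h j has_vector_derivative v) (at t)" if t: "t \<in> {a<..<b} - N" for t
    proof -
      obtain v where v: "(h j has_vector_derivative v) (at t)" using N(2) t by blast
      have t': "t \<in> {a<..<b}" using t by simp
      note m = mid[OF t']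
      have "v \<in> flow_map H (h j t)"
        by (rule flow_limit_derivative[OF H ev[OF m(1) less_trans[OF m(2,3)] m(4)] lip M(1) h _ v]) (use m in auto)
      then show ?thesis using v by blast
    qed
    moreover have C: "h j t \<in> flow_set H" if t: "t \<in> {a<..<b}" for t
    proof -
      note m = mid[OF t]
      have "\<forall>\<^sub>F i in sequentially. g (\<phi> i) j t \<in> flow_set H"
        using ev[OF m(1) less_trans[OF m(2,3)] m(4)] by eventually_elim (use m in \<open>auto simp: flow_segment_def\<close>)
      moreover have "closed (flow_set H)" using H by (simp add: basic_assumptions_def)
      ultimately show ?thesis using Lim_in_closed_set[OF _ _ _ h] by simp
    qed
    \<comment> \<open>The left end \<open>a\<close> must lie over the flow set as well; it is
      reached by closure.\<close>
    have "h j ` closure {a<..<b} \<subseteq> flow_set H"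
    proof (rule image_closure_subset)
      show "continuous_on (closure {a<..<b}) (h j)" using hL by (rule lipschitz_on_continuous_on)
      show "closed (flow_set H)" using H by (simp add: basic_assumptions_def)
    qed (use C in auto)
    then have "\<forall>t\<in>{a..<b}. h j t \<in> flow_set H" using ab by auto
    moreover have "negligible N" using N(1) by (simp add: negligible_iff_null_sets)
    ultimately show ?thesis
      unfolding flow_segment_def by (intro conjI exI[of _ M] exI[of _ N] hL ballI) auto
  qed
  have "sol H y"
    unfolding sol_def
  proof (intro conjI allI impI hd)
    show "flow_segment H (\<lambda>t. val y t j) a b" if "a < b" "(a, j) \<in> dom y" "(b, j) \<in> dom y" for j a b
      by (rule flow_segment_cong[OF seg[OF that]])
         (use hybrid_dom_convex[OF hd that(2,3)] valy in auto)
  next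
    fix t j assume t: "(t, j) \<in> dom y" "(t, Suc j) \<in> dom y"
    \<comment> \<open>A time common to two levels is squeezed between both bounds and is thus the
      limit of the jump times.\<close>
    have "\<sigma> (Suc j) = ereal t" using t unfolding domy by (auto intro: antisym)
    then have \<tau>t: "(\<lambda>i. \<tau> (\<phi> i) (Suc j)) \<longlonglongrightarrow> t" using \<sigma>[of "Suc j"] by simp
    have lims: "(\<lambda>i. g (\<phi> i) j (\<tau> (\<phi> i) (Suc j))) \<longlonglongrightarrow> h j t"
      "(\<lambda>i. g (\<phi> i) (Suc j) (\<tau> (\<phi> i) (Suc j))) \<longlonglongrightarrow> h (Suc j) t"
      by (rule equilipschitz_tendsto[OF lip h \<tau>t])+
    have ev: "\<forall>\<^sub>F i in sequentially. g (\<phi> i) j (\<tau> (\<phi> i) (Suc j)) \<in> jump_set H \<and>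
        g (\<phi> i) (Suc j) (\<tau> (\<phi> i) (Suc j)) \<in> jump_map H (g (\<phi> i) j (\<tau> (\<phi> i) (Suc j)))"
    proof -
      have "\<forall>\<^sub>F i in sequentially. Suc j \<le> J (\<phi> i)" using t(2) unfolding domy P_def by blast
      then show ?thesis
      proof eventually_elim
        case (elim i)
        let ?t = "\<tau> (\<phi> i) (Suc j)"
        have "(?t, j) \<in> dom (x (\<phi> i))" "(?t, Suc j) \<in> dom (x (\<phi> i))"
          using \<tau>(3)[of j "\<phi> i" ?t] \<tau>(3)[OF elim, of ?t] elim \<tau>(2)[of "\<phi> i" j] \<tau>(2)[of "\<phi> i" "Suc j"] by auto
        then have "val (x (\<phi> i)) ?t j \<in> jump_set H \<and> val (x (\<phi> i)) ?t (Suc j) \<in> jump_map H (val (x (\<phi> i)) ?t j)"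
          using solD(3,4)[OF x] by blast
        moreover have "g (\<phi> i) j ?t = val (x (\<phi> i)) ?t j" using elim \<tau>(2)[of "\<phi> i" j] by (intro g_eq) auto
        moreover have "g (\<phi> i) (Suc j) ?t = val (x (\<phi> i)) ?t (Suc j)" using elim \<tau>(2)[of "\<phi> i" "Suc j"] by (intro g_eq) auto
        ultimately show ?case by simp
      qed
    qed
    have "closed (jump_set H)" "outer_semicontinuous (jump_map H)" using H by (auto simp: basic_assumptions_def)
    then have "h j t \<in> jump_set H" "h (Suc j) t \<in> jump_map H (h j t)"
      using ev Lim_in_closed_set[OF _ _ _ lims(1), of "jump_set H"] outer_semicontinuous_eventually[OF _ lims]
      by (auto simp: eventually_conj_iff)
    then show "val y t j \<in> jump_set H" "val y t (Suc j) \<in> jump_map H (val y t j)"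
      using valy[OF t(1)] valy[OF t(2)] by auto
  qed
  moreover have "(\<lambda>i. val (x (\<phi> i)) 0 0) \<longlonglongrightarrow> val y 0 0"
  proof -
    have "g i 0 0 = val (x i) 0 0" for i using \<tau>(1)[of i] \<tau>(2)[of i 0] by (intro g_eq) auto
    then show ?thesis using h[of 0 0] valy[OF hybrid_dom_zero[OF hd]] by simp
  qed
  moreover have "\<exists>s. s \<longlonglongrightarrow> t \<and>
       (\<forall>\<^sub>F i in sequentially. (s i, j) \<in> dom (x (\<phi> i)) \<and> s i \<le> T (\<phi> i) \<and> j \<le> J (\<phi> i)) \<and>
       (\<lambda>i. val (x (\<phi> i)) (s i) j) \<longlonglongrightarrow> val y t j" if tj: "(t, j) \<in> dom y" for t j
  proof (intro exI conjI)
    \<comment> \<open>The clamped times lie in the approximating domains, and they converge to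
      \<open>t\<close> because the ends of the sections converge.\<close>
    let ?s = "\<lambda>i. cl (\<phi> i) j t"
    have Pj: "\<forall>\<^sub>F i in sequentially. j \<le> J (\<phi> i)" using tj unfolding domy P_def by blast
    have "(\<lambda>i. max (ereal (\<tau> (\<phi> i) j)) (min (ereal t) (ereal (\<tau> (\<phi> i) (Suc j))))) \<longlonglongrightarrow> max (\<sigma> j) (min (ereal t) (\<sigma> (Suc j)))"
      by (intro tendsto_max tendsto_min \<sigma> tendsto_const)
    also have "max (\<sigma> j) (min (ereal t) (\<sigma> (Suc j))) = ereal t" using tj unfolding domy by (simp add: min_absorb1 max_absorb2)
    also have "(\<lambda>i. max (ereal (\<tau> (\<phi> i) j)) (min (ereal t) (ereal (\<tau> (\<phi> i) (Suc j))))) = (\<lambda>i. ereal (?s i))"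
      by (auto simp: cl_def max_def min_def)
    finally show "?s \<longlonglongrightarrow> t" by simp
    show "\<forall>\<^sub>F i in sequentially. (?s i, j) \<in> dom (x (\<phi> i)) \<and> ?s i \<le> T (\<phi> i) \<and> j \<le> J (\<phi> i)"
      using Pj by eventually_elim (use cl_dom in blast)
    have "\<forall>\<^sub>F i in sequentially. g (\<phi> i) j t = val (x (\<phi> i)) (?s i) j"
      using Pj by eventually_elim (simp add: g_def)
    then show "(\<lambda>i. val (x (\<phi> i)) (?s i) j) \<longlonglongrightarrow> val y t j"
      using h[of j t] valy[OF tj] by (auto intro: Lim_transform_eventually)
  qed
  moreover have "complete_arc y \<or> (\<exists>t j. (t, j) \<in> dom y \<and> (\<lambda>i. T (\<phi> i)) \<longlonglongrightarrow> t \<and>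
       (\<forall>\<^sub>F i in sequentially. J (\<phi> i) = j) \<and> (\<lambda>i. val (x (\<phi> i)) (T (\<phi> i)) (J (\<phi> i))) \<longlonglongrightarrow> val y t j)"
  proof (cases "\<exists>j. P j \<and> \<sigma> (Suc j) = \<infinity>")
    case True
    \<comment> \<open>The least such level starts at a finite time, because the section before it
      has a finite end; so the limit really flows for ever on it.\<close>
    define j where "j = (LEAST j. P j \<and> \<sigma> (Suc j) = \<infinity>)"
    have j: "P j \<and> \<sigma> (Suc j) = \<infinity>" unfolding j_def using True by (rule LeastI_ex)
    have "\<sigma> j \<noteq> \<infinity>"
    proof (cases j)
      case 0 then show ?thesis using \<sigma>0 by simp
    next
      case (Suc k)
      then have "k < j" "P k" using j Pdown by auto
      then show ?thesis using not_less_Least[of k "\<lambda>j. P j \<and> \<sigma> (Suc j) = \<infinity>"] Suc unfolding j_def by auto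
    qed
    then obtain r where r: "\<sigma> j = ereal r" using \<sigma>nonneg[of j] by (cases "\<sigma> j") auto
    have "\<exists>t k. (t, k) \<in> dom y \<and> n \<le> t + real k" for n
      by (rule exI[of _ "max n r"], rule exI[of _ j]) (use j r in \<open>auto simp: domy\<close>)
    then show ?thesis unfolding complete_arc_iff[OF hd] by blast
  next
    case False
    have fin: "\<exists>r. \<sigma> (Suc j) = ereal r" if "P j" for j
      using that False \<sigma>nonneg[of "Suc j"] by (cases "\<sigma> (Suc j)") auto
    show ?thesis
    proof (cases "\<forall>j. P j")
      case True
      have "\<exists>t k. (t, k) \<in> dom y \<and> n \<le> t + real k" for n
      proof -
        obtain k :: nat where k: "n \<le> real k" using real_arch_simple by blast
        obtain r where r: "\<sigma> (Suc k) = ereal r" using fin True by blast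
        have "(r, Suc k) \<in> dom y" unfolding domy using True r \<sigma>mono[of "Suc k"] by simp
        moreover have "0 \<le> r" using \<sigma>nonneg[of "Suc k"] r by simp
        ultimately show ?thesis using k by (intro exI[of _ r] exI[of _ "Suc k"]) auto
      qed
      then show ?thesis unfolding complete_arc_iff[OF hd] by blast
    next
      case False
      \<comment> \<open>Some level fails to survive, so the numbers of jumps settle at
        \<open>j\<close>. Then \<open>\<tau> (\<phi> i) (Suc j)\<close> is the end time
        \<open>T (\<phi> i)\<close> by the convention for truncated times.\<close>
      then obtain j where j: "\<forall>\<^sub>F i in sequentially. J (\<phi> i) = j"
        using nat_tendsto_ereal[OF l] unfolding P_def by blast
      then have "P j" unfolding P_def by eventually_elim simp
      then obtain t where t: "\<sigma> (Suc j) = ereal t" using fin by blast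
      have tj: "(t, j) \<in> dom y" unfolding domy using \<open>P j\<close> t \<sigma>mono[of j] by simp
      have \<tau>t: "(\<lambda>i. \<tau> (\<phi> i) (Suc j)) \<longlonglongrightarrow> t" using \<sigma>[of "Suc j"] t by simp
      have eq: "\<forall>\<^sub>F i in sequentially. \<tau> (\<phi> i) (Suc j) = T (\<phi> i)"
        using j by eventually_elim (simp add: \<tau>T)
      have "(\<lambda>i. T (\<phi> i)) \<longlonglongrightarrow> t" using \<tau>t eq by (rule Lim_transform_eventually)
      moreover have "\<forall>\<^sub>F i in sequentially. g (\<phi> i) j (\<tau> (\<phi> i) (Suc j)) = val (x (\<phi> i)) (T (\<phi> i)) (J (\<phi> i))"
        using j eq
      proof eventually_elim
        case (elim i)
        have "g (\<phi> i) j (\<tau> (\<phi> i) (Suc j)) = val (x (\<phi> i)) (\<tau> (\<phi> i) (Suc j)) j"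
          using elim \<tau>(2)[of "\<phi> i" j] by (intro g_eq) auto
        then show ?case using elim by simp
      qed
      then have "(\<lambda>i. val (x (\<phi> i)) (T (\<phi> i)) (J (\<phi> i))) \<longlonglongrightarrow> h j t"
        by (rule Lim_transform_eventually[OF equilipschitz_tendsto[OF lip h \<tau>t]])
      ultimately show ?thesis
        using tj j unfolding valy[OF tj, symmetric] by blast
    qed
  qed
  ultimately show ?thesis using that[of y \<phi>] \<phi> unfolding graphical_limit_def by blast
qed

lemma graphical_limitD:
  assumes "graphical_limit x T J y"
  shows "(\<lambda>i. val (x i) 0 0) \<longlonglongrightarrow> val y 0 0"
    "(t, j) \<in> dom y \<Longrightarrow> \<exists>s. s \<longlonglongrightarrow> t \<and>
       (\<forall>\<^sub>F i in sequentially. (s i, j) \<in> dom (x i) \<and> s i \<le> T i \<and> j \<le> J i) \<and>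
       (\<lambda>i. val (x i) (s i) j) \<longlonglongrightarrow> val y t j"
    "complete_arc y \<or> (\<exists>t j. (t, j) \<in> dom y \<and> T \<longlonglongrightarrow> t \<and>
       (\<forall>\<^sub>F i in sequentially. J i = j) \<and> (\<lambda>i. val (x i) (T i) (J i)) \<longlonglongrightarrow> val y t j)"
  using assms unfolding graphical_limit_def by blast+

section \<open>Attraction and stability\<close>

lemma mem_set_ball: "x \<in> set_ball \<Gamma> c \<longleftrightarrow> (\<exists>y\<in>\<Gamma>. dist x y < c)"
  by (simp add: set_ball_def setdistance_def INF_less_iff)

lemma open_set_ball: "open (set_ball \<Gamma> c)"
proof -
  have "set_ball \<Gamma> c = (\<Union>y\<in>\<Gamma>. ball y c)" by (auto simp: mem_set_ball dist_commute)
  then show ?thesis by auto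
qed

lemma subset_set_ball: "0 < c \<Longrightarrow> \<Gamma> \<subseteq> set_ball \<Gamma> c"
  by (force simp: mem_set_ball)

lemma set_ball_mono: "\<Gamma> \<subseteq> \<Gamma>' \<Longrightarrow> c \<le> c' \<Longrightarrow> set_ball \<Gamma> c \<subseteq> set_ball \<Gamma>' c'"
  by (force simp: mem_set_ball)

lemma set_ball_infdist: "\<Gamma> \<noteq> {} \<Longrightarrow> set_ball \<Gamma> c = {x. infdist x \<Gamma> < c}"
  by (simp add: set_ball_def setdistance_eq_infdist)

lemma limit_in_closed_set:
  assumes "closed \<Gamma>" "z \<longlonglongrightarrow> l" "\<And>e. e > 0 \<Longrightarrow> \<forall>\<^sub>F i in sequentially. z i \<in> set_ball \<Gamma> e"
  shows "l \<in> \<Gamma>"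
proof -
  have "\<exists>y\<in>\<Gamma>. dist y l < e" if "e > 0" for e
  proof -
    have "\<forall>\<^sub>F i in sequentially. dist (z i) l < e / 2" using assms(2) by (rule tendstoD) (use \<open>e > 0\<close> in simp)
    moreover have "\<forall>\<^sub>F i in sequentially. z i \<in> set_ball \<Gamma> (e / 2)" using \<open>e > 0\<close> by (intro assms(3)) simp
    ultimately have "\<forall>\<^sub>F i in sequentially. \<exists>y\<in>\<Gamma>. dist y l < e"
    proof eventually_elim
      case (elim i)
      then obtain y where "y \<in> \<Gamma>" "dist (z i) y < e / 2" by (auto simp: mem_set_ball)
      then show ?case using elim(1) dist_triangle_half_r by blast
    qed
    then show ?thesis by (simp add: eventually_const_iff)
  qed
  then show ?thesis using closure_approachable[of l \<Gamma>] closure_closed[OF assms(1)] by simp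
qed

lemma converges_to_iff:
  "converges_to x \<Gamma> \<longleftrightarrow>
     (\<forall>e>0. \<exists>n. \<forall>t j. (t, j) \<in> dom x \<longrightarrow> n \<le> t + real j \<longrightarrow> val x t j \<in> set_ball \<Gamma> e)"
proof -
  let ?F = "inf (filtercomap (\<lambda>(t, j). t + real j) at_top) (principal (dom x))"
  have ev: "(\<forall>\<^sub>F p in ?F. setdistance (the (x p)) \<Gamma> < u) \<longleftrightarrow>
      (\<exists>n. \<forall>t j. (t, j) \<in> dom x \<longrightarrow> n \<le> t + real j \<longrightarrow> setdistance (val x t j) \<Gamma> < u)" for u
    unfolding eventually_inf_principal eventually_filtercomap_at_top_linorder by auto
  have nonneg: "0 \<le> setdistance z \<Gamma>" for z unfolding setdistance_def by (intro INF_greatest) simp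
  show ?thesis
  proof
    assume "converges_to x \<Gamma>"
    then have "\<forall>\<^sub>F p in ?F. setdistance (the (x p)) \<Gamma> < ereal e" if "e > 0" for e
      using that unfolding converges_to_def by (intro order_tendstoD) auto
    then show "\<forall>e>0. \<exists>n. \<forall>t j. (t, j) \<in> dom x \<longrightarrow> n \<le> t + real j \<longrightarrow> val x t j \<in> set_ball \<Gamma> e"
      unfolding ev set_ball_def by simp
  next
    assume *: "\<forall>e>0. \<exists>n. \<forall>t j. (t, j) \<in> dom x \<longrightarrow> n \<le> t + real j \<longrightarrow> val x t j \<in> set_ball \<Gamma> e"
    show "converges_to x \<Gamma>"
      unfolding converges_to_def
    proof (rule order_tendstoI)
      fix u :: ereal assume "u < 0"
      then show "\<forall>\<^sub>F p in ?F. u < setdistance (the (x p)) \<Gamma>" using nonneg less_le_trans by (intro always_eventually) blast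
    next
      fix u :: ereal assume "0 < u"
      then obtain e where e: "0 < ereal e" "ereal e < u" using ereal_dense2 by blast
      then obtain n where "\<forall>t j. (t, j) \<in> dom x \<longrightarrow> n \<le> t + real j \<longrightarrow> val x t j \<in> set_ball \<Gamma> e" using * by auto
      then show "\<forall>\<^sub>F p in ?F. setdistance (the (x p)) \<Gamma> < u"
        unfolding ev set_ball_def using e(2) by (auto intro!: exI[of _ n] intro: less_trans)
    qed
  qed
qed

lemma val_in_ran: "(t, j) \<in> dom x \<Longrightarrow> val x t j \<in> ran x"
  by (metis domD option.sel ranI)

lemma ran_arcE: "z \<in> ran x \<Longrightarrow> (\<And>t j. (t, j) \<in> dom x \<Longrightarrow> z = val x t j \<Longrightarrow> thesis) \<Longrightarrow> thesis"
  by (force simp: ran_def)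

lemma map_le_val: "x \<subseteq>\<^sub>m y \<Longrightarrow> (t, j) \<in> dom x \<Longrightarrow> (t, j) \<in> dom y \<and> val y t j = val x t j"
  unfolding map_le_def by (metis domIff)

lemma map_le_ran: "x \<subseteq>\<^sub>m y \<Longrightarrow> ran x \<subseteq> ran y"
  by (force simp: map_le_def ran_def dom_def)

lemma complete_arc_map_le:
  assumes "complete_arc x" "x \<subseteq>\<^sub>m y"
  shows "complete_arc y"
  using assms(1) bounded_subset[OF _ image_mono[OF map_le_implies_dom_le[OF assms(2)]]]
  unfolding complete_arc_def by blast

lemma converges_to_map_le:
  assumes "converges_to y \<Gamma>" "x \<subseteq>\<^sub>m y"
  shows "converges_to x \<Gamma>"
  using assms(1) map_le_val[OF assms(2)] unfolding converges_to_iff by metis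

section \<open>Restriction to a closed set and the properties it inherits\<close>

lemma solutions_mono: "U \<subseteq> V \<Longrightarrow> solutions H U \<subseteq> solutions H V"
  unfolding solutions_def by blast

lemma flow_segment_restriction:
  "flow_segment (restriction H \<Gamma>) f a b \<longleftrightarrow> flow_segment H f a b \<and> (\<forall>t\<in>{a..<b}. f t \<in> \<Gamma>)"
  unfolding flow_segment_def restriction_def by auto

lemma sol_restrictionD: "sol (restriction H \<Gamma>) x \<Longrightarrow> sol H x"
  unfolding sol_def flow_segment_restriction by (simp add: restriction_def)

text \<open>Flow and jump sets constrain a solution only at points that are followed by later ones.
  A final point may lie outside \<open>\<Gamma>\<close>, as an exit point can.\<close>

lemma sol_restrictionI:
  assumes "sol H x"
    and "\<And>t j s k. (t, j) \<in> dom x \<Longrightarrow> (s, k) \<in> dom x \<Longrightarrow> t + real j < s + real k \<Longrightarrow> val x t j \<in> \<Gamma>"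
  shows "sol (restriction H \<Gamma>) x"
proof -
  have "val x t j \<in> \<Gamma>" if "(a, j) \<in> dom x" "(b, j) \<in> dom x" "t \<in> {a..<b}" for a b t j
    using assms(2)[of t j b j] hybrid_dom_convex[OF solD(1)[OF assms(1)] that(1,2), of t] that by simp
  moreover have "val x t j \<in> \<Gamma>" if "(t, j) \<in> dom x" "(t, Suc j) \<in> dom x" for t j
    using assms(2)[of t j t "Suc j"] that by simp
  ultimately show ?thesis
    using assms(1) unfolding sol_def flow_segment_restriction by (auto simp: restriction_def)
qed

text \<open>A maximal solution of the restriction may cease to be maximal for \<open>H\<close>,
  where it can perhaps be continued outside \<open>\<Gamma>\<close>. Range bounds and convergence
  are inherited from its extension.\<close>

lemma restriction_solutions_extend:
  assumes "basic_assumptions H" "closed \<Gamma>" "x \<in> solutions (restriction H \<Gamma>) U"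
  obtains y where "y \<in> solutions H U" "x \<subseteq>\<^sub>m y"
proof (rule sol_extends_to_solutions[OF assms(1)])
  show "sol H x" "val x 0 0 \<in> U"
    using solutionsD[OF basic_assumptions_restriction[OF assms(1,2)] assms(3)] sol_restrictionD by auto
qed (rule that)

lemma stable_restriction:
  assumes "basic_assumptions H" "closed \<Delta>" "stable H \<Gamma>"
  shows "stable (restriction H \<Delta>) \<Gamma>"
  unfolding stable_def
proof (intro allI impI)
  fix e :: real assume "e > 0"
  then obtain d where d: "d > 0" "(\<Union>x\<in>solutions H (set_ball \<Gamma> d). ran x) \<subseteq> set_ball \<Gamma> e"
    using assms(3) unfolding stable_def by blast
  have "ran x \<subseteq> set_ball \<Gamma> e" if x: "x \<in> solutions (restriction H \<Delta>) (set_ball \<Gamma> d)" for x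
  proof -
    obtain y where "y \<in> solutions H (set_ball \<Gamma> d)" "x \<subseteq>\<^sub>m y"
      using restriction_solutions_extend[OF assms(1,2) x] by blast
    then show ?thesis using map_le_ran[of x y] d(2) by blast
  qed
  then show "\<exists>d>0. (\<Union>x\<in>solutions (restriction H \<Delta>) (set_ball \<Gamma> d). ran x) \<subseteq> set_ball \<Gamma> e"
    using d(1) by blast
qed

lemma basin_of_attraction_compact:
  "compact \<Gamma> \<Longrightarrow> p \<in> basin_of_attraction H \<Gamma> \<longleftrightarrow>
     (\<forall>x\<in>solutions H {p}. bounded_arc x \<and> (complete_arc x \<longrightarrow> converges_to x \<Gamma>))"
  by (simp add: basin_of_attraction_def)

lemma basin_of_attraction_restriction:
  assumes "basic_assumptions H" "closed \<Delta>" "compact \<Gamma>"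
  shows "basin_of_attraction H \<Gamma> \<subseteq> basin_of_attraction (restriction H \<Delta>) \<Gamma>"
proof
  fix p assume p: "p \<in> basin_of_attraction H \<Gamma>"
  show "p \<in> basin_of_attraction (restriction H \<Delta>) \<Gamma>"
    unfolding basin_of_attraction_compact[OF assms(3)]
  proof
    fix x assume "x \<in> solutions (restriction H \<Delta>) {p}"
    then obtain y where y: "y \<in> solutions H {p}" "x \<subseteq>\<^sub>m y"
      using restriction_solutions_extend[OF assms(1,2)] by blast
    then have "bounded_arc y" "complete_arc y \<Longrightarrow> converges_to y \<Gamma>"
      using p unfolding basin_of_attraction_compact[OF assms(3)] by auto
    then show "bounded_arc x \<and> (complete_arc x \<longrightarrow> converges_to x \<Gamma>)"
      using complete_arc_map_le[OF _ y(2)] converges_to_map_le[OF _ y(2)] bounded_subset[OF _ map_le_ran[OF y(2)]]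
      unfolding bounded_arc_def by blast
  qed
qed

lemma basin_of_attraction_mono:
  assumes "compact \<Gamma>" "\<Gamma> \<subseteq> \<Delta>"
  shows "basin_of_attraction H \<Gamma> \<subseteq> basin_of_attraction H \<Delta>"
proof
  fix p assume p: "p \<in> basin_of_attraction H \<Gamma>"
  have "(if compact \<Delta> then bounded_arc x else \<exists>M::real. \<forall>z\<in>ran x. setdistance z \<Delta> \<le> ereal M) \<and>
      (complete_arc x \<longrightarrow> converges_to x \<Delta>)" if x: "x \<in> solutions H {p}" for x
  proof -
    have b: "bounded_arc x" "complete_arc x \<Longrightarrow> converges_to x \<Gamma>"
      using p x unfolding basin_of_attraction_compact[OF assms(1)] by auto
    have "\<exists>M::real. \<forall>z\<in>ran x. setdistance z \<Delta> \<le> ereal M" if nc: "\<not> compact \<Delta>"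
    proof -
      \<comment> \<open>The empty set is compact, so \<open>\<Delta>\<close> has a point to measure
        the distance from.\<close>
      obtain y where y: "y \<in> \<Delta>" using nc compact_empty by fastforce
      obtain M where M: "\<And>z. z \<in> ran x \<Longrightarrow> dist y z \<le> M"
        using b(1) unfolding bounded_arc_def bounded_any_center[of _ y] by blast
      have "setdistance z \<Delta> \<le> ereal M" if "z \<in> ran x" for z
        unfolding setdistance_def using y M[OF that] by (intro INF_lower2[of y]) (auto simp: dist_commute)
      then show ?thesis by blast
    qed
    moreover have "converges_to x \<Delta>" if "converges_to x \<Gamma>"
      using that set_ball_mono[OF assms(2) order_refl] unfolding converges_to_iff by blast
    ultimately show ?thesis using b by auto
  qed
  then show "p \<in> basin_of_attraction H \<Delta>" unfolding basin_of_attraction_def by blast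
qed

lemma stable_imp_locally_stable_near:
  assumes "stable H \<Gamma>" "\<Gamma> \<subseteq> \<Delta>"
  shows "locally_stable_near H \<Delta> \<Gamma>"
  unfolding locally_stable_near_def
\<comment> \<open>Any positive radius would do.\<close>
proof (rule exI[of _ 1], intro conjI allI impI)
  fix e :: real assume "e > 0"
  then obtain d where d: "d > 0" "(\<Union>x\<in>solutions H (set_ball \<Gamma> d). ran x) \<subseteq> set_ball \<Gamma> e"
    using assms(1) unfolding stable_def by blast
  have "val x t j \<in> set_ball \<Delta> e" if "x \<in> solutions H (set_ball \<Gamma> d)" "(t, j) \<in> dom x" for x t j
    using d(2) that(1) val_in_ran[OF that(2)] set_ball_mono[OF assms(2) order_refl, of e] by blast
  then show "\<exists>d>0. \<forall>x\<in>solutions H (set_ball \<Gamma> d). \<forall>t j. (t, j) \<in> dom x \<longrightarrow>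
      (\<forall>s k. (s, k) \<in> dom x \<longrightarrow> s \<le> t \<longrightarrow> k \<le> j \<longrightarrow> the (x (s, k)) \<in> set_ball \<Gamma> 1) \<longrightarrow>
      the (x (t, j)) \<in> set_ball \<Delta> e"
    using d(1) by (intro exI[of _ d]) simp
qed simp

section \<open>Limits near a closed set and exit points\<close>

lemma compact_neighbourhood_in_open:
  fixes \<Gamma> :: "'a::heine_borel set"
  assumes "compact \<Gamma>" "open U" "\<Gamma> \<subseteq> U" "\<Gamma> \<noteq> {}"
  obtains r where "r > 0" "\<And>c. c \<le> r \<Longrightarrow> {x. infdist x \<Gamma> \<le> c} \<subseteq> U"
proof -
  obtain e where e: "e > 0" "(\<Union>x\<in>\<Gamma>. ball x e) \<subseteq> U"
    using compact_subset_open_imp_ball_epsilon_subset[OF assms(1-3)] by blast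
  show ?thesis
  proof (rule that[of "e / 2"])
    fix c assume "c \<le> e / 2"
    show "{x. infdist x \<Gamma> \<le> c} \<subseteq> U"
    proof
      fix x assume "x \<in> {x. infdist x \<Gamma> \<le> c}"
      then have "infdist x \<Gamma> < e" using \<open>c \<le> e / 2\<close> e(1) by simp
      then have "x \<in> set_ball \<Gamma> e" by (simp add: set_ball_infdist assms(4))
      then obtain y where "y \<in> \<Gamma>" "x \<in> ball y e" by (auto simp: mem_set_ball dist_commute)
      then show "x \<in> U" using e(2) by blast
    qed
  qed (use e in simp)
qed

lemma closed_infdist_le: "closed {x. infdist x \<Gamma> \<le> c}"
  by (intro closed_Collect_le continuous_intros)

text \<open>A point of the limit that is followed by a later one is approximated by points strictly
  before the ends \<open>(T i, J i)\<close>, since the approximations of the later point do not pass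
  these ends. There \<open>near\<close> applies, and closedness puts the limit value into
  \<open>\<Gamma>\<close>.\<close>

lemma relative_limit:
  fixes x :: "nat \<Rightarrow> 'a::euclidean_space arc"
  assumes H: "basic_assumptions H" and K: "compact K" and cl: "closed \<Gamma>"
    and x: "\<And>i. sol H (x i)" and TJ: "\<And>i. (T i, J i) \<in> dom (x i)"
    and inK: "\<And>i s k. (s, k) \<in> dom (x i) \<Longrightarrow> s \<le> T i \<Longrightarrow> k \<le> J i \<Longrightarrow> val (x i) s k \<in> K"
    and near: "\<And>e. e > 0 \<Longrightarrow> \<forall>\<^sub>F i in sequentially. \<forall>s k. (s, k) \<in> dom (x i) \<longrightarrow>
       s + real k < T i + real (J i) \<longrightarrow> val (x i) s k \<in> set_ball \<Gamma> e"
  obtains y \<phi> where "sol (restriction H \<Gamma>) y" "strict_mono (\<phi> :: nat \<Rightarrow> nat)"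
    "graphical_limit (\<lambda>i. x (\<phi> i)) (\<lambda>i. T (\<phi> i)) (\<lambda>i. J (\<phi> i)) y"
proof -
  obtain y \<phi> where y: "sol H y" and \<phi>: "strict_mono (\<phi> :: nat \<Rightarrow> nat)"
    and lim: "graphical_limit (\<lambda>i. x (\<phi> i)) (\<lambda>i. T (\<phi> i)) (\<lambda>i. J (\<phi> i)) y"
    by (rule solution_sequence_limit[OF H K x TJ inK]) (assumption | rule that)+
  note app = graphical_limitD(2)[OF lim]
  have "sol (restriction H \<Gamma>) y"
  proof (rule sol_restrictionI[OF y])
    fix t j t' j' assume tj: "(t, j) \<in> dom y" and tj': "(t', j') \<in> dom y" and less: "t + real j < t' + real j'"
    obtain s where s: "s \<longlonglongrightarrow> t" "\<forall>\<^sub>F i in sequentially. (s i, j) \<in> dom (x (\<phi> i)) \<and> s i \<le> T (\<phi> i) \<and> j \<le> J (\<phi> i)"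
      "(\<lambda>i. val (x (\<phi> i)) (s i) j) \<longlonglongrightarrow> val y t j" using app[OF tj] by blast
    obtain s' where s': "s' \<longlonglongrightarrow> t'" "\<forall>\<^sub>F i in sequentially. (s' i, j') \<in> dom (x (\<phi> i)) \<and> s' i \<le> T (\<phi> i) \<and> j' \<le> J (\<phi> i)"
      using app[OF tj'] by blast
    have "(\<lambda>i. s' i + real j' - (s i + real j)) \<longlonglongrightarrow> t' + real j' - (t + real j)"
      by (intro tendsto_intros s s')
    then have "\<forall>\<^sub>F i in sequentially. 0 < s' i + real j' - (s i + real j)"
      by (rule order_tendstoD) (use less in simp)
    then have early: "\<forall>\<^sub>F i in sequentially. s i + real j < T (\<phi> i) + real (J (\<phi> i))"
      using s'(2) by eventually_elim (auto simp: of_nat_mono)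
    show "val y t j \<in> \<Gamma>"
    proof (rule limit_in_closed_set[OF cl s(3)])
      fix e :: real assume "e > 0"
      from eventually_subseq[OF \<phi> near[OF this]] s(2) early
      show "\<forall>\<^sub>F i in sequentially. val (x (\<phi> i)) (s i) j \<in> set_ball \<Gamma> e"
        by eventually_elim blast
    qed
  qed
  from that[OF this \<phi> lim] show ?thesis .
qed

text \<open>If the last section has positive length, the exit point is a limit of values in the
  closed set \<open>W\<close>; otherwise it was reached by a jump from \<open>W\<close>. This keeps
  the exit points of a whole sequence of solutions in one bounded set.\<close>

lemma exit_point_mem:
  assumes x: "sol H x" and TJ: "(T, J) \<in> dom x" and ne: "0 < T + real J"
    and before: "\<And>s k. (s, k) \<in> dom x \<Longrightarrow> s + real k < T + real J \<Longrightarrow> val x s k \<in> W" and W: "closed W"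
  shows "val x T J \<in> W \<union> (\<Union>z\<in>W \<inter> jump_set H. jump_map H z)"
proof -
  note E = solD(1)[OF x]
  note L = jump_time_least[OF E TJ]
  show ?thesis
  proof (cases "jump_time (dom x) J < T")
    case True
    have "flow_segment H (\<lambda>t. val x t J) (jump_time (dom x) J) T" by (rule solD(2)[OF x True L(1) TJ])
    then have cont: "continuous_on {jump_time (dom x) J..T} (\<lambda>t. val x t J)" by (rule flow_segment_continuous)
    have "(\<lambda>t. val x t J) ` closure {jump_time (dom x) J..<T} \<subseteq> W"
    proof (rule image_closure_subset)
      show "continuous_on (closure {jump_time (dom x) J..<T}) (\<lambda>t. val x t J)" using cont True by simp
      show "(\<lambda>t. val x t J) ` {jump_time (dom x) J..<T} \<subseteq> W"
        using before hybrid_dom_convex[OF E L(1) TJ] by auto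
    qed (rule W)
    then show ?thesis using True by auto
  next
    case False
    then have T: "T = jump_time (dom x) J" using L(2) by simp
    \<comment> \<open>Level 0 begins at time 0, so a positive hybrid time at the start of a level
      was reached by a jump.\<close>
    then obtain k where k: "J = Suc k" using ne jump_time_0[OF E] by (cases J) auto
    then have Tk: "(T, k) \<in> dom x" using jump_time_Suc(1)[OF E, of T k] TJ T by simp
    then have "val x T k \<in> W" using before[of T k] k by simp
    then show ?thesis using solD(3,4)[OF x Tk] TJ k by auto
  qed
qed

section \<open>The reduction theorem\<close>

lemma basin_of_attractionD:
  assumes "p \<in> basin_of_attraction H \<Gamma>" "x \<in> solutions H {p}" "complete_arc x"
  shows "converges_to x \<Gamma>"
  using assms unfolding basin_of_attraction_def by blast

lemma complete_sol_converges:
  assumes H: "basic_assumptions H" and y: "sol H y" "complete_arc y" and b: "val y 0 0 \<in> basin_of_attraction H \<Gamma>"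
  shows "converges_to y \<Gamma>"
proof -
  obtain m where m: "m \<in> solutions H {val y 0 0}" "y \<subseteq>\<^sub>m m"
    using sol_extends_to_solutions[OF H y(1), of "{val y 0 0}"] by blast
  from basin_of_attractionD[OF b m(1) complete_arc_map_le[OF y(2) m(2)]] m(2)
  show ?thesis by (rule converges_to_map_le)
qed

text \<open>\<open>near\<close> is what local stability gives, with \<open>B\<close> a neighbourhood
  of the large set; its condition on the past is guaranteed strictly before the first exit. Looking
  for the last visit to \<open>A\<close> only up to that exit keeps the piece in \<open>U\<close>,
  and shifting makes the visit its initial point.\<close>

lemma escaping_segment:
  assumes x: "sol H x" and U: "open U" and A: "closed A" "A \<subseteq> U"
    and W: "closed W" "U \<subseteq> W" and ini: "val x 0 0 \<in> A" and bad: "(t0, j0) \<in> dom x" "val x t0 j0 \<notin> U"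
    and near: "\<And>t j. (t, j) \<in> dom x \<Longrightarrow>
       (\<And>s k. (s, k) \<in> dom x \<Longrightarrow> s \<le> t \<Longrightarrow> k \<le> j \<Longrightarrow> val x s k \<in> U) \<Longrightarrow> val x t j \<in> B"
  obtains z T J where "sol H z" "(T, J) \<in> dom z" "val z 0 0 \<in> A" "val z T J \<notin> U"
    "val z T J \<in> W \<union> (\<Union>z\<in>W \<inter> jump_set H. jump_map H z)"
    "\<And>t j. (t, j) \<in> dom z \<Longrightarrow> t + real j < T + real J \<Longrightarrow> val z t j \<in> U \<inter> B"
    "\<And>t j. (t, j) \<in> dom z \<Longrightarrow> 0 < t + real j \<Longrightarrow> t + real j \<le> T + real J \<Longrightarrow> val z t j \<notin> A"
proof -
  note E = solD(1)[OF x]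
  obtain T J where TJ: "(T, J) \<in> dom x" "val x T J \<notin> U"
    and inU: "\<And>s k. (s, k) \<in> dom x \<Longrightarrow> s + real k < T + real J \<Longrightarrow> val x s k \<in> U"
    using first_exit[OF x U bad] by blast
  obtain s k where sk: "(s, k) \<in> dom x" "s \<le> T" "k \<le> J" "val x s k \<in> A"
    and notA: "\<And>t j. (t, j) \<in> dom x \<Longrightarrow> s + real k < t + real j \<Longrightarrow> t + real j \<le> T + real J \<Longrightarrow> val x t j \<notin> A"
    using last_entry[OF x A(1) TJ(1) ini] by blast
  let ?z = "shift_arc s k x"
  \<comment> \<open>The solution starts in \<open>A\<close>, inside \<open>U\<close>, so the exit
    comes later.\<close>
  have "T + real J \<noteq> 0"
  proof
    assume "T + real J = 0"
    then have "T = 0" "J = 0" using hybrid_dom_nonneg[OF E TJ(1)] by (auto simp: add_nonneg_eq_0_iff)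
    then show False using TJ(2) ini A(2) by auto
  qed
  then have pos: "0 < T + real J" using hybrid_dom_nonneg[OF E TJ(1)] by (simp add: less_le)
  have valTJ: "val ?z (T - s) (J - k) = val x T J" using sk by (simp add: val_shift_arc)
  have zdom: "0 \<le> t \<and> (t + s, j + k) \<in> dom x \<and> val ?z t j = val x (t + s) (j + k)" if "(t, j) \<in> dom ?z" for t j
    using that by (simp add: dom_shift_arc val_shift_arc)
  show ?thesis
  proof (rule that[of ?z "T - s" "J - k"])
    show "sol H ?z" by (rule sol_shift_arc[OF x sk(1)])
    show "(T - s, J - k) \<in> dom ?z" using sk TJ by (simp add: dom_shift_arc)
    show "val ?z 0 0 \<in> A" using sk by (simp add: val_shift_arc)
    show "val ?z (T - s) (J - k) \<notin> U" using TJ valTJ by simp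
    have "val x T J \<in> W \<union> (\<Union>z\<in>W \<inter> jump_set H. jump_map H z)"
      by (rule exit_point_mem[OF x TJ(1) pos _ W(1)]) (use inU W(2) in blast)
    then show "val ?z (T - s) (J - k) \<in> W \<union> (\<Union>z\<in>W \<inter> jump_set H. jump_map H z)" using valTJ by simp
    show "val ?z t j \<in> U \<inter> B" if tj: "(t, j) \<in> dom ?z" "t + real j < T - s + real (J - k)" for t j
    proof -
      have d: "(t + s, j + k) \<in> dom x" and v: "val ?z t j = val x (t + s) (j + k)" using zdom[OF tj(1)] by auto
      have lt: "t + s + real (j + k) < T + real J" using tj(2) sk(3) by simp
      have "val x (t + s) (j + k) \<in> B"
      proof (rule near[OF d])
        fix s' k' assume s': "(s', k') \<in> dom x" "s' \<le> t + s" "k' \<le> j + k"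
        then have "real k' \<le> real (j + k)" by (simp only: of_nat_le_iff)
        then have "s' + real k' < T + real J" using s'(2) lt by linarith
        then show "val x s' k' \<in> U" by (rule inU[OF s'(1)])
      qed
      then show ?thesis using inU[OF d lt] v by simp
    qed
    show "val ?z t j \<notin> A" if tj: "(t, j) \<in> dom ?z" "0 < t + real j" "t + real j \<le> T - s + real (J - k)" for t j
      using zdom[OF tj(1)] notA[of "t + s" "j + k"] tj(2,3) sk(3) by simp
  qed
qed

lemma reduction_stable:
  fixes H :: "'a::euclidean_space hybrid_system"
  assumes H: "basic_assumptions H" and comp: "compact \<Gamma>" and cl: "closed \<Delta>"
    and st: "stable (restriction H \<Delta>) \<Gamma>" and att: "attractive (restriction H \<Delta>) \<Gamma>"
    and loc: "locally_stable_near H \<Delta> \<Gamma>"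
  shows "stable H \<Gamma>"
proof (cases "\<Gamma> = {}")
  case True
  \<comment> \<open>Every neighbourhood of the empty set is empty, so no solution starts
    there.\<close>
  then show ?thesis by (auto simp: stable_def solutions_def mem_set_ball intro!: exI[of _ 1])
next
  case ne: False
  let ?R = "restriction H \<Delta>"
  have R: "basic_assumptions ?R" using basic_assumptions_restriction[OF H cl] .
  show ?thesis
  proof (rule ccontr)
    assume "\<not> stable H \<Gamma>"
    then obtain \<epsilon> where \<epsilon>: "\<epsilon> > 0" "\<And>d. d > 0 \<Longrightarrow> \<exists>x\<in>solutions H (set_ball \<Gamma> d). \<not> ran x \<subseteq> set_ball \<Gamma> \<epsilon>"
      unfolding stable_def by blast
    obtain r where r: "r > 0" "\<And>e. e > 0 \<Longrightarrow> \<exists>d>0. \<forall>x\<in>solutions H (set_ball \<Gamma> d). \<forall>t j. (t, j) \<in> dom x \<longrightarrow>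
        (\<forall>s k. (s, k) \<in> dom x \<longrightarrow> s \<le> t \<longrightarrow> k \<le> j \<longrightarrow> val x s k \<in> set_ball \<Gamma> r) \<longrightarrow> val x t j \<in> set_ball \<Delta> e"
      using loc unfolding locally_stable_near_def by blast
    obtain e1 where e1: "e1 > 0" "\<And>c. c \<le> e1 \<Longrightarrow> {x. infdist x \<Gamma> \<le> c} \<subseteq> interior (basin_of_attraction ?R \<Gamma>)"
      using compact_neighbourhood_in_open[OF comp open_interior _ ne] att unfolding attractive_def by blast
    \<comment> \<open>At most \<open>\<epsilon>\<close> so that the bad solutions leave
      \<open>U\<close>, at most \<open>r\<close> so that local stability applies while they stay in
      \<open>U\<close>, and at most \<open>e1\<close> so that even the closed ball \<open>W\<close>
      lies in the relative basin.\<close>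
    define \<rho> where "\<rho> = min \<epsilon> (min r e1)"
    have \<rho>: "\<rho> > 0" "\<rho> \<le> \<epsilon>" "\<rho> \<le> r" "\<rho> \<le> e1" using \<epsilon>(1) r(1) e1(1) by (auto simp: \<rho>_def)
    define U W where "U = set_ball \<Gamma> \<rho>" and "W = {x. infdist x \<Gamma> \<le> \<rho>}"
    have Ueq: "U = {x. infdist x \<Gamma> < \<rho>}" unfolding U_def by (rule set_ball_infdist[OF ne])
    have U: "open U" "U \<subseteq> W" unfolding Ueq W_def using open_set_ball[of \<Gamma> \<rho>] Ueq by (auto simp: U_def)
    have W: "compact W" "closed W" "W \<subseteq> basin_of_attraction ?R \<Gamma>"
      using compact_infdist_le[OF ne comp \<rho>(1)] e1(2)[OF \<rho>(4)] interior_subset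
      by (auto simp: W_def compact_imp_closed)
    obtain \<delta>0 where \<delta>0: "\<delta>0 > 0" "(\<Union>x\<in>solutions ?R (set_ball \<Gamma> \<delta>0). ran x) \<subseteq> U"
      using st \<rho>(1) unfolding stable_def U_def by blast
    \<comment> \<open>Halving makes the closed ball \<open>A\<close> fit into the open balls of
      radius \<open>\<delta>0\<close> and \<open>\<rho>\<close>.\<close>
    define \<delta> where "\<delta> = min \<delta>0 \<rho> / 2"
    have \<delta>: "\<delta> > 0" "\<delta> < \<delta>0" "\<delta> < \<rho>" using \<delta>0(1) \<rho>(1) by (auto simp: \<delta>_def)
    define A where "A = {x. infdist x \<Gamma> \<le> \<delta>}"
    have A: "closed A" "A \<subseteq> U" "A \<subseteq> set_ball \<Gamma> \<delta>0" "A \<subseteq> W" "set_ball \<Gamma> \<delta> \<subseteq> A"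
      using \<delta> closed_infdist_le unfolding A_def Ueq W_def set_ball_infdist[OF ne] by auto
    \<comment> \<open>The exit may be a jump from \<open>W\<close>; local boundedness of the jump
      map makes the closure of all landing points compact.\<close>
    define K where "K = W \<union> closure (\<Union>z\<in>W \<inter> jump_set H. jump_map H z)"
    have K: "compact K" unfolding K_def
      by (intro compact_Un W(1) compact_closure[THEN iffD2] jump_map_bounded_on_compact[OF H W(1)])
    have "\<exists>z T J. sol H z \<and> (T, J) \<in> dom z \<and> val z 0 0 \<in> A \<and> val z T J \<notin> U \<and> val z T J \<in> K \<and>
        (\<forall>t j. (t, j) \<in> dom z \<longrightarrow> t + real j < T + real J \<longrightarrow> val z t j \<in> U \<inter> set_ball \<Delta> (1 / real (Suc i))) \<and>
        (\<forall>t j. (t, j) \<in> dom z \<longrightarrow> 0 < t + real j \<longrightarrow> t + real j \<le> T + real J \<longrightarrow> val z t j \<notin> A)" for i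
    proof -
      have "1 / real (Suc i) > 0" by simp
      from r(2)[OF this] obtain d where d: "d > 0" "\<And>x t j. x \<in> solutions H (set_ball \<Gamma> d) \<Longrightarrow> (t, j) \<in> dom x \<Longrightarrow>
        (\<And>s k. (s, k) \<in> dom x \<Longrightarrow> s \<le> t \<Longrightarrow> k \<le> j \<Longrightarrow> val x s k \<in> set_ball \<Gamma> r) \<Longrightarrow> val x t j \<in> set_ball \<Delta> (1 / real (Suc i))"
        by blast
      \<comment> \<open>The radius \<open>\<delta>\<close> puts the start into \<open>A\<close>, and
        \<open>d\<close> makes local stability apply with tolerance
        \<open>1 / real (Suc i)\<close>.\<close>
      obtain x where x: "x \<in> solutions H (set_ball \<Gamma> (min d \<delta>))" "\<not> ran x \<subseteq> set_ball \<Gamma> \<epsilon>"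
        using \<epsilon>(2)[of "min d \<delta>"] d(1) \<delta>(1) by auto
      have xd: "x \<in> solutions H (set_ball \<Gamma> d)"
        using x(1) solutions_mono[OF set_ball_mono[OF order_refl min.cobounded1]] by blast
      have "set_ball \<Gamma> (min d \<delta>) \<subseteq> A"
        using set_ball_mono[OF order_refl min.cobounded2] A(5) by blast
      then have ini: "val x 0 0 \<in> A" using solutionsD(2)[OF H x(1)] by blast
      have UE: "U \<subseteq> set_ball \<Gamma> \<epsilon>" "U \<subseteq> set_ball \<Gamma> r" unfolding U_def using \<rho> by (simp_all add: set_ball_mono)
      obtain w where w: "w \<in> ran x" "w \<notin> set_ball \<Gamma> \<epsilon>" using x(2) by blast
      obtain t0 j0 where t0: "(t0, j0) \<in> dom x" "w = val x t0 j0" using w(1) by (rule ran_arcE)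
      then have bad: "(t0, j0) \<in> dom x" "val x t0 j0 \<notin> U" using w(2) UE(1) by auto
      show ?thesis
      proof (rule escaping_segment[OF solutionsD(1)[OF H x(1)] U(1) A(1,2) W(2) U(2) ini bad, of "set_ball \<Delta> (1 / real (Suc i))"])
        fix t j assume "(t, j) \<in> dom x" "\<And>s k. (s, k) \<in> dom x \<Longrightarrow> s \<le> t \<Longrightarrow> k \<le> j \<Longrightarrow> val x s k \<in> U"
        then show "val x t j \<in> set_ball \<Delta> (1 / real (Suc i))" using d(2)[OF xd] UE(2) by blast
      next
        fix z T J
        assume z: "sol H z" "(T, J) \<in> dom z" "val z 0 0 \<in> A" "val z T J \<notin> U"
          and zK: "val z T J \<in> W \<union> (\<Union>z\<in>W \<inter> jump_set H. jump_map H z)"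
          and zU: "\<And>t j. (t, j) \<in> dom z \<Longrightarrow> t + real j < T + real J \<Longrightarrow> val z t j \<in> U \<inter> set_ball \<Delta> (1 / real (Suc i))"
          and zA: "\<And>t j. (t, j) \<in> dom z \<Longrightarrow> 0 < t + real j \<Longrightarrow> t + real j \<le> T + real J \<Longrightarrow> val z t j \<notin> A"
        have "W \<union> (\<Union>z\<in>W \<inter> jump_set H. jump_map H z) \<subseteq> K"
          unfolding K_def by (rule Un_mono[OF order_refl closure_subset])
        then have "val z T J \<in> K" using zK by (rule subsetD)
        with z show ?thesis
          by (intro exI[of _ z] exI[of _ T] exI[of _ J] conjI allI impI zU zA) assumption+
      qed
    qed
    then obtain z T J where z: "\<And>i. sol H (z i)" "\<And>i. (T i, J i) \<in> dom (z i)" "\<And>i. val (z i) 0 0 \<in> A"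
        "\<And>i. val (z i) (T i) (J i) \<notin> U" "\<And>i. val (z i) (T i) (J i) \<in> K"
      and zU: "\<And>i t j. (t, j) \<in> dom (z i) \<Longrightarrow> t + real j < T i + real (J i) \<Longrightarrow> val (z i) t j \<in> U \<inter> set_ball \<Delta> (1 / real (Suc i))"
      and zA: "\<And>i t j. (t, j) \<in> dom (z i) \<Longrightarrow> 0 < t + real j \<Longrightarrow> t + real j \<le> T i + real (J i) \<Longrightarrow> val (z i) t j \<notin> A"
      by metis
    have inK: "val (z i) s k \<in> K" if "(s, k) \<in> dom (z i)" "s \<le> T i" "k \<le> J i" for i s k
    proof (cases "s = T i \<and> k = J i")
      case True then show ?thesis using z(5) by simp
    next
      case False
      then have "s + real k < T i + real (J i)" using that(2,3) by (cases "k = J i") auto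
      then show ?thesis using zU[OF that(1)] U(2) unfolding K_def by blast
    qed
    have near: "\<forall>\<^sub>F i in sequentially. \<forall>s k. (s, k) \<in> dom (z i) \<longrightarrow> s + real k < T i + real (J i) \<longrightarrow> val (z i) s k \<in> set_ball \<Delta> e"
      if e: "e > 0" for e
    proof -
      obtain n where n: "1 / real (Suc n) < e" using nat_approx_posE[OF e] by blast
      show ?thesis
        unfolding eventually_sequentially
      proof (intro exI[of _ n] allI impI)
        fix i s k assume i: "n \<le> i" and s: "(s, k) \<in> dom (z i)" "s + real k < T i + real (J i)"
        have "1 / real (Suc i) \<le> 1 / real (Suc n)" using i by (intro divide_left_mono) auto
        then have "1 / real (Suc i) \<le> e" using n by linarith
        then show "val (z i) s k \<in> set_ball \<Delta> e"
          using zU[OF s] set_ball_mono[OF order_refl, of "1 / real (Suc i)" e \<Delta>] by blast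
      qed
    qed
    obtain y \<phi> where y: "sol ?R y" and \<phi>: "strict_mono (\<phi> :: nat \<Rightarrow> nat)"
      and lim: "graphical_limit (\<lambda>i. z (\<phi> i)) (\<lambda>i. T (\<phi> i)) (\<lambda>i. J (\<phi> i)) y"
      by (rule relative_limit[OF H K cl z(1,2) inK near]) (assumption | rule that)+
    note ini = graphical_limitD(1)[OF lim] and app = graphical_limitD(2)[OF lim] and fin = graphical_limitD(3)[OF lim]
    have y0: "val y 0 0 \<in> A" using closed_sequentially[OF A(1) _ ini] z(3) by blast
    from fin show False
    proof (elim disjE exE conjE)
      fix t j assume tj: "(t, j) \<in> dom y" and lim: "(\<lambda>i. val (z (\<phi> i)) (T (\<phi> i)) (J (\<phi> i))) \<longlonglongrightarrow> val y t j"
      \<comment> \<open>The exit points survive in the limit: it starts in \<open>A\<close> and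
        leaves \<open>U\<close>, against the choice of \<open>\<delta>0\<close>.\<close>
      have "closed (- U)" using U(1) unfolding closed_def by simp
      from closed_sequentially[OF this _ lim] z(4) have "val y t j \<notin> U" by simp
      moreover obtain m where m: "m \<in> solutions ?R (set_ball \<Gamma> \<delta>0)" "y \<subseteq>\<^sub>m m"
        using sol_extends_to_solutions[OF R y, of "set_ball \<Gamma> \<delta>0"] y0 A(3) by blast
      moreover have "val y t j \<in> ran m" using val_in_ran[OF tj] map_le_ran[OF m(2)] by blast
      ultimately show False using \<delta>0(2) by blast
    next
      assume c: "complete_arc y"
      have "val y 0 0 \<in> basin_of_attraction ?R \<Gamma>" using y0 A(4) W(3) by blast
      from complete_sol_converges[OF R y c this] obtain n where n: "\<And>t j. (t, j) \<in> dom y \<Longrightarrow> n \<le> t + real j \<Longrightarrow> val y t j \<in> set_ball \<Gamma> \<delta>"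
        using \<delta>(1) unfolding converges_to_iff by blast
      \<comment> \<open>Beyond \<open>n\<close> the limit is back within \<open>\<delta>\<close> of
        \<open>\<Gamma>\<close>. The 1 ensures positive hybrid time, since the pieces avoid
        \<open>A\<close> only after their start.\<close>
      obtain t j where tj: "(t, j) \<in> dom y" "max n 1 \<le> t + real j"
        using c unfolding complete_arc_iff[OF solD(1)[OF y]] by blast
      then have inball: "val y t j \<in> set_ball \<Gamma> \<delta>" using n by simp
      obtain s where s: "s \<longlonglongrightarrow> t" "\<forall>\<^sub>F i in sequentially. (s i, j) \<in> dom (z (\<phi> i)) \<and> s i \<le> T (\<phi> i) \<and> j \<le> J (\<phi> i)"
        "(\<lambda>i. val (z (\<phi> i)) (s i) j) \<longlonglongrightarrow> val y t j" using app[OF tj(1)] by blast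
      have "\<forall>\<^sub>F i in sequentially. val (z (\<phi> i)) (s i) j \<in> set_ball \<Gamma> \<delta>"
        using topological_tendstoD[OF s(3) open_set_ball inball] .
      moreover have "(\<lambda>i. s i + real j) \<longlonglongrightarrow> t + real j" by (intro tendsto_intros s)
      then have "\<forall>\<^sub>F i in sequentially. 0 < s i + real j" by (rule order_tendstoD) (use tj(2) in simp)
      ultimately have "\<forall>\<^sub>F i in sequentially. False"
        using s(2)
      proof eventually_elim
        case (elim i)
        have "s i + real j \<le> T (\<phi> i) + real (J (\<phi> i))" using elim by (intro add_mono) auto
        then have "val (z (\<phi> i)) (s i) j \<notin> A" using zA[of "s i" j "\<phi> i"] elim by blast
        then show ?case using elim(1) A(5) by blast
      qed
      then show False by simp
    qed
  qed
qed

text \<open>Stated for any compact \<open>K\<close> in the relative basin, so that it serves the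
  local case with a closed ball and the global case with the closure of a bounded range. A limit of
  tails yields a single visit near \<open>\<Gamma>\<close>; turning visits into convergence is left
  to stability.\<close>

lemma complete_solution_approaches:
  fixes H :: "'a::euclidean_space hybrid_system"
  assumes H: "basic_assumptions H" and comp: "compact \<Gamma>" and cl: "closed \<Delta>"
    and K: "compact K" "K \<subseteq> basin_of_attraction (restriction H \<Delta>) \<Gamma>"
    and x: "sol H x" "complete_arc x" "ran x \<subseteq> K" "converges_to x \<Delta>" and \<delta>: "0 < \<delta>"
  shows "\<exists>t j. (t, j) \<in> dom x \<and> val x t j \<in> set_ball \<Gamma> \<delta>"
proof (rule ccontr)
  assume no: "\<not> ?thesis"
  let ?R = "restriction H \<Delta>"
  have R: "basic_assumptions ?R" using basic_assumptions_restriction[OF H cl] .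
  note E = solD(1)[OF x(1)]
  have late: "\<exists>t j. (t, j) \<in> dom x \<and> n \<le> t + real j" for n using x(2) unfolding complete_arc_iff[OF E] by blast
  \<comment> \<open>The \<open>i\<close>-th piece starts at hybrid time \<open>i\<close> or later,
    so the pieces approach \<open>\<Delta>\<close>; it lasts at least \<open>i\<close>, so the limit
    must be complete.\<close>
  have "\<exists>s k T J. (s, k) \<in> dom x \<and> real i \<le> s + real k \<and> (T, J) \<in> dom x \<and> s \<le> T \<and> k \<le> J \<and> s + real k + real i \<le> T + real J" for i
  proof -
    obtain s k where sk: "(s, k) \<in> dom x" "real i \<le> s + real k" using late by blast
    obtain T J where TJ: "(T, J) \<in> dom x" "s + real k + real i \<le> T + real J" using late by blast
    then have "s + real k \<le> T + real J" by linarith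
    from hybrid_dom_order[OF E sk(1) TJ(1) this] show ?thesis using sk TJ by blast
  qed
  then obtain s k T J where sk: "\<And>i. (s i, k i) \<in> dom x" "\<And>i. real i \<le> s i + real (k i)"
    and TJ: "\<And>i. (T i, J i) \<in> dom x" "\<And>i. s i \<le> T i" "\<And>i. k i \<le> J i" "\<And>i. s i + real (k i) + real i \<le> T i + real (J i)"
    by metis
  define z where "z i = shift_arc (s i) (k i) x" for i
  define T' J' where "T' i = T i - s i" and "J' i = J i - k i" for i
  have zdom: "0 \<le> t \<and> (t + s i, j + k i) \<in> dom x \<and> val (z i) t j = val x (t + s i) (j + k i)" if "(t, j) \<in> dom (z i)" for t j i
    using that by (simp add: z_def dom_shift_arc val_shift_arc)
  have zsol: "sol H (z i)" for i unfolding z_def by (rule sol_shift_arc[OF x(1) sk(1)])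
  have zend: "(T' i, J' i) \<in> dom (z i)" for i using TJ(1-3)[of i] by (simp add: z_def T'_def J'_def dom_shift_arc)
  have long: "real i \<le> T' i + real (J' i)" for i using TJ(3,4)[of i] by (simp add: T'_def J'_def of_nat_diff)
  have inK: "val (z i) t j \<in> K" if "(t, j) \<in> dom (z i)" for i t j
    using zdom[OF that] val_in_ran x(3) by (metis subsetD)
  have near: "\<forall>\<^sub>F i in sequentially. \<forall>t j. (t, j) \<in> dom (z i) \<longrightarrow> t + real j < T' i + real (J' i) \<longrightarrow> val (z i) t j \<in> set_ball \<Delta> e"
    if e: "e > 0" for e
  proof -
    obtain n where n: "\<And>t j. (t, j) \<in> dom x \<Longrightarrow> n \<le> t + real j \<Longrightarrow> val x t j \<in> set_ball \<Delta> e"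
      using x(4) e unfolding converges_to_iff by blast
    obtain N :: nat where N: "n \<le> real N" using real_arch_simple by blast
    show ?thesis
      unfolding eventually_sequentially
    proof (intro exI[of _ N] allI impI)
      fix i t j assume i: "N \<le> i" and t: "(t, j) \<in> dom (z i)"
      have "n \<le> t + s i + real (j + k i)" using N i sk(2)[of i] zdom[OF t] by simp
      then show "val (z i) t j \<in> set_ball \<Delta> e" using n zdom[OF t] by simp
    qed
  qed
  obtain y \<phi> where y: "sol ?R y" and \<phi>: "strict_mono (\<phi> :: nat \<Rightarrow> nat)"
    and lim: "graphical_limit (\<lambda>i. z (\<phi> i)) (\<lambda>i. T' (\<phi> i)) (\<lambda>i. J' (\<phi> i)) y"
    by (rule relative_limit[OF H K(1) cl zsol zend inK near]) (assumption | rule that)+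
  note ini = graphical_limitD(1)[OF lim] and app = graphical_limitD(2)[OF lim] and fin = graphical_limitD(3)[OF lim]
  have "val (z i) 0 0 \<in> K" for i by (rule inK[OF hybrid_dom_zero[OF solD(1)[OF zsol]]])
  then have y0: "val y 0 0 \<in> K" using closed_sequentially[OF compact_imp_closed[OF K(1)] _ ini] by blast
  from fin show False
  proof (elim disjE exE conjE)
    fix t j assume T: "(\<lambda>i. T' (\<phi> i)) \<longlonglongrightarrow> t" and J: "\<forall>\<^sub>F i in sequentially. J' (\<phi> i) = j"
    \<comment> \<open>Convergent end points contradict the growing lengths of the pieces, as
      \<open>i \<le> \<phi> i\<close>.\<close>
    obtain N :: nat where N: "t + 1 + real j \<le> real N" using real_arch_simple by blast
    have "\<forall>\<^sub>F i in sequentially. T' (\<phi> i) < t + 1" using T by (rule order_tendstoD) simp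
    with J eventually_ge_at_top[of N] have "\<forall>\<^sub>F i in sequentially. False"
    proof eventually_elim
      case (elim i)
      have "i \<le> \<phi> i" using \<phi> by (rule seq_suble)
      then have "real N \<le> real (\<phi> i)" using elim by simp
      then show ?case using long[of "\<phi> i"] elim N by simp
    qed
    then show False by simp
  next
    assume c: "complete_arc y"
    have "val y 0 0 \<in> basin_of_attraction ?R \<Gamma>" using y0 K(2) by blast
    from complete_sol_converges[OF R y c this] obtain n where n: "\<And>t j. (t, j) \<in> dom y \<Longrightarrow> n \<le> t + real j \<Longrightarrow> val y t j \<in> set_ball \<Gamma> \<delta>"
      using \<delta> unfolding converges_to_iff by blast
    obtain t j where tj: "(t, j) \<in> dom y" "n \<le> t + real j"
      using c unfolding complete_arc_iff[OF solD(1)[OF y]] by blast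
    obtain u where u: "\<forall>\<^sub>F i in sequentially. (u i, j) \<in> dom (z (\<phi> i)) \<and> u i \<le> T' (\<phi> i) \<and> j \<le> J' (\<phi> i)"
      "(\<lambda>i. val (z (\<phi> i)) (u i) j) \<longlonglongrightarrow> val y t j" using app[OF tj(1)] by blast
    have "\<forall>\<^sub>F i in sequentially. val (z (\<phi> i)) (u i) j \<in> set_ball \<Gamma> \<delta>"
      using topological_tendstoD[OF u(2) open_set_ball n[OF tj]] .
    then have "\<forall>\<^sub>F i in sequentially. False"
      using u(1)
    proof eventually_elim
      case (elim i)
      then show ?case using no zdom[of "u i" j "\<phi> i"] by auto
    qed
    then show False by simp
  qed
qed

text \<open>After one visit to the \<open>d\<close>-neighbourhood, the tail extends to a maximal
  solution starting there, and stability confines it for good.\<close>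

lemma stable_approach_imp_converges:
  assumes H: "basic_assumptions H" and st: "stable H \<Gamma>" and x: "sol H x"
    and app: "\<And>d. 0 < d \<Longrightarrow> \<exists>t j. (t, j) \<in> dom x \<and> val x t j \<in> set_ball \<Gamma> d"
  shows "converges_to x \<Gamma>"
  unfolding converges_to_iff
proof (intro allI impI)
  fix e :: real assume "e > 0"
  then obtain d where d: "d > 0" "(\<Union>x\<in>solutions H (set_ball \<Gamma> d). ran x) \<subseteq> set_ball \<Gamma> e"
    using st unfolding stable_def by blast
  obtain s k where sk: "(s, k) \<in> dom x" "val x s k \<in> set_ball \<Gamma> d" using app[OF d(1)] by blast
  let ?z = "shift_arc s k x"
  have "val ?z 0 0 \<in> set_ball \<Gamma> d" using sk(2) by (simp add: val_shift_arc)
  then obtain m where m: "m \<in> solutions H (set_ball \<Gamma> d)" "?z \<subseteq>\<^sub>m m"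
    using sol_extends_to_solutions[OF H sol_shift_arc[OF x sk(1)]] by blast
  have "val x t j \<in> set_ball \<Gamma> e" if tj: "(t, j) \<in> dom x" "s + real k \<le> t + real j" for t j
  proof -
    note le = hybrid_dom_order[OF solD(1)[OF x] sk(1) tj]
    have "(t - s, j - k) \<in> dom ?z" using tj le by (simp add: dom_shift_arc)
    from val_in_ran[OF this] have "val x t j \<in> ran ?z" using le by (simp add: val_shift_arc)
    then show ?thesis using map_le_ran[OF m(2)] m(1) d(2) by blast
  qed
  then show "\<exists>n. \<forall>t j. (t, j) \<in> dom x \<longrightarrow> n \<le> t + real j \<longrightarrow> val x t j \<in> set_ball \<Gamma> e" by blast
qed

lemma reduction_attractive:
  fixes H :: "'a::euclidean_space hybrid_system"
  assumes H: "basic_assumptions H" and comp: "compact \<Gamma>" and cl: "closed \<Delta>"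
    and st: "stable H \<Gamma>" and att: "attractive (restriction H \<Delta>) \<Gamma>"
    and loc: "locally_attractive_near H \<Delta> \<Gamma>"
  shows "attractive H \<Gamma>"
proof (cases "\<Gamma> = {}")
  case True
  then show ?thesis by (simp add: attractive_def)
next
  case ne: False
  let ?R = "restriction H \<Delta>"
  obtain e where e: "e > 0" "\<And>c. c \<le> e \<Longrightarrow> {x. infdist x \<Gamma> \<le> c} \<subseteq> interior (basin_of_attraction ?R \<Gamma>)"
    using compact_neighbourhood_in_open[OF comp open_interior _ ne] att unfolding attractive_def by blast
  let ?W = "{x. infdist x \<Gamma> \<le> e}"
  have W: "compact ?W" "?W \<subseteq> basin_of_attraction ?R \<Gamma>"
    using compact_infdist_le[OF ne comp e(1)] e(2)[OF order_refl] interior_subset by auto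
  obtain d where d: "d > 0" "(\<Union>x\<in>solutions H (set_ball \<Gamma> d). ran x) \<subseteq> set_ball \<Gamma> e"
    using st e(1) unfolding stable_def by blast
  obtain r where r: "r > 0" "set_ball \<Gamma> r \<subseteq> basin_of_attraction H \<Delta>"
    using loc unfolding locally_attractive_near_def by blast
  \<comment> \<open>The radius \<open>d\<close> confines the solutions to the compact set
    \<open>?W\<close> by stability, and \<open>r\<close> makes the complete ones converge to
    \<open>\<Delta>\<close>.\<close>
  let ?B = "set_ball \<Gamma> (min d r)"
  have "?B \<subseteq> basin_of_attraction H \<Gamma>"
  proof
    fix p assume p: "p \<in> ?B"
    then have pd: "p \<in> set_ball \<Gamma> d" and pr: "p \<in> basin_of_attraction H \<Delta>"
      using set_ball_mono[OF order_refl min.cobounded1] set_ball_mono[OF order_refl min.cobounded2] r(2) by blast+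
    show "p \<in> basin_of_attraction H \<Gamma>"
      unfolding basin_of_attraction_compact[OF comp]
    proof
      fix x assume x: "x \<in> solutions H {p}"
      have "x \<in> solutions H (set_ball \<Gamma> d)" using x pd solutions_mono[of "{p}" "set_ball \<Gamma> d" H] by blast
      then have "ran x \<subseteq> set_ball \<Gamma> e" using d(2) by blast
      then have rW: "ran x \<subseteq> ?W" unfolding set_ball_infdist[OF ne] by force
      have sx: "sol H x" using solutionsD(1)[OF H x] .
      have "converges_to x \<Gamma>" if "complete_arc x"
        using complete_solution_approaches[OF H comp cl W sx that rW basin_of_attractionD[OF pr x that]]
        by (rule stable_approach_imp_converges[OF H st sx])
      then show "bounded_arc x \<and> (complete_arc x \<longrightarrow> converges_to x \<Gamma>)"
        unfolding bounded_arc_def using bounded_subset[OF compact_imp_bounded[OF W(1)] rW] by blast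
    qed
  qed
  then have "?B \<subseteq> interior (basin_of_attraction H \<Gamma>)" by (rule interior_maximal[OF _ open_set_ball])
  then show ?thesis unfolding attractive_def using subset_set_ball[of "min d r" \<Gamma>] d(1) r(1) by auto
qed

theorem mainTheorem3:
  fixes H :: "(real ^ 'n) hybrid_system"
    and \<Gamma>\<^sub>1 \<Gamma>\<^sub>2 :: "(real ^ 'n) set"
  assumes "basic_assumptions H"
    and "\<Gamma>\<^sub>1 \<subseteq> \<Gamma>\<^sub>2"
    and "compact \<Gamma>\<^sub>1"
    and "closed \<Gamma>\<^sub>2"
  shows "(asymptotically_stable H \<Gamma>\<^sub>1 \<longleftrightarrow>
            asymptotically_stable (restriction H \<Gamma>\<^sub>2) \<Gamma>\<^sub>1 \<and>
            locally_stable_near H \<Gamma>\<^sub>2 \<Gamma>\<^sub>1 \<and>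
            locally_attractive_near H \<Gamma>\<^sub>2 \<Gamma>\<^sub>1) \<and>
         (globally_asymptotically_stable H \<Gamma>\<^sub>1 \<longleftrightarrow>
            globally_asymptotically_stable (restriction H \<Gamma>\<^sub>2) \<Gamma>\<^sub>1 \<and>
            locally_stable_near H \<Gamma>\<^sub>2 \<Gamma>\<^sub>1 \<and>
            globally_attractive H \<Gamma>\<^sub>2 \<and>
            (\<forall>x\<in>solutions H UNIV. bounded_arc x))"
proof -
  note H = assms(1) and sub = assms(2) and comp = assms(3) and cl = assms(4)
  let ?R = "restriction H \<Gamma>\<^sub>2"
  \<comment> \<open>Both necessity directions rest on these inclusions: the basin of a compact set
    can only grow when the system is restricted or the set is enlarged.\<close>
  note basins = basin_of_attraction_restriction[OF H cl comp] basin_of_attraction_mono[OF comp sub, of H]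
  have "asymptotically_stable ?R \<Gamma>\<^sub>1 \<and> locally_stable_near H \<Gamma>\<^sub>2 \<Gamma>\<^sub>1 \<and> locally_attractive_near H \<Gamma>\<^sub>2 \<Gamma>\<^sub>1"
    if as: "asymptotically_stable H \<Gamma>\<^sub>1"
  proof -
    have st: "stable H \<Gamma>\<^sub>1" and att: "\<Gamma>\<^sub>1 \<subseteq> interior (basin_of_attraction H \<Gamma>\<^sub>1)"
      using as by (auto simp: asymptotically_stable_def attractive_def)
    have "locally_attractive_near H \<Gamma>\<^sub>2 \<Gamma>\<^sub>1"
    proof -
      obtain e where e: "e > 0" "(\<Union>x\<in>\<Gamma>\<^sub>1. ball x e) \<subseteq> interior (basin_of_attraction H \<Gamma>\<^sub>1)"
        using compact_subset_open_imp_ball_epsilon_subset[OF comp open_interior att] by blast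
      have "set_ball \<Gamma>\<^sub>1 e \<subseteq> (\<Union>x\<in>\<Gamma>\<^sub>1. ball x e)" by (auto simp: mem_set_ball dist_commute)
      then show ?thesis unfolding locally_attractive_near_def
        using e basins(2) interior_subset by (intro exI[of _ e]) blast
    qed
    then show ?thesis
      using stable_restriction[OF H cl st] stable_imp_locally_stable_near[OF st sub] att interior_mono[OF basins(1)]
      by (auto simp: asymptotically_stable_def attractive_def)
  qed
  moreover have "asymptotically_stable H \<Gamma>\<^sub>1"
    if "asymptotically_stable ?R \<Gamma>\<^sub>1" "locally_stable_near H \<Gamma>\<^sub>2 \<Gamma>\<^sub>1" "locally_attractive_near H \<Gamma>\<^sub>2 \<Gamma>\<^sub>1"
    using that reduction_stable[OF H comp cl] reduction_attractive[OF H comp cl]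
    unfolding asymptotically_stable_def by blast
  moreover have "globally_asymptotically_stable ?R \<Gamma>\<^sub>1 \<and> locally_stable_near H \<Gamma>\<^sub>2 \<Gamma>\<^sub>1 \<and>
      globally_attractive H \<Gamma>\<^sub>2 \<and> (\<forall>x\<in>solutions H UNIV. bounded_arc x)"
    if gas: "globally_asymptotically_stable H \<Gamma>\<^sub>1"
  proof -
    have st: "stable H \<Gamma>\<^sub>1" and att: "basin_of_attraction H \<Gamma>\<^sub>1 = UNIV"
      using gas by (auto simp: globally_asymptotically_stable_def globally_attractive_def)
    have "bounded_arc x" if "x \<in> solutions H UNIV" for x
    proof -
      have "val x 0 0 \<in> basin_of_attraction H \<Gamma>\<^sub>1" using att by simp
      then show ?thesis using solutions_singleton[OF that] unfolding basin_of_attraction_compact[OF comp] by blast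
    qed
    then show ?thesis
      using stable_restriction[OF H cl st] stable_imp_locally_stable_near[OF st sub] basins att
      by (auto simp: globally_asymptotically_stable_def globally_attractive_def)
  qed
  moreover have "globally_asymptotically_stable H \<Gamma>\<^sub>1"
    if gas: "globally_asymptotically_stable ?R \<Gamma>\<^sub>1" and loc: "locally_stable_near H \<Gamma>\<^sub>2 \<Gamma>\<^sub>1"
      and att2: "globally_attractive H \<Gamma>\<^sub>2" and bdd: "\<forall>x\<in>solutions H UNIV. bounded_arc x"
  proof -
    have stR: "stable ?R \<Gamma>\<^sub>1" and attR: "basin_of_attraction ?R \<Gamma>\<^sub>1 = UNIV"
      using gas by (auto simp: globally_asymptotically_stable_def globally_attractive_def)
    \<comment> \<open>Relative attractivity in the local sense is immediate here, as the interior of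
      the whole space is everything.\<close>
    have st: "stable H \<Gamma>\<^sub>1" by (rule reduction_stable[OF H comp cl stR _ loc]) (simp add: attractive_def attR)
    have "p \<in> basin_of_attraction H \<Gamma>\<^sub>1" for p
      unfolding basin_of_attraction_compact[OF comp]
    proof
      fix x assume x: "x \<in> solutions H {p}"
      have sx: "sol H x" using solutionsD(1)[OF H x] .
      have b: "bounded_arc x" using bdd x solutions_mono[of "{p}" UNIV H] by blast
      \<comment> \<open>The bounded range provides the compact set, which lies in the relative basin
        because that is the whole space.\<close>
      then have K: "compact (closure (ran x))" by (simp add: bounded_arc_def compact_closure)
      have "converges_to x \<Gamma>\<^sub>1" if c: "complete_arc x"
      proof (rule stable_approach_imp_converges[OF H st sx])
        have "p \<in> basin_of_attraction H \<Gamma>\<^sub>2" using att2 by (simp add: globally_attractive_def)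
        from basin_of_attractionD[OF this x c]
        show "\<exists>t j. (t, j) \<in> dom x \<and> val x t j \<in> set_ball \<Gamma>\<^sub>1 d" if "0 < d" for d
          using that by (intro complete_solution_approaches[OF H comp cl K _ sx c closure_subset]) (simp add: attR)
      qed
      then show "bounded_arc x \<and> (complete_arc x \<longrightarrow> converges_to x \<Gamma>\<^sub>1)" using b by blast
    qed
    then show ?thesis using st by (auto simp: globally_asymptotically_stable_def globally_attractive_def)
  qed
  ultimately show ?thesis by blast
qed

end
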